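(* Let $R$ be a unital ring and $\Gamma$ a discrete amenable group. Let $\ell$ be an $R$-weak length function with the strong quotient property, and suppose that $\ell$ can be upgraded to a proper bivariant $R$-weak length function (i.e. $\ell$ has a proper upgrading $\ell(\cdot,\cdot|\cdot)$). Then for any locally $\ell$-finite $R\Gamma$-modules $\mathcal M_1\subseteq\mathcal M_2\subseteq\mathcal M_3$, $$\mathrm{m}\ell(\mathcal M_2|\mathcal M_3)=\mathrm{m}\ell(\mathcal M_1|\mathcal M_3)+\mathrm{m}\ell(\mathcal M_2/\mathcal M_1\,|\,\mathcal M_3/\mathcal M_1).$$ In particular, if moreover $\ell$ is independent of ambient modules, then for any locally $\ell$-finite $R\Gamma$-modules $\mathcal M_1\subseteq\mathcal M_2$, $$\mathrm{m}\ell(\mathcal M_2)=\mathrm{m}\ell(\mathcal M_1)+\mathrm{m}\ell(\mathcal M_2/\mathcal M_1).$$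
   Context: All modules are left modules. $\mathcal F(S)$ is the set of nonempty finite subsets of a set $S$; for an abelian group $G$, $\mathcal F^0(G)$ is the set of finite subsets of $G$ containing $0$. $A+B=\{a+b:a\in A,b\in B\}$. **$R$-weak length function.** A map $\ell$ assigning to each pair $(A,\mathcal M)$, with $\mathcal M$ an $R$-module and $A\subseteq\mathcal M$ a nonempty subset, a value $\ell(A|\mathcal M)\in[0,+\infty]$ such that: (1) $\ell(\{0\}|\mathcal M)=0$ for every $\mathcal M$; (2) $\ell(A\times B|\mathcal M\times\mathcal N)=\ell(A|\mathcal M)+\ell(B|\mathcal N)$; (3) $\ell(A|\mathcal M)\ge \ell(\varphi(A)|\mathcal N)$ for every $R$-module homomorphism $\varphi:\mathcal M\to\mathcal N$ and nonempty $A\subseteq\mathcal M$; (4) if $(A_n)$ is an increasing directed family of nonempty subsets of $\mathcal M$ with union $A$, then $\ell(A_n|\mathcal M)$ increases to $\ell(A|\mathcal M)$ (in particular $A_1\subseteq A_2\subseteq \mathcal M$ implies $\ell(A_1|\mathcal M)\le\ell(A_2|\mathcal M)$). $\ell$ has the **strong quotient property** if for every $R$-module homomorphism $\varphi:\mathcal M\to\mathcal N$, every $A\in\mathcal F^0(\mathcal M)$ and $B\in\mathcal F^0(\ker\varphi)$, $\ell(A+B|\mathcal M)\ge\ell(\varphi(A)|\mathcal N)+\ell(B|\mathcal M)$. It is **independent of ambient modules** if $\ell(A|\mathcal M_1)=\ell(A|\mathcal M_2)$ whenever $A\subseteq\mathcal M_1\subseteq\mathcal M_2$ with $\mathcal M_1,\mathcal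 M_2$ $R$-modules. An $R\Gamma$-module $\mathcal M$ is **locally $\ell$-finite** if $\ell(A|\mathcal M)<+\infty$ for every $A\in\mathcal F(\mathcal M)$ ($\mathcal M$ regarded as an $R$-module). **Bivariant $R$-weak length function.** A map assigning to each $R$-module $\mathcal M$ and nonempty $A,B\subseteq\mathcal M$ a value $\ell(A,B|\mathcal M)\in[0,+\infty]$ such that: (1) $\ell(\{0\},\{0\}|\mathcal M)=0$; (2) $\ell(A\times A',B\times B'|\mathcal M\times\mathcal M')=\ell(A,B|\mathcal M)+\ell(A',B'|\mathcal M')$; (3) $\ell(\varphi(A),\varphi(B)|\mathcal N)\le\ell(A,B|\mathcal M)$ for every $R$-module homomorphism $\varphi:\mathcal M\to\mathcal N$; (4) if $(A_n)$ is an increasing directed family of nonempty subsets of $\mathcal M$ with union $A$, then $\ell(A_n,B|\mathcal M)$ increases to $\ell(A,B|\mathcal M)$ for any nonempty $B\subseteq \mathcal M$; if $A$ is finite and $(B_n)$ is an increasing directed family of nonempty subsets of $\mathcal M$ with union $B$, then $\ell(A,B_n|\mathcal M)$ decreases to $\ell(A,B|\mathcal M)$. It is an **upgrading** of $\ell$ if $\ell(A,\{0\}|\mathcal M)=\ell(A|\mathcal M)$ for all $(A,\mathcal M)$. The upgrading is **proper** if (i) $\ell(A,C|\mathcal M)\le\ell(A,B|\mathcal M)+\ell(B,C|\mathcal M)$ for all $R$-modules $\mathcal M$ and $A,B,C\in\mathcal F(\mathcal M)$; and (ii) for every $R$-module homomorphism $\varphi:\mathcal M\to\mathcal N$, every $A\in\mathcal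 F(\mathcal M)$ and $\varepsilon>0$ there is $B\in\mathcal F(\ker\varphi)$ with $\ell(A,B|\mathcal M)\le\ell(\varphi(A)|\varphi(\mathcal M))+\varepsilon$. **Amenability and limits.** For $K\in\mathcal F(\Gamma)$, $\delta>0$, a set $F\in\mathcal F(\Gamma)$ is $(K,\delta)$-invariant if $|\{s\in F:Ks\subseteq F\}|\ge(1-\delta)|F|$; $\Gamma$ is amenable if for all $K,\delta$ a $(K,\delta)$-invariant $F\in\mathcal F(\Gamma)$ exists. $\lim_F\varphi(F)=c$ means: for every $\varepsilon>0$ there are $K\in\mathcal F(\Gamma)$, $\delta>0$ with $|\varphi(F)-c|<\varepsilon$ for all $(K,\delta)$-invariant $F\in\mathcal F(\Gamma)$. **Mean weak length.** For an $R\Gamma$-module $\mathcal M$, nonempty $A\subseteq\mathcal M$ and $F\in\mathcal F(\Gamma)$ put $A^{[F]}=\sum_{s\in F}s^{-1}A$. For $A\in\mathcal F^0(\mathcal M)$ (with $\mathcal M$ locally $\ell$-finite) set $\mathrm{m}\ell(A|\mathcal M)=\lim_F \ell(A^{[F]}|\mathcal M)/|F|$ (the limit exists by the Ornstein–Weiss lemma). For $R\Gamma$-modules $\mathcal M_1\subseteq\mathcal M_2$, $\mathrm{m}\ell(\mathcal M_1|\mathcal M_2)=\sup_{A\in\mathcal F^0(\mathcal M_1)}\mathrm{m}\ell(A|\mathcal M_2)\in[0,+\infty]$, and $\mathrm{m}\ell(\mathcal M)=\mathrm{m}\ell(\mathcal M|\mathcal M)$. *)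

theory Defs
  imports "HOL-Algebra.Algebra" "HOL-Library.Extended_Nonnegative_Real"
begin

section \<open>Left modules over a not necessarily commutative ring\<close>

text \<open>
  The library locale \<open>module\<close> requires a commutative ring of scalars.  The record type
  \<open>('r, 'm) module\<close> and the locale \<open>submodule\<close> are used as they are; the fields \<open>mult\<close> and \<open>one\<close>
  that the record inherits from \<open>'m ring\<close> play no role.
\<close>

locale left_module = R?: ring R + M?: abelian_group M
  for R :: "('r, 'p) ring_scheme" (structure) and M :: "('r, 'm, 'x) module_scheme" (structure) +
  assumes smult_closed:
      "\<lbrakk>a \<in> carrier R; x \<in> carrier M\<rbrakk> \<Longrightarrow> a \<odot>\<^bsub>M\<^esub> x \<in> carrier M"
    and smult_l_distr:
      "\<lbrakk>a \<in> carrier R; b \<in> carrier R; x \<in> carrier M\<rbrakk> \<Longrightarrow>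
        (a \<oplus>\<^bsub>R\<^esub> b) \<odot>\<^bsub>M\<^esub> x = a \<odot>\<^bsub>M\<^esub> x \<oplus>\<^bsub>M\<^esub> b \<odot>\<^bsub>M\<^esub> x"
    and smult_r_distr:
      "\<lbrakk>a \<in> carrier R; x \<in> carrier M; y \<in> carrier M\<rbrakk> \<Longrightarrow>
        a \<odot>\<^bsub>M\<^esub> (x \<oplus>\<^bsub>M\<^esub> y) = a \<odot>\<^bsub>M\<^esub> x \<oplus>\<^bsub>M\<^esub> a \<odot>\<^bsub>M\<^esub> y"
    and smult_assoc1:
      "\<lbrakk>a \<in> carrier R; b \<in> carrier R; x \<in> carrier M\<rbrakk> \<Longrightarrow>
        (a \<otimes>\<^bsub>R\<^esub> b) \<odot>\<^bsub>M\<^esub> x = a \<odot>\<^bsub>M\<^esub> (b \<odot>\<^bsub>M\<^esub> x)"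
    and smult_one:
      "x \<in> carrier M \<Longrightarrow> \<one>\<^bsub>R\<^esub> \<odot>\<^bsub>M\<^esub> x = x"

definition left_module_hom ::
  "('r, 'p) ring_scheme \<Rightarrow> ('r, 'a) module \<Rightarrow> ('r, 'b) module \<Rightarrow> ('a \<Rightarrow> 'b) set" where
  "left_module_hom R M N =
     {\<phi>. \<phi> \<in> carrier M \<rightarrow> carrier N \<and>
         (\<forall>x\<in>carrier M. \<forall>y\<in>carrier M. \<phi> (x \<oplus>\<^bsub>M\<^esub> y) = \<phi> x \<oplus>\<^bsub>N\<^esub> \<phi> y) \<and>
         (\<forall>r\<in>carrier R. \<forall>x\<in>carrier M. \<phi> (r \<odot>\<^bsub>M\<^esub> x) = r \<odot>\<^bsub>N\<^esub> \<phi> x)}"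

definition prod_module :: "('r, 'a) module \<Rightarrow> ('r, 'b) module \<Rightarrow> ('r, 'a \<times> 'b) module" where
  "prod_module M N =
     \<lparr>carrier = carrier M \<times> carrier N, monoid.mult = undefined, monoid.one = undefined,
      ring.zero = (\<zero>\<^bsub>M\<^esub>, \<zero>\<^bsub>N\<^esub>),
      ring.add = (\<lambda>(x, y) (x', y'). (x \<oplus>\<^bsub>M\<^esub> x', y \<oplus>\<^bsub>N\<^esub> y')),
      smult = (\<lambda>r (x, y). (r \<odot>\<^bsub>M\<^esub> x, r \<odot>\<^bsub>N\<^esub> y))\<rparr>"

text \<open>
  In the scalar multiplication, \<open>N\<close> is added so that \<open>r (N + x) = N + r x\<close> also when
  multiplication by \<open>r\<close> does not map \<open>N\<close> onto \<open>N\<close>.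
\<close>

definition quot_module :: "('r, 'm) module \<Rightarrow> 'm set \<Rightarrow> ('r, 'm set) module" where
  "quot_module M N =
     \<lparr>carrier = a_rcosets\<^bsub>M\<^esub> N, monoid.mult = undefined, monoid.one = undefined,
      ring.zero = N,
      ring.add = (\<lambda>P Q. P <+>\<^bsub>M\<^esub> Q),
      smult = (\<lambda>r P. N <+>\<^bsub>M\<^esub> ((\<lambda>x. r \<odot>\<^bsub>M\<^esub> x) ` P))\<rparr>"

text \<open>The module structure transported along a map \<open>f\<close> that is injective on \<open>carrier M\<close>.\<close>

definition copy_module :: "('a \<Rightarrow> 'b) \<Rightarrow> ('r, 'a) module \<Rightarrow> ('r, 'b) module" where
  "copy_module f M =
     (let g = inv_into (carrier M) f in
       \<lparr>carrier = f ` carrier M, monoid.mult = undefined, monoid.one = undefined,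
        ring.zero = f \<zero>\<^bsub>M\<^esub>,
        ring.add = (\<lambda>x y. f (g x \<oplus>\<^bsub>M\<^esub> g y)),
        smult = (\<lambda>r x. f (r \<odot>\<^bsub>M\<^esub> g x))\<rparr>)"


section \<open>Weak length functions\<close>

text \<open>
  A length function is given on all modules whose carrier lies in a fixed infinite type \<open>'u\<close>,
  which plays the role of the universe.  Products and quotients of such modules have carriers in
  \<open>'u \<times> 'u\<close> and \<open>'u set\<close>, but these carriers still embed into \<open>'u\<close>.  The functions below evaluate a
  length function on a module over any type whose carrier embeds into \<open>'u\<close>, by transport along
  some embedding.  As weak length functions are invariant under isomorphism (axiom (3)), the
  value does not depend on the embedding.
\<close>

definition ext_len ::
  "(('r, 'u) module \<Rightarrow> 'u set \<Rightarrow> ennreal) \<Rightarrow> ('r, 'b) module \<Rightarrow> 'b set \<Rightarrow> ennreal" where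
  "ext_len l M A =
     (let f = (SOME f :: 'b \<Rightarrow> 'u. inj_on f (carrier M)) in l (copy_module f M) (f ` A))"

definition ext_len2 ::
  "(('r, 'u) module \<Rightarrow> 'u set \<Rightarrow> 'u set \<Rightarrow> ennreal) \<Rightarrow>
   ('r, 'b) module \<Rightarrow> 'b set \<Rightarrow> 'b set \<Rightarrow> ennreal" where
  "ext_len2 l M A B =
     (let f = (SOME f :: 'b \<Rightarrow> 'u. inj_on f (carrier M)) in l (copy_module f M) (f ` A) (f ` B))"

definition nonempty_subsets :: "'a set \<Rightarrow> 'a set set" where
  "nonempty_subsets S = {A. A \<subseteq> S \<and> A \<noteq> {}}"

definition fin_subsets :: "'a set \<Rightarrow> 'a set set" where
  "fin_subsets S = {A. A \<subseteq> S \<and> finite A \<and> A \<noteq> {}}"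

definition fin_subsets0 :: "('a, 'p) ring_scheme \<Rightarrow> 'a set \<Rightarrow> 'a set set" where
  "fin_subsets0 M S = {A. A \<subseteq> S \<and> finite A \<and> \<zero>\<^bsub>M\<^esub> \<in> A}"

text \<open>
  An increasing directed family of nonempty subsets of \<open>S\<close>, regarded as a set of sets.
\<close>

definition directed_family :: "'a set \<Rightarrow> 'a set set \<Rightarrow> bool" where
  "directed_family S \<A> \<longleftrightarrow>
     \<A> \<noteq> {} \<and> \<A> \<subseteq> nonempty_subsets S \<and> (\<forall>A\<in>\<A>. \<forall>B\<in>\<A>. \<exists>C\<in>\<A>. A \<subseteq> C \<and> B \<subseteq> C)"

text \<open>
  In axiom (4), monotonicity of \<open>l\<close> in the set is the case of the directed family \<open>{A\<^sub>1, A\<^sub>2}\<close> with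
  \<open>A\<^sub>1 \<subseteq> A\<^sub>2\<close>, so ``increases to'' amounts to the equality with the supremum.
\<close>

definition weak_length_function ::
  "('r, 'p) ring_scheme \<Rightarrow> (('r, 'u) module \<Rightarrow> 'u set \<Rightarrow> ennreal) \<Rightarrow> bool" where
  "weak_length_function R l \<longleftrightarrow>
     \<comment> \<open>(1)\<close>
     (\<forall>M. left_module R M \<longrightarrow> l M {\<zero>\<^bsub>M\<^esub>} = 0) \<and>
     \<comment> \<open>(2)\<close>
     (\<forall>M N. left_module R M \<longrightarrow> left_module R N \<longrightarrow>
        (\<forall>A\<in>nonempty_subsets (carrier M). \<forall>B\<in>nonempty_subsets (carrier N).
           ext_len l (prod_module M N) (A \<times> B) = l M A + l N B)) \<and>
     \<comment> \<open>(3)\<close>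
     (\<forall>M N. left_module R M \<longrightarrow> left_module R N \<longrightarrow>
        (\<forall>\<phi>\<in>left_module_hom R M N. \<forall>A\<in>nonempty_subsets (carrier M). l M A \<ge> l N (\<phi> ` A))) \<and>
     \<comment> \<open>(4)\<close>
     (\<forall>M. left_module R M \<longrightarrow>
        (\<forall>\<A>. directed_family (carrier M) \<A> \<longrightarrow> l M (\<Union>\<A>) = (SUP A\<in>\<A>. l M A)))"

definition strong_quotient_property ::
  "('r, 'p) ring_scheme \<Rightarrow> (('r, 'u) module \<Rightarrow> 'u set \<Rightarrow> ennreal) \<Rightarrow> bool" where
  "strong_quotient_property R l \<longleftrightarrow>
     (\<forall>M N. left_module R M \<longrightarrow> left_module R N \<longrightarrow>
        (\<forall>\<phi>\<in>left_module_hom R M N.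
           \<forall>A\<in>fin_subsets0 M (carrier M). \<forall>B\<in>fin_subsets0 M (a_kernel M N \<phi>).
             l M (A <+>\<^bsub>M\<^esub> B) \<ge> l N (\<phi> ` A) + l M B))"

definition independent_of_ambient ::
  "('r, 'p) ring_scheme \<Rightarrow> (('r, 'u) module \<Rightarrow> 'u set \<Rightarrow> ennreal) \<Rightarrow> bool" where
  "independent_of_ambient R l \<longleftrightarrow>
     (\<forall>M N. left_module R M \<longrightarrow> submodule N R M \<longrightarrow>
        (\<forall>A\<in>nonempty_subsets N. l (M\<lparr>carrier := N\<rparr>) A = l M A))"

definition bivariant_weak_length_function ::
  "('r, 'p) ring_scheme \<Rightarrow> (('r, 'u) module \<Rightarrow> 'u set \<Rightarrow> 'u set \<Rightarrow> ennreal) \<Rightarrow> bool" where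
  "bivariant_weak_length_function R l \<longleftrightarrow>
     \<comment> \<open>(1)\<close>
     (\<forall>M. left_module R M \<longrightarrow> l M {\<zero>\<^bsub>M\<^esub>} {\<zero>\<^bsub>M\<^esub>} = 0) \<and>
     \<comment> \<open>(2)\<close>
     (\<forall>M M'. left_module R M \<longrightarrow> left_module R M' \<longrightarrow>
        (\<forall>A\<in>nonempty_subsets (carrier M). \<forall>B\<in>nonempty_subsets (carrier M).
         \<forall>A'\<in>nonempty_subsets (carrier M'). \<forall>B'\<in>nonempty_subsets (carrier M').
           ext_len2 l (prod_module M M') (A \<times> A') (B \<times> B') = l M A B + l M' A' B')) \<and>
     \<comment> \<open>(3)\<close>
     (\<forall>M N. left_module R M \<longrightarrow> left_module R N \<longrightarrow>
        (\<forall>\<phi>\<in>left_module_hom R M N.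
         \<forall>A\<in>nonempty_subsets (carrier M). \<forall>B\<in>nonempty_subsets (carrier M).
           l N (\<phi> ` A) (\<phi> ` B) \<le> l M A B)) \<and>
     \<comment> \<open>(4)\<close>
     (\<forall>M. left_module R M \<longrightarrow>
        (\<forall>\<A>. \<forall>B\<in>nonempty_subsets (carrier M). directed_family (carrier M) \<A> \<longrightarrow>
           l M (\<Union>\<A>) B = (SUP A\<in>\<A>. l M A B)) \<and>
        (\<forall>\<B>. \<forall>A\<in>fin_subsets (carrier M). directed_family (carrier M) \<B> \<longrightarrow>
           l M A (\<Union>\<B>) = (INF B\<in>\<B>. l M A B)))"

definition upgrading ::
  "('r, 'p) ring_scheme \<Rightarrow> (('r, 'u) module \<Rightarrow> 'u set \<Rightarrow> ennreal) \<Rightarrow>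
   (('r, 'u) module \<Rightarrow> 'u set \<Rightarrow> 'u set \<Rightarrow> ennreal) \<Rightarrow> bool" where
  "upgrading R l l2 \<longleftrightarrow>
     bivariant_weak_length_function R l2 \<and>
     (\<forall>M. left_module R M \<longrightarrow> (\<forall>A\<in>nonempty_subsets (carrier M). l2 M A {\<zero>\<^bsub>M\<^esub>} = l M A))"

definition proper_upgrading ::
  "('r, 'p) ring_scheme \<Rightarrow> (('r, 'u) module \<Rightarrow> 'u set \<Rightarrow> ennreal) \<Rightarrow>
   (('r, 'u) module \<Rightarrow> 'u set \<Rightarrow> 'u set \<Rightarrow> ennreal) \<Rightarrow> bool" where
  "proper_upgrading R l l2 \<longleftrightarrow>
     upgrading R l l2 \<and>
     (\<forall>M. left_module R M \<longrightarrow>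
        (\<forall>A\<in>fin_subsets (carrier M). \<forall>B\<in>fin_subsets (carrier M). \<forall>C\<in>fin_subsets (carrier M).
           l2 M A C \<le> l2 M A B + l2 M B C)) \<and>
     (\<forall>M N. left_module R M \<longrightarrow> left_module R N \<longrightarrow>
        (\<forall>\<phi>\<in>left_module_hom R M N. \<forall>A\<in>fin_subsets (carrier M). \<forall>\<epsilon>::real. \<epsilon> > 0 \<longrightarrow>
           (\<exists>B\<in>fin_subsets (a_kernel M N \<phi>).
              l2 M A B \<le> l (N\<lparr>carrier := \<phi> ` carrier M\<rparr>) (\<phi> ` A) + ennreal \<epsilon>)))"


section \<open>Amenable groups\<close>

definition invariant_set :: "('g, 'q) monoid_scheme \<Rightarrow> 'g set \<Rightarrow> real \<Rightarrow> 'g set \<Rightarrow> bool" where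
  "invariant_set G K \<delta> F \<longleftrightarrow>
     real (card {s \<in> F. (\<lambda>k. k \<otimes>\<^bsub>G\<^esub> s) ` K \<subseteq> F}) \<ge> (1 - \<delta>) * real (card F)"

definition amenable :: "('g, 'q) monoid_scheme \<Rightarrow> bool" where
  "amenable G \<longleftrightarrow>
     (\<forall>K\<in>fin_subsets (carrier G). \<forall>\<delta>>0. \<exists>F\<in>fin_subsets (carrier G). invariant_set G K \<delta> F)"

definition amenable_limit :: "('g, 'q) monoid_scheme \<Rightarrow> ('g set \<Rightarrow> real) \<Rightarrow> real \<Rightarrow> bool" where
  "amenable_limit G \<phi> c \<longleftrightarrow>
     (\<forall>\<epsilon>>0. \<exists>K\<in>fin_subsets (carrier G). \<exists>\<delta>>0.
        \<forall>F\<in>fin_subsets (carrier G). invariant_set G K \<delta> F \<longrightarrow> \<bar>\<phi> F - c\<bar> < \<epsilon>)"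


section \<open>Modules over the group ring\<close>

text \<open>
  Elements of the group ring are the finitely supported functions from \<open>carrier G\<close> to
  \<open>carrier R\<close>, extended by zero outside \<open>carrier G\<close>; the product is convolution.
\<close>

definition group_ring ::
  "('r, 'p) ring_scheme \<Rightarrow> ('g, 'q) monoid_scheme \<Rightarrow> ('g \<Rightarrow> 'r) ring" where
  "group_ring R G =
     \<lparr>carrier = {f. (\<forall>s\<in>carrier G. f s \<in> carrier R) \<and> (\<forall>s. s \<notin> carrier G \<longrightarrow> f s = \<zero>\<^bsub>R\<^esub>) \<and>
                    finite {s. f s \<noteq> \<zero>\<^bsub>R\<^esub>}},
      monoid.mult = (\<lambda>f g s. if s \<in> carrier G
                       then \<Oplus>\<^bsub>R\<^esub>t\<in>{t. f t \<noteq> \<zero>\<^bsub>R\<^esub>}. f t \<otimes>\<^bsub>R\<^esub> g (inv\<^bsub>G\<^esub> t \<otimes>\<^bsub>G\<^esub> s)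
                       else \<zero>\<^bsub>R\<^esub>),
      monoid.one = (\<lambda>s. if s = \<one>\<^bsub>G\<^esub> then \<one>\<^bsub>R\<^esub> else \<zero>\<^bsub>R\<^esub>),
      ring.zero = (\<lambda>s. \<zero>\<^bsub>R\<^esub>),
      ring.add = (\<lambda>f g s. f s \<oplus>\<^bsub>R\<^esub> g s)\<rparr>"

definition group_ring_single :: "('r, 'p) ring_scheme \<Rightarrow> 'r \<Rightarrow> 'g \<Rightarrow> 'g \<Rightarrow> 'r" where
  "group_ring_single R r s = (\<lambda>t. if t = s then r else \<zero>\<^bsub>R\<^esub>)"

text \<open>A module over the group ring, regarded as a module over \<open>R\<close>.\<close>

definition restrict_scalars ::
  "('r, 'p) ring_scheme \<Rightarrow> ('g, 'q) monoid_scheme \<Rightarrow> ('g \<Rightarrow> 'r, 'm) module \<Rightarrow> ('r, 'm) module" where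
  "restrict_scalars R G M =
     \<lparr>carrier = carrier M, monoid.mult = undefined, monoid.one = undefined, ring.zero = \<zero>\<^bsub>M\<^esub>, 
      ring.add = ring.add M,
      smult = (\<lambda>r x. group_ring_single R r \<one>\<^bsub>G\<^esub> \<odot>\<^bsub>M\<^esub> x)\<rparr>"

definition group_action ::
  "('r, 'p) ring_scheme \<Rightarrow> ('g \<Rightarrow> 'r, 'm) module \<Rightarrow> 'g \<Rightarrow> 'm \<Rightarrow> 'm" where
  "group_action R M s x = group_ring_single R \<one>\<^bsub>R\<^esub> s \<odot>\<^bsub>M\<^esub> x"

text \<open>The Minkowski sum of the sets \<open>s\<^sup>-\<^sup>1 A\<close> for \<open>s \<in> F\<close>.\<close>

definition sum_translates ::
  "('r, 'p) ring_scheme \<Rightarrow> ('g, 'q) monoid_scheme \<Rightarrow> ('g \<Rightarrow> 'r, 'm) module \<Rightarrow>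
   'm set \<Rightarrow> 'g set \<Rightarrow> 'm set" where
  "sum_translates R G M A F =
     {\<Oplus>\<^bsub>M\<^esub>s\<in>F. group_action R M (inv\<^bsub>G\<^esub> s) (a s) | a. a \<in> F \<rightarrow> A}"

definition locally_finite_module ::
  "('r, 'p) ring_scheme \<Rightarrow> ('g, 'q) monoid_scheme \<Rightarrow>
   (('r, 'm) module \<Rightarrow> 'm set \<Rightarrow> ennreal) \<Rightarrow> ('g \<Rightarrow> 'r, 'm) module \<Rightarrow> bool" where
  "locally_finite_module R G l M \<longleftrightarrow>
     (\<forall>A\<in>fin_subsets (carrier M). l (restrict_scalars R G M) A < \<infinity>)"

definition mean_length_set ::
  "('r, 'p) ring_scheme \<Rightarrow> ('g, 'q) monoid_scheme \<Rightarrow>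
   (('r, 'm) module \<Rightarrow> 'm set \<Rightarrow> ennreal) \<Rightarrow> ('g \<Rightarrow> 'r, 'm) module \<Rightarrow> 'm set \<Rightarrow> ennreal" where
  "mean_length_set R G l M A =
     ennreal (THE c. amenable_limit G
       (\<lambda>F. enn2real (l (restrict_scalars R G M) (sum_translates R G M A F)) / real (card F)) c)"

definition mean_length ::
  "('r, 'p) ring_scheme \<Rightarrow> ('g, 'q) monoid_scheme \<Rightarrow>
   (('r, 'm) module \<Rightarrow> 'm set \<Rightarrow> ennreal) \<Rightarrow> ('g \<Rightarrow> 'r, 'm) module \<Rightarrow> 'm set \<Rightarrow> ennreal" where
  "mean_length R G l M N = (SUP A\<in>fin_subsets0 M N. mean_length_set R G l M A)"

end

theory Submission
  imports Defs
begin

text \<open>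
  Write \<open>A\<^sup>F\<close> for the sum of the translates \<open>s\<^sup>-\<^sup>1 A\<close> with \<open>s \<in> F\<close>, and let \<open>l2\<close> be a proper upgrading of \<open>l\<close>.
  For a submodule \<open>N\<close> of \<open>M\<close> the number \<open>l2(A\<^sup>F, N)\<close> measures \<open>A\<^sup>F\<close> modulo \<open>N\<close>: continuity of \<open>l2\<close> in
  its second argument and the approximation property of proper upgradings give \<open>l2(A, ker \<phi>) = l(\<phi>(A))\<close>
  for surjective \<open>\<phi>\<close> (lemma \<open>l2_kernel\<close>).  So the mean length of the image of \<open>A\<close> in \<open>M / N\<close> is the limit
  \<open>c(A, N)\<close> of \<open>l2(A\<^sup>F, N) / |F|\<close>, the mean length of \<open>A\<close> in \<open>M\<close> is the special case \<open>c(A, 0)\<close>, and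
  the comparison of the two takes place inside the single module \<open>M\<close>.

  The limits exist because \<open>F \<mapsto> l2(A\<^sup>F, N)\<close> is subadditive and invariant under right translation
  (theorem \<open>ornstein_weiss\<close>).  Both this and the harder half of the addition formula rest on
  \<open>quasi_tilings_exist\<close>: a sufficiently invariant set is almost covered by almost disjoint translates
  of finitely many tiles, and these tiles can be chosen in any family that has arbitrarily invariant
  members containing \<open>\<one>\<close>.

  Lower bound.  The strong quotient property, applied to \<open>(A + B)\<^sup>F = A\<^sup>F + B\<^sup>F\<close> with \<open>B \<subseteq> N\<close>,
  gives \<open>c(A, N) + c(B, 0) \<le> c(A + B, 0)\<close> (lemma \<open>rel_mean_superadditive\<close>).

  Upper bound.  By the triangle inequality \<open>l(A\<^sup>F) \<le> l2(A\<^sup>F, B\<^sup>F) + l(B\<^sup>F)\<close>, it is enough to find, for each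
  \<open>\<epsilon> > 0\<close>, one finite \<open>B \<subseteq> N\<close> such that \<open>l2(A\<^sup>F, B\<^sup>F) \<le> (c(A, N) + \<epsilon>) |F|\<close> for all sufficiently
  invariant \<open>F\<close> (lemma \<open>rel_length_approximation\<close>).  For one set \<open>D\<close> there is a finite \<open>B\<^sub>D \<subseteq> N\<close>
  with \<open>l2(A\<^sup>D, B\<^sub>D)\<close> close to \<open>l2(A\<^sup>D, N)\<close>.  Let \<open>F\<close> be quasi-tiled by translates \<open>D c\<close> of finitely
  many tiles \<open>D\<close> with \<open>l2(A\<^sup>D, N) / |D|\<close> close to \<open>c(A, N)\<close>, and let \<open>B\<close> consist of \<open>0\<close> and all these
  \<open>B\<^sub>D\<close>.  The centres \<open>c\<close> are distinct points of \<open>F\<close>, so \<open>B\<^sup>F\<close> contains the sum of the sets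
  \<open>c\<^sup>-\<^sup>1 B\<close>, and \<open>l2(A\<^sup>F, B\<^sup>F)\<close> is at most the sum of the \<open>l2(A\<^sup>D, B\<^sub>D)\<close> over the tiles, up to the
  contribution of the few uncovered points.
\<close>


section \<open>Quasi-tilings of almost invariant sets\<close>

context group
begin

lemma r_coset_image: "D #> c = (\<lambda>d. d \<otimes> c) ` D"
  unfolding r_coset_def by auto

lemma r_coset_subset_carrier:
  "D \<subseteq> carrier G \<Longrightarrow> c \<in> carrier G \<Longrightarrow> D #> c \<subseteq> carrier G"
  unfolding r_coset_image by auto

lemma finite_r_coset: "finite D \<Longrightarrow> finite (D #> c)"
  unfolding r_coset_image by simp

lemma card_r_coset:
  assumes "D \<subseteq> carrier G" "c \<in> carrier G"
  shows "card (D #> c) = card D"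
  unfolding r_coset_image
  by (rule card_image) (use assms in \<open>auto intro!: inj_onI simp: subset_iff\<close>)

lemma r_coset_one_mem: "\<one> \<in> D \<Longrightarrow> c \<in> carrier G \<Longrightarrow> c \<in> D #> c"
  unfolding r_coset_image by (metis image_eqI l_one)

definition escaping :: "'a set \<Rightarrow> 'a set \<Rightarrow> 'a set" where
  "escaping K F = {s \<in> F. \<not> (\<lambda>k. k \<otimes> s) ` K \<subseteq> F}"

lemma invariant_set_iff:
  assumes "finite F"
  shows "invariant_set G K \<delta> F \<longleftrightarrow> real (card (escaping K F)) \<le> \<delta> * real (card F)"
proof -
  let ?I = "{s \<in> F. (\<lambda>k. k \<otimes> s) ` K \<subseteq> F}"
  have "F = ?I \<union> escaping K F" "?I \<inter> escaping K F = {}"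
    unfolding escaping_def by auto
  then have "card F = card ?I + card (escaping K F)"
    using assms by (metis (no_types, lifting) card_Un_disjoint finite_Un)
  then show ?thesis
    unfolding invariant_set_def by (auto simp: algebra_simps)
qed

lemma invariant_set_mono:
  assumes "invariant_set G K \<delta> F" "K' \<subseteq> K" "\<delta> \<le> \<delta>'" "finite F"
  shows "invariant_set G K' \<delta>' F"
proof -
  have "card (escaping K' F) \<le> card (escaping K F)"
    by (rule card_mono) (use assms in \<open>auto simp: escaping_def\<close>)
  moreover have "\<delta> * real (card F) \<le> \<delta>' * real (card F)"
    using assms by (intro mult_right_mono) auto
  ultimately show ?thesis
    using assms(1) unfolding invariant_set_iff[OF assms(4)] by linarith
qed

lemma invariant_set_r_coset:
  assumes F: "F \<subseteq> carrier G" "finite F" and K: "K \<subseteq> carrier G" and c: "c \<in> carrier G"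
    and inv: "invariant_set G K \<delta> F"
  shows "invariant_set G K \<delta> (F #> c)"
proof -
  have "escaping K (F #> c) \<subseteq> escaping K F #> c"
  proof
    fix x assume x: "x \<in> escaping K (F #> c)"
    then obtain s where s: "s \<in> F" "x = s \<otimes> c"
      unfolding escaping_def r_coset_image by auto
    from x obtain k where k: "k \<in> K" "k \<otimes> x \<notin> F #> c"
      unfolding escaping_def by auto
    have "k \<otimes> x = (k \<otimes> s) \<otimes> c"
      using s k F K c by (simp add: m_assoc subset_iff)
    then have "k \<otimes> s \<notin> F"
      using k unfolding r_coset_image by auto
    then show "x \<in> escaping K F #> c"
      using s k unfolding escaping_def r_coset_image by auto
  qed
  then have "card (escaping K (F #> c)) \<le> card (escaping K F #> c)"
    using F by (intro card_mono finite_r_coset) (auto simp: escaping_def)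
  also have "\<dots> \<le> card (escaping K F)"
    unfolding r_coset_image by (rule card_image_le) (use F in \<open>auto simp: escaping_def\<close>)
  finally show ?thesis
    using inv F c by (simp add: invariant_set_iff finite_r_coset card_r_coset)
qed

text \<open>
  \<open>C\<close> is a largest set of centres for which the translates of \<open>D\<close> inside \<open>F\<close> overlap so little that
  their union has at least \<open>(1 - \<epsilon>) |C| |D|\<close> elements.  No further translate can be added, so each
  translate of \<open>D\<close> inside \<open>F\<close> meets the union in at least \<open>\<epsilon> |D|\<close> points; as a point lies
  in at most \<open>|D|\<close> translates, double counting bounds the union from below.
\<close>

lemma greedy_filling:
  assumes D: "D \<subseteq> carrier G" "finite D" "D \<noteq> {}" and F: "F \<subseteq> carrier G" "finite F"
    and \<epsilon>: "0 < \<epsilon>" "\<epsilon> < 1"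
  obtains C where "C \<subseteq> F - escaping D F"
    and "(1 - \<epsilon>) * real (card C * card D) \<le> real (card (\<Union>c\<in>C. D #> c))"
    and "\<epsilon> * real (card (F - escaping D F)) \<le> real (card (\<Union>c\<in>C. D #> c))"
proof -
  define I where "I = F - escaping D F"
  define U where "U C = (\<Union>c\<in>C. D #> c)" for C
  define good where
    "good C \<longleftrightarrow> C \<subseteq> I \<and> (1 - \<epsilon>) * real (card C * card D) \<le> real (card (U C))" for C
  have fI: "finite I" and IG: "I \<subseteq> carrier G"
    using F unfolding I_def by auto
  have fU: "finite (U C)" if "C \<subseteq> I" for C
    unfolding U_def using that fI D by (auto intro: finite_subset finite_r_coset)
  have "good {}"
    unfolding good_def U_def by simp
  moreover have "\<forall>C. good C \<longrightarrow> card C < Suc (card I)"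
    unfolding good_def using fI by (auto intro: card_mono le_imp_less_Suc)
  ultimately obtain C where C: "good C" and max: "\<And>C'. good C' \<Longrightarrow> card C' \<le> card C"
    using ex_has_greatest_nat[of good "{}" card "Suc (card I)"] by (metis less_imp_le_nat)
  have CI: "C \<subseteq> I" and fC: "finite C"
    using C fI unfolding good_def by (auto intro: finite_subset)
  have overlap: "\<epsilon> * real (card D) \<le> real (card ((D #> c) \<inter> U C))" if c: "c \<in> I" for c
  proof (cases "c \<in> C")
    case True
    then have "(D #> c) \<inter> U C = D #> c"
      unfolding U_def by auto
    moreover have "card (D #> c) = card D"
      using c IG D by (auto intro: card_r_coset)
    moreover have "\<epsilon> * real (card D) \<le> 1 * real (card D)"
      using \<epsilon> by (intro mult_right_mono) auto
    ultimately show ?thesis by simp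
  next
    case False
    show ?thesis
    proof (rule ccontr)
      assume less: "\<not> ?thesis"
      have eq: "U (insert c C) = U C \<union> (D #> c)"
        unfolding U_def by auto
      have "card (U C \<union> (D #> c)) + card (U C \<inter> (D #> c)) = card (U C) + card (D #> c)"
        using card_Un_Int[OF fU[OF CI] finite_r_coset[OF D(2)]] by (simp only: add.commute)
      moreover have "card (D #> c) = card D"
        using c IG D by (auto intro: card_r_coset)
      ultimately have "real (card (U (insert c C))) \<ge> real (card (U C)) + (1 - \<epsilon>) * real (card D)"
        unfolding eq using less by (simp add: Int_commute algebra_simps)
      then have "good (insert c C)"
        using C c False fC unfolding good_def by (auto simp: algebra_simps)
      from max[OF this] show False
        using False fC by simp
    qed
  qed
  have "\<epsilon> * real (card D) * real (card I) = (\<Sum>c\<in>I. \<epsilon> * real (card D))"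
    by simp
  also have "\<dots> \<le> (\<Sum>c\<in>I. real (card ((D #> c) \<inter> U C)))"
    by (rule sum_mono) (rule overlap)
  also have "\<dots> = real (\<Sum>c\<in>I. card {d \<in> D. d \<otimes> c \<in> U C})"
  proof -
    have "card ((D #> c) \<inter> U C) = card {d \<in> D. d \<otimes> c \<in> U C}" if "c \<in> I" for c
    proof -
      have "(D #> c) \<inter> U C = (\<lambda>d. d \<otimes> c) ` {d \<in> D. d \<otimes> c \<in> U C}"
        unfolding r_coset_image by auto
      moreover have "inj_on (\<lambda>d. d \<otimes> c) {d \<in> D. d \<otimes> c \<in> U C}"
        using that IG D by (auto intro!: inj_onI simp: subset_iff)
      ultimately show ?thesis
        by (simp add: card_image)
    qed
    then show ?thesis by simp
  qed
  also have "(\<Sum>c\<in>I. card {d \<in> D. d \<otimes> c \<in> U C}) = (\<Sum>d\<in>D. card {c \<in> I. d \<otimes> c \<in> U C})"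
    using sum_multicount_gen[OF D(2) fI, of "\<lambda>d c. d \<otimes> c \<in> U C" "\<lambda>c. card {d \<in> D. d \<otimes> c \<in> U C}"]
    by simp
  also have "\<dots> \<le> (\<Sum>d\<in>D. card (U C))"
  proof (rule sum_mono)
    fix d assume "d \<in> D"
    show "card {c \<in> I. d \<otimes> c \<in> U C} \<le> card (U C)"
    proof (rule card_inj_on_le)
      show "inj_on (\<lambda>c. d \<otimes> c) {c \<in> I. d \<otimes> c \<in> U C}"
        using \<open>d \<in> D\<close> D IG by (auto intro!: inj_onI simp: subset_iff)
    qed (use fU[OF CI] in auto)
  qed
  finally have "\<epsilon> * real (card D) * real (card I) \<le> real (card D) * real (card (U C))"
    by simp
  moreover have "0 < real (card D)"
    using D by (simp add: card_gt_0_iff)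
  ultimately have "\<epsilon> * real (card I) \<le> real (card (U C))"
    by (simp add: mult.assoc mult.left_commute[of \<epsilon>])
  then show thesis
    using that[of C] C unfolding good_def U_def I_def by blast
qed

text \<open>
  A point outside the tiles that \<open>K\<close> moves into a tile \<open>D c\<close> has the form \<open>k\<^sup>-\<^sup>1 d c\<close> with \<open>k\<^sup>-\<^sup>1 d \<notin> D\<close>.
  If \<open>D\<close> is almost invariant under \<open>K\<^sup>-\<^sup>1\<close> there are few such points, so removing the tiles
  from an almost \<open>K\<close>-invariant \<open>F\<close> leaves an almost \<open>K\<close>-invariant set, unless very little is left.
\<close>

lemma escaping_remainder:
  assumes D: "D \<subseteq> carrier G" "finite D" and F: "F \<subseteq> carrier G" "finite F"
    and K: "K \<subseteq> carrier G" "finite K" and C: "C \<subseteq> carrier G" "finite C"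
  shows "card (escaping K (F - (\<Union>c\<in>C. D #> c)))
    \<le> card (escaping K F) + card C * (card K * card (escaping (m_inv G ` K) D))"
proof -
  let ?E = "escaping (m_inv G ` K) D"
  let ?f = "\<lambda>(c, k, d). (inv k \<otimes> d) \<otimes> c"
  have fE: "finite ?E" "finite (escaping K F)"
    using D F by (auto simp: escaping_def)
  have "escaping K (F - (\<Union>c\<in>C. D #> c)) \<subseteq> escaping K F \<union> ?f ` (C \<times> K \<times> ?E)"
  proof
    fix s assume "s \<in> escaping K (F - (\<Union>c\<in>C. D #> c))"
    then obtain k where s: "s \<in> F" "s \<notin> (\<Union>c\<in>C. D #> c)" and k: "k \<in> K"
        "k \<otimes> s \<notin> F \<or> k \<otimes> s \<in> (\<Union>c\<in>C. D #> c)"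
      unfolding escaping_def by auto
    show "s \<in> escaping K F \<union> ?f ` (C \<times> K \<times> ?E)"
    proof (cases "k \<otimes> s \<in> F")
      case False
      then show ?thesis
        using s k unfolding escaping_def by auto
    next
      case True
      with k obtain c d where c: "c \<in> C" and d: "d \<in> D" and eq: "k \<otimes> s = d \<otimes> c"
        unfolding r_coset_image by auto
      have G: "k \<in> carrier G" "s \<in> carrier G" "c \<in> carrier G" "d \<in> carrier G"
        using k s c d K F C D by auto
      then have s_eq: "s = (inv k \<otimes> d) \<otimes> c"
        using eq by (metis inv_closed inv_solve_left m_assoc m_closed)
      with s c have "inv k \<otimes> d \<notin> D"
        unfolding r_coset_image by auto
      then have "d \<in> ?E"
        using d k unfolding escaping_def by auto
      then have "(c, k, d) \<in> C \<times> K \<times> ?E"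
        using c k by simp
      then show ?thesis
        using s_eq by (intro UnI2 rev_image_eqI) auto
    qed
  qed
  then have "card (escaping K (F - (\<Union>c\<in>C. D #> c)))
      \<le> card (escaping K F \<union> ?f ` (C \<times> K \<times> ?E))"
    using fE K C by (intro card_mono) auto
  also have "\<dots> \<le> card (escaping K F) + card (?f ` (C \<times> K \<times> ?E))"
    by (rule card_Un_le)
  also have "card (?f ` (C \<times> K \<times> ?E)) \<le> card (C \<times> K \<times> ?E)"
    using fE K C by (intro card_image_le) auto
  finally show ?thesis
    by (simp add: card_cartesian_product)
qed

definition tiled_region :: "('a \<Rightarrow> 'a set) \<Rightarrow> 'a set \<Rightarrow> 'a set" where
  "tiled_region \<tau> C = (\<Union>c\<in>C. \<tau> c #> c)"

text \<open>
  The tile \<open>\<tau> c\<close> is a function of its centre \<open>c\<close>, which makes the centres of different tiles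
  distinct.  Tiles may overlap; \<open>\<epsilon>\<close> bounds the total overlap and \<open>\<eta>\<close> the part of \<open>F\<close> that is missed.
\<close>

definition quasi_tiling ::
  "real \<Rightarrow> real \<Rightarrow> 'a set set \<Rightarrow> 'a set \<Rightarrow> ('a \<Rightarrow> 'a set) \<Rightarrow> 'a set \<Rightarrow> bool" where
  "quasi_tiling \<epsilon> \<eta> \<T> F \<tau> C \<longleftrightarrow>
     C \<subseteq> F \<and> \<tau> ` C \<subseteq> \<T> \<and> tiled_region \<tau> C \<subseteq> F \<and>
     (1 - \<epsilon>) * real (\<Sum>c\<in>C. card (\<tau> c)) \<le> real (card (tiled_region \<tau> C)) \<and>
     real (card (F - tiled_region \<tau> C)) \<le> \<eta> * real (card F)"

text \<open>
  The remainder \<open>F - U\<close> is tiled by centres in it, while the assumption \<open>\<one> \<in> D\<close> places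
  the centres of the translates of \<open>D\<close> in \<open>U\<close>.  This keeps all centres distinct.
\<close>

lemma quasi_tiling_extend:
  assumes F: "F \<subseteq> carrier G" "finite F" and one: "\<one> \<in> D"
    and C: "C \<subseteq> F - escaping D F" and U: "U = (\<Union>c\<in>C. D #> c)"
    and C_card: "(1 - \<epsilon>) * real (card C * card D) \<le> real (card U)"
    and tiling: "quasi_tiling \<epsilon> \<eta>' \<T> (F - U) \<tau>' C'"
    and \<eta>: "\<eta>' * real (card (F - U)) \<le> \<eta> * real (card F)"
  shows "\<exists>\<tau> C. quasi_tiling \<epsilon> \<eta> (insert D \<T>) F \<tau> C"
proof -
  define \<tau> where "\<tau> c = (if c \<in> C then D else \<tau>' c)" for c
  have UF: "U \<subseteq> F"
    using C unfolding U escaping_def r_coset_image by auto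
  have CU: "C \<subseteq> U"
  proof
    fix c assume c: "c \<in> C"
    then have "c \<in> carrier G" using C F by auto
    then show "c \<in> U"
      using r_coset_one_mem[OF one] c unfolding U by blast
  qed
  have C': "C' \<subseteq> F - U" "tiled_region \<tau>' C' \<subseteq> F - U"
    using tiling unfolding quasi_tiling_def by auto
  then have disj: "C \<inter> C' = {}"
    using CU by auto
  then have \<tau>_C': "\<tau> c = \<tau>' c" if "c \<in> C'" for c
    using that unfolding \<tau>_def by auto
  have region: "tiled_region \<tau> (C \<union> C') = U \<union> tiled_region \<tau>' C'"
  proof -
    have "(\<Union>c\<in>C. \<tau> c #> c) = U"
      unfolding U by (intro SUP_cong refl) (simp add: \<tau>_def)
    moreover have "(\<Union>c\<in>C'. \<tau> c #> c) = (\<Union>c\<in>C'. \<tau>' c #> c)"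
      by (intro SUP_cong refl) (simp add: \<tau>_C')
    ultimately show ?thesis
      unfolding tiled_region_def by (simp only: UN_Un)
  qed
  have fin: "finite C" "finite C'" "finite U" "finite (tiled_region \<tau>' C')"
    using F UF CU C' by (meson finite_Diff finite_subset)+
  have "(\<Sum>c\<in>C \<union> C'. card (\<tau> c)) = (\<Sum>c\<in>C. card (\<tau> c)) + (\<Sum>c\<in>C'. card (\<tau> c))"
    using fin disj by (simp add: sum.union_disjoint)
  also have "\<dots> = card C * card D + (\<Sum>c\<in>C'. card (\<tau>' c))"
  proof -
    have "(\<Sum>c\<in>C. card (\<tau> c)) = card C * card D"
      by (simp add: \<tau>_def)
    moreover have "(\<Sum>c\<in>C'. card (\<tau> c)) = (\<Sum>c\<in>C'. card (\<tau>' c))"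
      using \<tau>_C' by (intro sum.cong refl) simp
    ultimately show ?thesis by simp
  qed
  finally have sum: "(\<Sum>c\<in>C \<union> C'. card (\<tau> c)) = card C * card D + (\<Sum>c\<in>C'. card (\<tau>' c))" .
  have card: "card (U \<union> tiled_region \<tau>' C') = card U + card (tiled_region \<tau>' C')"
    using C' fin by (intro card_Un_disjoint) auto
  have rest: "F - (U \<union> tiled_region \<tau>' C') = (F - U) - tiled_region \<tau>' C'"
    by auto
  have "quasi_tiling \<epsilon> \<eta> (insert D \<T>) F \<tau> (C \<union> C')"
    unfolding quasi_tiling_def region sum card rest
  proof (intro conjI)
    show "C \<union> C' \<subseteq> F" "U \<union> tiled_region \<tau>' C' \<subseteq> F"
      using CU UF C' by auto
    show "\<tau> ` (C \<union> C') \<subseteq> insert D \<T>"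
      using tiling unfolding quasi_tiling_def \<tau>_def by auto
    show "(1 - \<epsilon>) * real (card C * card D + (\<Sum>c\<in>C'. card (\<tau>' c)))
        \<le> real (card U + card (tiled_region \<tau>' C'))"
      using C_card tiling unfolding quasi_tiling_def by (simp add: algebra_simps)
    show "real (card (F - U - tiled_region \<tau>' C')) \<le> \<eta> * real (card F)"
      using tiling \<eta> unfolding quasi_tiling_def by linarith
  qed
  then show ?thesis by blast
qed

text \<open>
  A new tile \<open>D\<close> is placed first and the tiles of the induction hypothesis fill the
  remainder.  Hence \<open>D\<close> has to be very invariant relative to the set \<open>K\<close> of the induction hypothesis,
  so that the remainder inherits the invariance needed there, and \<open>F\<close> very invariant relative to
  \<open>D\<close>.  The translates of each tile cover at least the fraction
  \<open>\<epsilon> / 2\<close> of what is left.  Once at most \<open>\<epsilon> |F|\<close>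
  points are left the remainder may fail to be invariant, but then nothing more has to be covered.
\<close>

lemma quasi_tiling_induct:
  fixes \<epsilon> :: real
  assumes \<epsilon>: "0 < \<epsilon>" "\<epsilon> < 1"
    and \<D>: "\<And>K \<delta>. K \<in> fin_subsets (carrier G) \<Longrightarrow> \<delta> > 0 \<Longrightarrow>
      \<exists>D\<in>\<D>. D \<in> fin_subsets (carrier G) \<and> \<one> \<in> D \<and> invariant_set G K \<delta> D"
  shows "\<exists>\<T> K \<delta>. finite \<T> \<and> \<T> \<subseteq> \<D> \<inter> fin_subsets (carrier G) \<and> K \<in> fin_subsets (carrier G) \<and> \<delta> > 0 \<and>
    (\<forall>F\<in>fin_subsets (carrier G). invariant_set G K \<delta> F \<longrightarrow>
      (\<exists>\<tau> C. quasi_tiling \<epsilon> (max \<epsilon> ((1 - \<epsilon> / 2) ^ n)) \<T> F \<tau> C))"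
proof (induction n)
  case 0
  have "quasi_tiling \<epsilon> (max \<epsilon> ((1 - \<epsilon> / 2) ^ 0)) {} F (\<lambda>_. {}) {}" for F
    using \<epsilon> by (simp add: quasi_tiling_def tiled_region_def)
  moreover have "{\<one>} \<in> fin_subsets (carrier G)"
    by (simp add: fin_subsets_def)
  ultimately show ?case
    by (intro exI[of _ "{}"] exI[of _ "{\<one>}"] exI[of _ 1]) auto
next
  case (Suc n)
  define \<eta> where "\<eta> = max \<epsilon> ((1 - \<epsilon> / 2) ^ n)"
  from Suc obtain \<T> K \<delta> where \<T>: "finite \<T>" "\<T> \<subseteq> \<D> \<inter> fin_subsets (carrier G)"
    and K: "K \<in> fin_subsets (carrier G)" and \<delta>: "\<delta> > 0"
    and step: "\<And>F. F \<in> fin_subsets (carrier G) \<Longrightarrow> invariant_set G K \<delta> F \<Longrightarrow>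
      \<exists>\<tau> C. quasi_tiling \<epsilon> \<eta> \<T> F \<tau> C"
    unfolding \<eta>_def by blast
  have K': "K \<subseteq> carrier G" "finite K" "K \<noteq> {}"
    using K unfolding fin_subsets_def by auto
  have cK: "0 < real (card K)"
    using K' by (simp add: card_gt_0_iff)
  \<comment> \<open>Together with \<open>\<delta>' \<le> \<delta> \<epsilon> / 2\<close> below, at most \<open>\<delta> \<epsilon> |F|\<close> points of the remainder escape, which
    is at most \<open>\<delta> |F - U|\<close> as long as more than \<open>\<epsilon> |F|\<close> points are left.\<close>
  define \<delta>D where "\<delta>D = \<delta> * \<epsilon> * (1 - \<epsilon>) / (2 * real (card K))"
  have \<delta>D: "\<delta>D > 0"
    using \<delta> \<epsilon> cK unfolding \<delta>D_def by simp
  have "m_inv G ` K \<in> fin_subsets (carrier G)"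
    using K' unfolding fin_subsets_def by auto
  from \<D>[OF this \<delta>D] obtain D where D: "D \<in> \<D>" "D \<in> fin_subsets (carrier G)" "\<one> \<in> D"
      and D_inv: "invariant_set G (m_inv G ` K) \<delta>D D"
    by blast
  have D': "D \<subseteq> carrier G" "finite D" "D \<noteq> {}"
    using D unfolding fin_subsets_def by auto
  define \<delta>' where "\<delta>' = min (1 / 2) (\<delta> * \<epsilon> / 2)"
  have \<delta>': "\<delta>' > 0" "\<delta>' \<le> 1 / 2" "\<delta>' \<le> \<delta> * \<epsilon> / 2"
    using \<delta> \<epsilon> unfolding \<delta>'_def by auto
  have "\<exists>\<tau> C. quasi_tiling \<epsilon> (max \<epsilon> ((1 - \<epsilon> / 2) ^ Suc n)) (insert D \<T>) F \<tau> C"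
    if F: "F \<in> fin_subsets (carrier G)" and F_inv: "invariant_set G (K \<union> D) \<delta>' F" for F
  proof -
    have F': "F \<subseteq> carrier G" "finite F" "F \<noteq> {}"
      using F unfolding fin_subsets_def by auto
    from greedy_filling[OF D' F'(1,2) \<epsilon>] obtain C where C: "C \<subseteq> F - escaping D F"
      and C1: "(1 - \<epsilon>) * real (card C * card D) \<le> real (card (\<Union>c\<in>C. D #> c))"
      and C2: "\<epsilon> * real (card (F - escaping D F)) \<le> real (card (\<Union>c\<in>C. D #> c))"
      by blast
    define U where "U = (\<Union>c\<in>C. D #> c)"
    have UF: "U \<subseteq> F"
      using C unfolding U_def escaping_def r_coset_image by auto
    have card_FU: "real (card (F - U)) = real (card F) - real (card U)"
      using F' UF by (simp add: card_Diff_subset finite_subset of_nat_diff card_mono)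
    have C1: "(1 - \<epsilon>) * real (card C * card D) \<le> real (card U)"
      using C1 unfolding U_def .
    have eF: "escaping D F \<subseteq> F" "finite (escaping D F)"
      using F' by (auto simp: escaping_def)
    have "real (card (escaping D F)) \<le> \<delta>' * real (card F)"
      using invariant_set_mono[OF F_inv _ order_refl F'(2), of D] invariant_set_iff[OF F'(2)] by auto
    also have "\<dots> \<le> (1 / 2) * real (card F)"
      using \<delta>' by (intro mult_right_mono) auto
    finally have "real (card F) / 2 \<le> real (card (F - escaping D F))"
      using eF F' by (simp add: card_Diff_subset of_nat_diff card_mono)
    then have "\<epsilon> * (real (card F) / 2) \<le> \<epsilon> * real (card (F - escaping D F))"
      using \<epsilon> by (intro mult_left_mono) auto
    also have "\<dots> \<le> real (card U)"
      using C2 unfolding U_def .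
    finally have U_large: "real (card (F - U)) \<le> (1 - \<epsilon> / 2) * real (card F)"
      unfolding card_FU by (simp add: algebra_simps)
    show ?thesis
    proof (cases "real (card (F - U)) \<le> \<epsilon> * real (card F)")
      case True
      show ?thesis
      proof (rule quasi_tiling_extend[OF F'(1,2) D(3) C U_def C1])
        show "quasi_tiling \<epsilon> 1 \<T> (F - U) (\<lambda>_. {}) {}"
          by (simp add: quasi_tiling_def tiled_region_def)
        have "\<epsilon> * real (card F) \<le> max \<epsilon> ((1 - \<epsilon> / 2) ^ Suc n) * real (card F)"
          by (intro mult_right_mono) auto
        then show "1 * real (card (F - U)) \<le> max \<epsilon> ((1 - \<epsilon> / 2) ^ Suc n) * real (card F)"
          using True by linarith
      qed
    next
      case False
      have "F - U \<noteq> {}"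
      proof
        assume "F - U = {}"
        then show False
          using False \<epsilon> by (simp only: card.empty) simp
      qed
      then have W: "F - U \<in> fin_subsets (carrier G)"
        using F' unfolding fin_subsets_def by blast
      have CG: "C \<subseteq> carrier G" "finite C"
        using C F' by (auto intro: finite_subset)
      have "invariant_set G K \<delta> (F - U)"
        unfolding invariant_set_iff[OF finite_Diff[OF F'(2)]]
      proof -
        let ?E = "card (escaping (m_inv G ` K) D)"
        have "real (card (escaping K F)) \<le> \<delta>' * real (card F)"
          using invariant_set_mono[OF F_inv _ order_refl F'(2), of K] invariant_set_iff[OF F'(2)] by auto
        also have "\<dots> \<le> \<delta> * \<epsilon> / 2 * real (card F)"
          using \<delta>' by (intro mult_right_mono) auto
        finally have 1: "real (card (escaping K F)) \<le> \<delta> * \<epsilon> / 2 * real (card F)" .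
        have "real ?E \<le> \<delta>D * real (card D)"
          using D_inv invariant_set_iff[OF D'(2)] by auto
        then have "real (card C * (card K * ?E))
            \<le> real (card C) * (real (card K) * (\<delta>D * real (card D)))"
          by (simp add: mult_left_mono)
        also have "\<dots> = \<delta> * \<epsilon> / 2 * ((1 - \<epsilon>) * real (card C * card D))"
          using cK unfolding \<delta>D_def by (simp add: field_simps)
        also have "\<dots> \<le> \<delta> * \<epsilon> / 2 * real (card F)"
        proof (rule mult_left_mono)
          show "(1 - \<epsilon>) * real (card C * card D) \<le> real (card F)"
            using C1 card_mono[OF F'(2) UF] by linarith
        qed (use \<delta> \<epsilon> in auto)
        finally have 2: "real (card C * (card K * ?E)) \<le> \<delta> * \<epsilon> / 2 * real (card F)" .
        have "real (card (escaping K (F - U))) \<le> real (card (escaping K F) + card C * (card K * ?E))"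
          unfolding U_def using escaping_remainder[OF D'(1,2) F'(1,2) K'(1,2) CG]
          by (simp only: of_nat_le_iff)
        also have "\<dots> \<le> \<delta> * (\<epsilon> * real (card F))"
          using 1 2 by simp
        also have "\<dots> \<le> \<delta> * real (card (F - U))"
          using False \<delta> by (intro mult_left_mono) auto
        finally show "real (card (escaping K (F - U))) \<le> \<delta> * real (card (F - U))" .
      qed
      from step[OF W this] obtain \<tau>' C' where *: "quasi_tiling \<epsilon> \<eta> \<T> (F - U) \<tau>' C'"
        by blast
      show ?thesis
      proof (rule quasi_tiling_extend[OF F'(1,2) D(3) C U_def C1 *])
        have "\<eta> * real (card (F - U)) \<le> \<eta> * ((1 - \<epsilon> / 2) * real (card F))"
          using U_large \<epsilon> unfolding \<eta>_def by (intro mult_left_mono) (auto simp: le_max_iff_disj)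
        also have "\<dots> = (\<eta> * (1 - \<epsilon> / 2)) * real (card F)"
          by simp
        also have "\<dots> \<le> max \<epsilon> ((1 - \<epsilon> / 2) ^ Suc n) * real (card F)"
        proof (rule mult_right_mono)
          have "\<epsilon> * (1 - \<epsilon> / 2) \<le> \<epsilon>"
            using \<epsilon> by (simp add: algebra_simps)
          then show "\<eta> * (1 - \<epsilon> / 2) \<le> max \<epsilon> ((1 - \<epsilon> / 2) ^ Suc n)"
            unfolding \<eta>_def by (cases "\<epsilon> \<le> (1 - \<epsilon> / 2) ^ n") (auto simp: max_def mult.commute)
        qed simp
        finally show "\<eta> * real (card (F - U)) \<le> max \<epsilon> ((1 - \<epsilon> / 2) ^ Suc n) * real (card F)" .
      qed
    qed
  qed
  moreover have "K \<union> D \<in> fin_subsets (carrier G)"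
    using K' D' unfolding fin_subsets_def by auto
  moreover have "finite (insert D \<T>)" "insert D \<T> \<subseteq> \<D> \<inter> fin_subsets (carrier G)"
    using \<T> D by auto
  ultimately show ?case
    using \<delta>'(1) by blast
qed

theorem quasi_tilings_exist:
  fixes \<epsilon> :: real
  assumes \<epsilon>: "0 < \<epsilon>" "\<epsilon> < 1"
    and \<D>: "\<And>K \<delta>. K \<in> fin_subsets (carrier G) \<Longrightarrow> \<delta> > 0 \<Longrightarrow>
      \<exists>D\<in>\<D>. D \<in> fin_subsets (carrier G) \<and> \<one> \<in> D \<and> invariant_set G K \<delta> D"
  shows "\<exists>\<T> K \<delta>. finite \<T> \<and> \<T> \<subseteq> \<D> \<inter> fin_subsets (carrier G) \<and> K \<in> fin_subsets (carrier G) \<and> \<delta> > 0 \<and>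
    (\<forall>F\<in>fin_subsets (carrier G). invariant_set G K \<delta> F \<longrightarrow> (\<exists>\<tau> C. quasi_tiling \<epsilon> \<epsilon> \<T> F \<tau> C))"
proof -
  have "(\<lambda>n. (1 - \<epsilon> / 2) ^ n) \<longlonglongrightarrow> 0"
    using \<epsilon> by (intro LIMSEQ_power_zero) simp
  then have "\<forall>\<^sub>F n in sequentially. (1 - \<epsilon> / 2) ^ n < \<epsilon>"
    using \<epsilon>(1) by (rule order_tendstoD)
  then obtain n where "(1 - \<epsilon> / 2) ^ n < \<epsilon>"
    by (auto simp: eventually_sequentially)
  then have "max \<epsilon> ((1 - \<epsilon> / 2) ^ n) = \<epsilon>"
    by simp
  then show ?thesis
    using quasi_tiling_induct[OF \<epsilon> \<D>, of n] by simp
qed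

end

section \<open>Limits along almost invariant sets\<close>

text \<open>
  Convergence along this filter is the limit over almost invariant sets, which gives access to the
  general theory of limits.
\<close>

definition folner_filter :: "('g, 'q) monoid_scheme \<Rightarrow> 'g set filter" where
  "folner_filter G = (INF p\<in>fin_subsets (carrier G) \<times> {0<..}.
     principal {F \<in> fin_subsets (carrier G). invariant_set G (fst p) (snd p) F})"

context group
begin

lemma eventually_folner_filter:
  "eventually P (folner_filter G) \<longleftrightarrow>
     (\<exists>K\<in>fin_subsets (carrier G). \<exists>\<delta>>0. \<forall>F\<in>fin_subsets (carrier G). invariant_set G K \<delta> F \<longrightarrow> P F)"
proof -
  let ?J = "fin_subsets (carrier G) \<times> {0::real<..}"
  have "({\<one>}, 1) \<in> ?J"
    by (simp add: fin_subsets_def)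
  then have "?J \<noteq> {}"
    by blast
  moreover have "\<exists>x\<in>?J.
      principal {F \<in> fin_subsets (carrier G). invariant_set G (fst x) (snd x) F}
      \<le> inf (principal {F \<in> fin_subsets (carrier G). invariant_set G (fst p) (snd p) F})
          (principal {F \<in> fin_subsets (carrier G). invariant_set G (fst q) (snd q) F})"
    if "p \<in> ?J" "q \<in> ?J" for p q
  proof (rule bexI)
    show "(fst p \<union> fst q, min (snd p) (snd q)) \<in> ?J"
      using that by (auto simp: fin_subsets_def)
    show "principal {F \<in> fin_subsets (carrier G).
          invariant_set G (fst (fst p \<union> fst q, min (snd p) (snd q))) (snd (fst p \<union> fst q, min (snd p) (snd q))) F}
      \<le> inf (principal {F \<in> fin_subsets (carrier G). invariant_set G (fst p) (snd p) F})
          (principal {F \<in> fin_subsets (carrier G). invariant_set G (fst q) (snd q) F})"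
      by (auto simp: fin_subsets_def elim!: invariant_set_mono)
  qed
  ultimately have "eventually P (folner_filter G) \<longleftrightarrow> (\<exists>p\<in>?J.
      eventually P (principal {F \<in> fin_subsets (carrier G). invariant_set G (fst p) (snd p) F}))"
    unfolding folner_filter_def by (rule eventually_INF_base)
  also have "\<dots> \<longleftrightarrow> (\<exists>K\<in>fin_subsets (carrier G). \<exists>\<delta>\<in>{0<..}.
      \<forall>F\<in>fin_subsets (carrier G). invariant_set G K \<delta> F \<longrightarrow> P F)"
    unfolding eventually_principal by (simp add: Bex_def Ball_def imp_conjL)
  finally show ?thesis
    by (simp add: Bex_def)
qed

lemma eventually_folner_fin_subsets: "\<forall>\<^sub>F F in folner_filter G. F \<in> fin_subsets (carrier G)"
  unfolding eventually_folner_filter by (intro bexI[of _ "{\<one>}"] exI[of _ 1]) (auto simp: fin_subsets_def)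

lemma amenable_limit_iff: "amenable_limit G \<phi> c \<longleftrightarrow> (\<phi> \<longlongrightarrow> c) (folner_filter G)"
  unfolding amenable_limit_def tendsto_iff dist_real_def eventually_folner_filter by blast

lemma folner_filter_neq_bot:
  assumes "amenable G"
  shows "folner_filter G \<noteq> bot"
  using assms unfolding trivial_limit_def eventually_folner_filter amenable_def by blast

lemma the_amenable_limit:
  assumes "amenable G" "amenable_limit G \<phi> c"
  shows "(THE c. amenable_limit G \<phi> c) = c"
  using assms tendsto_unique[OF folner_filter_neq_bot[OF assms(1)]]
  unfolding amenable_limit_iff by blast

lemma amenable_limit_cong:
  assumes "\<And>F. F \<in> fin_subsets (carrier G) \<Longrightarrow> \<phi> F = \<psi> F"
  shows "amenable_limit G \<phi> c \<longleftrightarrow> amenable_limit G \<psi> c"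
  unfolding amenable_limit_iff
  by (rule tendsto_cong) (use eventually_folner_fin_subsets assms in \<open>auto elim: eventually_mono\<close>)

text \<open>
  Right translation preserves the degree of invariance, so a tile can be moved to contain \<open>\<one>\<close>.
\<close>

lemma invariant_tile_containing_one:
  assumes freq: "\<exists>\<^sub>F F in folner_filter G. P F"
    and trans: "\<And>F c. F \<in> fin_subsets (carrier G) \<Longrightarrow> c \<in> carrier G \<Longrightarrow> P F \<Longrightarrow> P (F #> c)"
    and K: "K \<in> fin_subsets (carrier G)" "\<delta> > 0"
  shows "\<exists>D\<in>{D. P D}. D \<in> fin_subsets (carrier G) \<and> \<one> \<in> D \<and> invariant_set G K \<delta> D"
proof -
  have "\<not> (\<forall>F\<in>fin_subsets (carrier G). invariant_set G K \<delta> F \<longrightarrow> \<not> P F)"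
    using freq K unfolding frequently_def eventually_folner_filter by blast
  then obtain F where F: "F \<in> fin_subsets (carrier G)" "invariant_set G K \<delta> F" "P F"
    by blast
  then have F': "F \<subseteq> carrier G" "finite F" "F \<noteq> {}"
    unfolding fin_subsets_def by auto
  then obtain s where s: "s \<in> F" "s \<in> carrier G"
    by auto
  have "\<one> \<in> F #> inv s"
    using s by (auto simp: r_coset_image intro!: image_eqI[of _ _ s])
  moreover have "F #> inv s \<in> fin_subsets (carrier G)"
    using F' s calculation by (auto simp: fin_subsets_def finite_r_coset dest: r_coset_subset_carrier)
  moreover have "invariant_set G K \<delta> (F #> inv s)"
    using F F' K s by (intro invariant_set_r_coset) (auto simp: fin_subsets_def)
  ultimately show ?thesis
    using trans[OF F(1) _ F(3), of "inv s"] s by blast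
qed

lemma quasi_tiling_sum_le:
  assumes F: "finite F" and \<epsilon>: "\<epsilon> < 1" and a: "0 \<le> a"
    and tiling: "quasi_tiling \<epsilon> \<eta> \<T> F \<tau> C"
    and h: "\<And>D. D \<in> \<T> \<Longrightarrow> h D \<le> a * real (card D)"
  shows "(\<Sum>c\<in>C. h (\<tau> c)) \<le> a / (1 - \<epsilon>) * real (card F)"
proof -
  have "(\<Sum>c\<in>C. h (\<tau> c)) \<le> (\<Sum>c\<in>C. a * real (card (\<tau> c)))"
    using tiling h unfolding quasi_tiling_def by (intro sum_mono) auto
  also have "\<dots> = a / (1 - \<epsilon>) * ((1 - \<epsilon>) * real (\<Sum>c\<in>C. card (\<tau> c)))"
    using \<epsilon> by (simp add: sum_distrib_left)
  also have "\<dots> \<le> a / (1 - \<epsilon>) * real (card F)"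
  proof (rule mult_left_mono)
    have "(1 - \<epsilon>) * real (\<Sum>c\<in>C. card (\<tau> c)) \<le> real (card (tiled_region \<tau> C))"
      using tiling unfolding quasi_tiling_def by blast
    also have "\<dots> \<le> real (card F)"
      using tiling F unfolding quasi_tiling_def by (simp add: card_mono)
    finally show "(1 - \<epsilon>) * real (\<Sum>c\<in>C. card (\<tau> c)) \<le> real (card F)" .
  qed (use a \<epsilon> in simp)
  finally show ?thesis .
qed

lemma subadditive_UN_le:
  fixes h :: "'a set \<Rightarrow> real"
  assumes "h {} = 0"
    and "\<And>A B. finite A \<Longrightarrow> A \<subseteq> carrier G \<Longrightarrow> finite B \<Longrightarrow> B \<subseteq> carrier G \<Longrightarrow> h (A \<union> B) \<le> h A + h B"
    and "finite C" and "\<And>c. c \<in> C \<Longrightarrow> finite (Y c) \<and> Y c \<subseteq> carrier G"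
  shows "h (\<Union>c\<in>C. Y c) \<le> (\<Sum>c\<in>C. h (Y c))"
  using assms(3,4)
proof (induction C rule: finite_induct)
  case empty
  then show ?case using assms(1) by simp
next
  case (insert c C)
  have "h (Y c \<union> (\<Union>c\<in>C. Y c)) \<le> h (Y c) + h (\<Union>c\<in>C. Y c)"
    using insert by (intro assms(2)) auto
  then show ?case
    using insert by fastforce
qed

text \<open>
  The limit is the lower limit \<open>m\<close> of \<open>h F / |F|\<close>.  There are arbitrarily invariant sets \<open>D\<close> with
  \<open>h D \<le> (m + \<epsilon>) |D|\<close>; quasi-tiling a sufficiently invariant \<open>F\<close> by such sets bounds \<open>h F / |F|\<close> by
  \<open>(m + \<epsilon>) / (1 - \<epsilon>)\<close>, plus the contribution of the uncovered points, of which there are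
  at most \<open>\<epsilon> |F|\<close>.
\<close>

theorem ornstein_weiss:
  fixes h :: "'a set \<Rightarrow> real"
  assumes amenable: "amenable G"
    and empty: "h {} = 0"
    and nonneg: "\<And>A. finite A \<Longrightarrow> A \<subseteq> carrier G \<Longrightarrow> 0 \<le> h A"
    and subadd: "\<And>A B. finite A \<Longrightarrow> A \<subseteq> carrier G \<Longrightarrow> finite B \<Longrightarrow> B \<subseteq> carrier G \<Longrightarrow> h (A \<union> B) \<le> h A + h B"
    and trans: "\<And>A c. finite A \<Longrightarrow> A \<subseteq> carrier G \<Longrightarrow> c \<in> carrier G \<Longrightarrow> h (A #> c) = h A"
  shows "\<exists>c. amenable_limit G (\<lambda>F. h F / real (card F)) c"
proof -
  define b where "b = h {\<one>}"
  have b: "0 \<le> b"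
    unfolding b_def by (rule nonneg) auto
  have singleton: "h {s} = b" if "s \<in> carrier G" for s
    using trans[of "{\<one>}" s] that unfolding b_def by (simp add: r_coset_image)
  have points: "h A \<le> b * real (card A)" if "finite A" "A \<subseteq> carrier G" for A
  proof -
    have "h (\<Union>s\<in>A. {s}) \<le> (\<Sum>s\<in>A. h {s})"
      using that by (intro subadditive_UN_le empty subadd) auto
    also have "\<dots> = (\<Sum>s\<in>A. b)"
      using that by (intro sum.cong) (auto simp: singleton)
    finally show ?thesis by (simp add: mult.commute)
  qed
  \<comment> \<open>The supremum of the eventual lower bounds is the lower limit.\<close>
  define Y where "Y = {x. \<forall>\<^sub>F F in folner_filter G. x \<le> h F / real (card F)}"
  have upper: "x \<le> b" if "x \<in> Y" for x
  proof -
    have "\<forall>\<^sub>F F in folner_filter G. x \<le> h F / real (card F) \<and> F \<in> fin_subsets (carrier G)"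
      using that eventually_folner_fin_subsets unfolding Y_def by (auto intro: eventually_conj)
    from eventually_happens'[OF folner_filter_neq_bot[OF amenable] this]
    obtain F where F: "x \<le> h F / real (card F)" "F \<in> fin_subsets (carrier G)"
      by blast
    then have "h F / real (card F) \<le> b"
      using points[of F] by (auto simp: fin_subsets_def divide_le_eq card_gt_0_iff)
    with F show ?thesis by linarith
  qed
  then have bdd: "bdd_above Y"
    by (rule bdd_aboveI)
  have "\<forall>\<^sub>F F in folner_filter G. 0 \<le> h F / real (card F)"
    using eventually_folner_fin_subsets
  proof eventually_elim
    case (elim F)
    then have "0 \<le> h F"
      unfolding fin_subsets_def by (intro nonneg) auto
    then show ?case by simp
  qed
  then have zero: "0 \<in> Y"
    unfolding Y_def by simp
  define m where "m = Sup Y"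
  have m: "0 \<le> m"
    unfolding m_def using zero bdd by (rule cSup_upper)
  have "((\<lambda>F. h F / real (card F)) \<longlongrightarrow> m) (folner_filter G)"
  proof (rule order_tendstoI)
    fix a assume "a < m"
    then obtain x where "x \<in> Y" "a < x"
      unfolding m_def using zero bdd less_cSup_iff[of Y a] by blast
    then show "\<forall>\<^sub>F F in folner_filter G. a < h F / real (card F)"
      unfolding Y_def by (auto elim: eventually_mono)
  next
    fix a assume a: "m < a"
    have "((\<lambda>\<epsilon>. (m + \<epsilon>) / (1 - \<epsilon>) + \<epsilon> * b) \<longlongrightarrow> (m + 0) / (1 - 0) + 0 * b) (at_right 0)"
      by (intro tendsto_intros) auto
    then have "((\<lambda>\<epsilon>. (m + \<epsilon>) / (1 - \<epsilon>) + \<epsilon> * b) \<longlongrightarrow> m) (at_right 0)"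
      by simp
    from order_tendstoD(2)[OF this a]
    have "\<forall>\<^sub>F \<epsilon> in at_right 0. (m + \<epsilon>) / (1 - \<epsilon>) + \<epsilon> * b < a \<and> \<epsilon> \<in> {0<..<1}"
      by (intro eventually_conj eventually_at_right_real) auto
    from eventually_happens'[OF _ this]
    obtain \<epsilon> where \<epsilon>: "(m + \<epsilon>) / (1 - \<epsilon>) + \<epsilon> * b < a" "0 < \<epsilon>" "\<epsilon> < 1"
      by auto
    let ?P = "\<lambda>D. h D \<le> (m + \<epsilon>) * real (card D)"
    have "\<exists>\<^sub>F F in folner_filter G. ?P F"
    proof (rule ccontr)
      assume "\<not> ?thesis"
      then have "\<forall>\<^sub>F F in folner_filter G. \<not> ?P F"
        by (simp add: not_frequently)
      with eventually_folner_fin_subsets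
      have "\<forall>\<^sub>F F in folner_filter G. m + \<epsilon> \<le> h F / real (card F)"
        by eventually_elim (auto simp: fin_subsets_def le_divide_eq card_gt_0_iff)
      then have "m + \<epsilon> \<in> Y"
        by (simp add: Y_def)
      then have "m + \<epsilon> \<le> m"
        unfolding m_def by (rule cSup_upper[OF _ bdd])
      with \<epsilon> show False by simp
    qed
    moreover have "?P (F #> c)" if "F \<in> fin_subsets (carrier G)" "c \<in> carrier G" "?P F" for F c
      using that trans[of F c] by (simp add: fin_subsets_def card_r_coset)
    ultimately have tiles: "\<exists>D\<in>{D. ?P D}. D \<in> fin_subsets (carrier G) \<and> \<one> \<in> D \<and> invariant_set G K \<delta> D"
      if "K \<in> fin_subsets (carrier G)" "\<delta> > 0" for K \<delta>
      using that by (rule invariant_tile_containing_one)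
    obtain \<T> K \<delta> where \<T>: "\<T> \<subseteq> {D. ?P D} \<inter> fin_subsets (carrier G)"
      and K: "K \<in> fin_subsets (carrier G)" "\<delta> > 0"
      and tiling: "\<And>F. F \<in> fin_subsets (carrier G) \<Longrightarrow> invariant_set G K \<delta> F \<Longrightarrow>
        \<exists>\<tau> C. quasi_tiling \<epsilon> \<epsilon> \<T> F \<tau> C"
      using quasi_tilings_exist[OF \<epsilon>(2,3) tiles] by blast
    have "h F / real (card F) < a"
      if F: "F \<in> fin_subsets (carrier G)" and F_inv: "invariant_set G K \<delta> F" for F
    proof -
      have F': "F \<subseteq> carrier G" "finite F" "0 < real (card F)"
        using F by (auto simp: fin_subsets_def card_gt_0_iff)
      from tiling[OF F F_inv] obtain \<tau> C where *: "quasi_tiling \<epsilon> \<epsilon> \<T> F \<tau> C"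
        by blast
      let ?U = "tiled_region \<tau> C"
      have C: "C \<subseteq> F" "?U \<subseteq> F" "real (card (F - ?U)) \<le> \<epsilon> * real (card F)" "\<tau> ` C \<subseteq> \<T>"
        using * unfolding quasi_tiling_def by auto
      have \<tau>: "?P (\<tau> c) \<and> finite (\<tau> c) \<and> \<tau> c \<subseteq> carrier G" if "c \<in> C" for c
      proof -
        have "\<tau> c \<in> {D. ?P D} \<inter> fin_subsets (carrier G)"
          using that C(4) \<T> by blast
        then show ?thesis
          unfolding fin_subsets_def by blast
      qed
      have fC: "finite C"
        using C F' by (auto intro: finite_subset)
      have "h F \<le> h (F - ?U) + h ?U"
        using subadd[of "F - ?U" ?U] F' C by (auto simp: Un_absorb2 intro: finite_subset)
      moreover have "h (F - ?U) \<le> b * (\<epsilon> * real (card F))"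
        using F' by (intro order_trans[OF points[of "F - ?U"] mult_left_mono[OF C(3) b]]) auto
      moreover have "h ?U \<le> (m + \<epsilon>) / (1 - \<epsilon>) * real (card F)"
      proof -
        have "h ?U \<le> (\<Sum>c\<in>C. h (\<tau> c #> c))"
          unfolding tiled_region_def using fC \<tau> C(1) F'(1)
          by (intro subadditive_UN_le empty subadd conjI finite_r_coset r_coset_subset_carrier) auto
        also have "\<dots> = (\<Sum>c\<in>C. h (\<tau> c))"
          using \<tau> C(1) F'(1) by (intro sum.cong trans) auto
        also have "\<dots> \<le> (m + \<epsilon>) / (1 - \<epsilon>) * real (card F)"
          using \<T> m \<epsilon> by (intro quasi_tiling_sum_le[OF F'(2) \<epsilon>(3) _ *]) auto
        finally show ?thesis .
      qed
      ultimately have "h F \<le> ((m + \<epsilon>) / (1 - \<epsilon>) + \<epsilon> * b) * real (card F)"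
        by (simp add: algebra_simps)
      also have "\<dots> < a * real (card F)"
        using \<epsilon> F' by (intro mult_strict_right_mono) auto
      finally show ?thesis
        using F' by (simp add: divide_less_eq)
    qed
    then show "\<forall>\<^sub>F F in folner_filter G. h F / real (card F) < a"
      unfolding eventually_folner_filter using K by blast
  qed
  then show ?thesis
    unfolding amenable_limit_iff by blast
qed

end

section \<open>Module constructions\<close>

lemma left_module_imp_abelian_group: "left_module R M \<Longrightarrow> abelian_group M"
  unfolding left_module_def by blast

text \<open>
  This yields the module axioms for transported modules and for quotients alike.
\<close>

lemma left_module_surj_image:
  assumes M: "left_module R M"
    and carrier: "carrier N = \<pi> ` carrier M"
    and add: "\<And>x y. x \<in> carrier M \<Longrightarrow> y \<in> carrier M \<Longrightarrow> \<pi> (x \<oplus>\<^bsub>M\<^esub> y) = \<pi> x \<oplus>\<^bsub>N\<^esub> \<pi> y"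
    and smult: "\<And>r x. r \<in> carrier R \<Longrightarrow> x \<in> carrier M \<Longrightarrow> \<pi> (r \<odot>\<^bsub>M\<^esub> x) = r \<odot>\<^bsub>N\<^esub> \<pi> x"
    and zero_eq: "\<pi> \<zero>\<^bsub>M\<^esub> = \<zero>\<^bsub>N\<^esub>"
  shows "left_module R N"
proof -
  interpret left_module R M by fact
  have N: "\<exists>x\<in>carrier M. y = \<pi> x" if "y \<in> carrier N" for y
    using that carrier by auto
  have \<pi>: "\<pi> x \<in> carrier N" if "x \<in> carrier M" for x
    using that carrier by auto
  have "abelian_group N"
  proof (rule abelian_groupI)
    show "\<zero>\<^bsub>N\<^esub> \<in> carrier N"
      using \<pi>[of "\<zero>\<^bsub>M\<^esub>"] zero_eq by simp
    fix x assume "x \<in> carrier N"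
    then obtain a where a: "a \<in> carrier M" "x = \<pi> a"
      using N by blast
    show "\<zero>\<^bsub>N\<^esub> \<oplus>\<^bsub>N\<^esub> x = x"
      using add[of "\<zero>\<^bsub>M\<^esub>" a] a zero_eq by simp
    have "\<pi> (\<ominus>\<^bsub>M\<^esub> a) \<oplus>\<^bsub>N\<^esub> x = \<zero>\<^bsub>N\<^esub>"
      using add[of "\<ominus>\<^bsub>M\<^esub> a" a] a zero_eq by (simp add: M.l_neg)
    then show "\<exists>y\<in>carrier N. y \<oplus>\<^bsub>N\<^esub> x = \<zero>\<^bsub>N\<^esub>"
      using \<pi>[of "\<ominus>\<^bsub>M\<^esub> a"] a by blast
    fix y assume "y \<in> carrier N"
    then obtain b where b: "b \<in> carrier M" "y = \<pi> b"
      using N by blast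
    show "x \<oplus>\<^bsub>N\<^esub> y \<in> carrier N"
      using add[of a b] a b \<pi>[of "a \<oplus>\<^bsub>M\<^esub> b"] by simp
    show "x \<oplus>\<^bsub>N\<^esub> y = y \<oplus>\<^bsub>N\<^esub> x"
      using add[of a b] add[of b a] a b by (simp add: M.a_comm)
    fix z assume "z \<in> carrier N"
    then obtain c where c: "c \<in> carrier M" "z = \<pi> c"
      using N by blast
    show "x \<oplus>\<^bsub>N\<^esub> y \<oplus>\<^bsub>N\<^esub> z = x \<oplus>\<^bsub>N\<^esub> (y \<oplus>\<^bsub>N\<^esub> z)"
      using add[of a b] add[of "a \<oplus>\<^bsub>M\<^esub> b" c] add[of b c] add[of a "b \<oplus>\<^bsub>M\<^esub> c"] a b c
      by (simp add: M.a_assoc)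
  qed
  moreover have "left_module_axioms R N"
  proof (rule left_module_axioms.intro)
    fix r x assume r: "r \<in> carrier R" and "x \<in> carrier N"
    then obtain a where a: "a \<in> carrier M" "x = \<pi> a"
      using N by blast
    show "r \<odot>\<^bsub>N\<^esub> x \<in> carrier N"
      using smult[of r a] r a \<pi> smult_closed by metis
    {
      fix s assume s: "s \<in> carrier R"
      show "(r \<oplus>\<^bsub>R\<^esub> s) \<odot>\<^bsub>N\<^esub> x = r \<odot>\<^bsub>N\<^esub> x \<oplus>\<^bsub>N\<^esub> s \<odot>\<^bsub>N\<^esub> x"
        using smult[of r a] smult[of s a] smult[of "r \<oplus>\<^bsub>R\<^esub> s" a] r s a
          add[of "r \<odot>\<^bsub>M\<^esub> a" "s \<odot>\<^bsub>M\<^esub> a"] by (simp add: smult_closed smult_l_distr)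
      show "(r \<otimes>\<^bsub>R\<^esub> s) \<odot>\<^bsub>N\<^esub> x = r \<odot>\<^bsub>N\<^esub> (s \<odot>\<^bsub>N\<^esub> x)"
        using smult[of r "s \<odot>\<^bsub>M\<^esub> a"] smult[of s a] smult[of "r \<otimes>\<^bsub>R\<^esub> s" a] r s a
        by (simp add: smult_closed smult_assoc1)
    }
    fix y assume "y \<in> carrier N"
    then obtain b where b: "b \<in> carrier M" "y = \<pi> b"
      using N by blast
    show "r \<odot>\<^bsub>N\<^esub> (x \<oplus>\<^bsub>N\<^esub> y) = r \<odot>\<^bsub>N\<^esub> x \<oplus>\<^bsub>N\<^esub> r \<odot>\<^bsub>N\<^esub> y"
      using smult[of r a] smult[of r b] smult[of r "a \<oplus>\<^bsub>M\<^esub> b"] add[of a b] r a b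
        add[of "r \<odot>\<^bsub>M\<^esub> a" "r \<odot>\<^bsub>M\<^esub> b"] by (simp add: smult_closed smult_r_distr)
  next
    fix x assume "x \<in> carrier N"
    then obtain a where a: "a \<in> carrier M" "x = \<pi> a"
      using N by blast
    show "\<one>\<^bsub>R\<^esub> \<odot>\<^bsub>N\<^esub> x = x"
      using smult[of "\<one>\<^bsub>R\<^esub>" a] a by (simp add: smult_one)
  qed
  ultimately show ?thesis
    using M unfolding left_module_def by blast
qed

lemma copy_module_simps:
  "carrier (copy_module f M) = f ` carrier M"
  "\<zero>\<^bsub>copy_module f M\<^esub> = f \<zero>\<^bsub>M\<^esub>"
  by (simp_all add: copy_module_def Let_def)

lemma copy_module_add:
  "inj_on f (carrier M) \<Longrightarrow> x \<in> carrier M \<Longrightarrow> y \<in> carrier M \<Longrightarrow>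
    f x \<oplus>\<^bsub>copy_module f M\<^esub> f y = f (x \<oplus>\<^bsub>M\<^esub> y)"
  by (simp add: copy_module_def Let_def inv_into_f_f)

lemma copy_module_smult:
  "inj_on f (carrier M) \<Longrightarrow> x \<in> carrier M \<Longrightarrow> r \<odot>\<^bsub>copy_module f M\<^esub> f x = f (r \<odot>\<^bsub>M\<^esub> x)"
  by (simp add: copy_module_def Let_def inv_into_f_f)

lemma left_module_copy_module:
  assumes "left_module R M" "inj_on f (carrier M)"
  shows "left_module R (copy_module f M)"
  by (rule left_module_surj_image[OF assms(1), where \<pi> = f])
    (simp_all add: copy_module_simps copy_module_add[OF assms(2)] copy_module_smult[OF assms(2)])

lemma left_module_prod_module:
  assumes "left_module R M" "left_module R N"
  shows "left_module R (prod_module M N)"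
proof -
  interpret M: left_module R M by fact
  interpret N: left_module R N by fact
  have "abelian_group (prod_module M N)"
  proof (rule abelian_groupI)
    fix x assume x: "x \<in> carrier (prod_module M N)"
    show "\<exists>y\<in>carrier (prod_module M N). y \<oplus>\<^bsub>prod_module M N\<^esub> x = \<zero>\<^bsub>prod_module M N\<^esub>"
      using x by (intro bexI[of _ "(\<ominus>\<^bsub>M\<^esub> fst x, \<ominus>\<^bsub>N\<^esub> snd x)"])
        (auto simp: prod_module_def M.M.l_neg N.M.l_neg)
  qed (auto simp: prod_module_def M.M.a_ac N.M.a_ac)
  moreover have "left_module_axioms R (prod_module M N)"
    by unfold_locales
      (auto simp: prod_module_def M.smult_closed N.smult_closed M.smult_l_distr N.smult_l_distr
        M.smult_r_distr N.smult_r_distr M.smult_assoc1 N.smult_assoc1 M.smult_one N.smult_one)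
  ultimately show ?thesis
    using assms unfolding left_module_def by blast
qed

lemma left_module_homD:
  assumes "\<phi> \<in> left_module_hom R M N"
  shows "\<And>x. x \<in> carrier M \<Longrightarrow> \<phi> x \<in> carrier N"
    and "\<And>x y. x \<in> carrier M \<Longrightarrow> y \<in> carrier M \<Longrightarrow> \<phi> (x \<oplus>\<^bsub>M\<^esub> y) = \<phi> x \<oplus>\<^bsub>N\<^esub> \<phi> y"
    and "\<And>r x. r \<in> carrier R \<Longrightarrow> x \<in> carrier M \<Longrightarrow> \<phi> (r \<odot>\<^bsub>M\<^esub> x) = r \<odot>\<^bsub>N\<^esub> \<phi> x"
  using assms unfolding left_module_hom_def by auto

lemma set_add_image: "A <+>\<^bsub>M\<^esub> B = (\<lambda>(x, y). x \<oplus>\<^bsub>M\<^esub> y) ` (A \<times> B)"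
  by (auto simp: set_add_def')

lemma nonempty_subsets_set_add:
  assumes "abelian_group M" "A \<in> nonempty_subsets (carrier M)" "B \<in> nonempty_subsets (carrier M)"
  shows "A <+>\<^bsub>M\<^esub> B \<in> nonempty_subsets (carrier M)"
proof -
  interpret abelian_group M by fact
  show ?thesis
    using assms(2,3) by (auto simp: nonempty_subsets_def set_add_image)
qed

lemma fin_subsets_imp_nonempty_subsets: "A \<in> fin_subsets S \<Longrightarrow> A \<in> nonempty_subsets S"
  by (auto simp: fin_subsets_def nonempty_subsets_def)

lemma infinite_imp_inj_pair:
  assumes "infinite (UNIV :: 'u set)"
  shows "\<exists>f :: 'u \<times> 'u \<Rightarrow> 'u. inj f"
proof -
  have "|UNIV \<times> UNIV :: ('u \<times> 'u) set| =o |UNIV :: 'u set|"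
    using card_of_Times_same_infinite[OF assms] .
  then obtain f where "bij_betw f (UNIV \<times> UNIV :: ('u \<times> 'u) set) (UNIV :: 'u set)"
    using card_of_ordIso by blast
  then show ?thesis
    by (auto simp: bij_betw_def)
qed


section \<open>Properties of proper upgradings\<close>

locale proper_length =
  fixes R :: "('r, 'p) ring_scheme"
    and l :: "('r, 'u) module \<Rightarrow> 'u set \<Rightarrow> ennreal"
    and l2 :: "('r, 'u) module \<Rightarrow> 'u set \<Rightarrow> 'u set \<Rightarrow> ennreal"
  assumes infinite_universe: "infinite (UNIV :: 'u set)"
    and ring: "ring R"
    and proper: "proper_upgrading R l l2"
begin

lemma upgrade: "upgrading R l l2" and bivariant: "bivariant_weak_length_function R l2"
  using proper unfolding proper_upgrading_def upgrading_def by blast+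

lemma l2_zero_right:
  "left_module R M \<Longrightarrow> A \<in> nonempty_subsets (carrier M) \<Longrightarrow> l2 M A {\<zero>\<^bsub>M\<^esub>} = l M A"
  using upgrade unfolding upgrading_def by blast

lemma l2_zero_zero: "left_module R M \<Longrightarrow> l2 M {\<zero>\<^bsub>M\<^esub>} {\<zero>\<^bsub>M\<^esub>} = 0"
  using bivariant unfolding bivariant_weak_length_function_def by blast

lemma l2_hom:
  "left_module R M \<Longrightarrow> left_module R N \<Longrightarrow> \<phi> \<in> left_module_hom R M N \<Longrightarrow>
    A \<in> nonempty_subsets (carrier M) \<Longrightarrow> B \<in> nonempty_subsets (carrier M) \<Longrightarrow>
    l2 N (\<phi> ` A) (\<phi> ` B) \<le> l2 M A B"
  using bivariant unfolding bivariant_weak_length_function_def by blast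

lemma l2_triangle:
  "left_module R M \<Longrightarrow> A \<in> fin_subsets (carrier M) \<Longrightarrow> B \<in> fin_subsets (carrier M) \<Longrightarrow>
    C \<in> fin_subsets (carrier M) \<Longrightarrow> l2 M A C \<le> l2 M A B + l2 M B C"
  using proper unfolding proper_upgrading_def by blast

lemma l2_kernel_approx:
  assumes "left_module R M" "left_module R N" "\<phi> \<in> left_module_hom R M N"
    and "A \<in> fin_subsets (carrier M)" "0 < \<epsilon>"
  obtains B where "B \<in> fin_subsets (a_kernel M N \<phi>)"
    and "l2 M A B \<le> l (N\<lparr>carrier := \<phi> ` carrier M\<rparr>) (\<phi> ` A) + ennreal \<epsilon>"
  using proper assms unfolding proper_upgrading_def by blast

lemma l2_mono:
  assumes M: "left_module R M" and A: "A \<subseteq> A'" "A \<in> nonempty_subsets (carrier M)"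
      "A' \<in> nonempty_subsets (carrier M)" and B: "B \<in> nonempty_subsets (carrier M)"
  shows "l2 M A B \<le> l2 M A' B"
proof -
  have "directed_family (carrier M) {A, A'}"
    using A unfolding directed_family_def by auto
  then have "l2 M (\<Union>{A, A'}) B = (SUP A\<in>{A, A'}. l2 M A B)"
    using bivariant M B unfolding bivariant_weak_length_function_def by blast
  moreover have "\<Union>{A, A'} = A'"
    using A by auto
  ultimately show ?thesis
    by (simp add: sup.absorb_iff2)
qed

lemma l2_antimono:
  assumes M: "left_module R M" and B: "B \<subseteq> B'" "B \<in> nonempty_subsets (carrier M)"
      "B' \<in> nonempty_subsets (carrier M)" and A: "A \<in> fin_subsets (carrier M)"
  shows "l2 M A B' \<le> l2 M A B"
proof -
  have "directed_family (carrier M) {B, B'}"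
    using B unfolding directed_family_def by auto
  then have "l2 M A (\<Union>{B, B'}) = (INF B\<in>{B, B'}. l2 M A B)"
    using bivariant M A unfolding bivariant_weak_length_function_def by blast
  moreover have "\<Union>{B, B'} = B'"
    using B by auto
  ultimately show ?thesis
    by (simp add: inf.absorb_iff2)
qed

lemma l2_eq_INF_fin_subsets:
  assumes M: "left_module R M" and N: "N \<in> nonempty_subsets (carrier M)"
    and A: "A \<in> fin_subsets (carrier M)"
  shows "l2 M A N = (INF B\<in>fin_subsets N. l2 M A B)"
proof -
  have "directed_family (carrier M) (fin_subsets N)"
    unfolding directed_family_def
  proof (intro conjI ballI)
    show "fin_subsets N \<noteq> {}" "fin_subsets N \<subseteq> nonempty_subsets (carrier M)"
      using N unfolding fin_subsets_def nonempty_subsets_def by (auto intro: exI[of _ "{_}"])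
    fix A B assume "A \<in> fin_subsets N" "B \<in> fin_subsets N"
    then show "\<exists>C\<in>fin_subsets N. A \<subseteq> C \<and> B \<subseteq> C"
      unfolding fin_subsets_def by (intro bexI[of _ "A \<union> B"]) auto
  qed
  moreover have "\<Union>(fin_subsets N) = N"
    unfolding fin_subsets_def by auto
  ultimately show ?thesis
    using bivariant M A unfolding bivariant_weak_length_function_def by metis
qed

text \<open>
  Addition is a homomorphism from \<open>M \<times> M\<close> to \<open>M\<close>, so the inequality follows from the product axiom.
\<close>

lemma l2_set_add:
  assumes M: "left_module R M"
    and sets: "A \<in> nonempty_subsets (carrier M)" "B \<in> nonempty_subsets (carrier M)"
      "A' \<in> nonempty_subsets (carrier M)" "B' \<in> nonempty_subsets (carrier M)"
  shows "l2 M (A <+>\<^bsub>M\<^esub> A') (B <+>\<^bsub>M\<^esub> B') \<le> l2 M A B + l2 M A' B'"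
proof -
  interpret left_module R M by fact
  let ?P = "prod_module M M"
  define f where "f = (SOME f :: 'u \<times> 'u \<Rightarrow> 'u. inj_on f (carrier ?P))"
  have f: "inj_on f (carrier ?P)"
    unfolding f_def using infinite_imp_inj_pair[OF infinite_universe]
    by (rule someI2_ex[OF ex_forward]) (auto intro: inj_on_subset)
  let ?N = "copy_module f ?P"
  define h where "h = (\<lambda>(x, y). x \<oplus>\<^bsub>M\<^esub> y) \<circ> inv_into (carrier ?P) f"
  have cP: "carrier ?P = carrier M \<times> carrier M"
    by (simp add: prod_module_def)
  have P: "left_module R ?P"
    using M by (intro left_module_prod_module)
  have N: "left_module R ?N"
    using P f by (rule left_module_copy_module)
  interpret P: left_module R ?P by fact
  have h_f: "h (f p) = fst p \<oplus>\<^bsub>M\<^esub> snd p" if "p \<in> carrier ?P" for p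
    using that f by (simp add: h_def case_prod_beta)
  have "h \<in> left_module_hom R ?N M"
    unfolding left_module_hom_def
  proof (intro CollectI conjI ballI)
    show "h \<in> carrier ?N \<rightarrow> carrier M"
      using h_f cP by (auto simp: copy_module_simps)
    fix x assume "x \<in> carrier ?N"
    then obtain p where p: "p \<in> carrier ?P" "x = f p"
      by (auto simp: copy_module_simps)
    {
      fix y assume "y \<in> carrier ?N"
      then obtain q where q: "q \<in> carrier ?P" "y = f q"
        by (auto simp: copy_module_simps)
      have "h (x \<oplus>\<^bsub>?N\<^esub> y) = h (f (p \<oplus>\<^bsub>?P\<^esub> q))"
        using p q f by (simp add: copy_module_add)
      also have "\<dots> = fst (p \<oplus>\<^bsub>?P\<^esub> q) \<oplus>\<^bsub>M\<^esub> snd (p \<oplus>\<^bsub>?P\<^esub> q)"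
        using p q by (intro h_f) (rule P.M.a_closed)
      also have "\<dots> = h x \<oplus>\<^bsub>M\<^esub> h y"
        using p q h_f[of p] h_f[of q] cP by (auto simp: prod_module_def M.a_ac)
      finally show "h (x \<oplus>\<^bsub>?N\<^esub> y) = h x \<oplus>\<^bsub>M\<^esub> h y" .
    }
    fix r assume r: "r \<in> carrier R"
    have "h (r \<odot>\<^bsub>?N\<^esub> x) = h (f (r \<odot>\<^bsub>?P\<^esub> p))"
      using p f by (simp add: copy_module_smult)
    also have "\<dots> = fst (r \<odot>\<^bsub>?P\<^esub> p) \<oplus>\<^bsub>M\<^esub> snd (r \<odot>\<^bsub>?P\<^esub> p)"
      using p r by (intro h_f P.smult_closed)
    also have "\<dots> = r \<odot>\<^bsub>M\<^esub> h x"
      using p r h_f[of p] cP by (auto simp: prod_module_def smult_r_distr)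
    finally show "h (r \<odot>\<^bsub>?N\<^esub> x) = r \<odot>\<^bsub>M\<^esub> h x" .
  qed
  moreover have image: "h ` f ` (S \<times> T) = S <+>\<^bsub>M\<^esub> T" if "S \<subseteq> carrier M" "T \<subseteq> carrier M" for S T
  proof -
    have "h ` f ` (S \<times> T) = (\<lambda>(x, y). x \<oplus>\<^bsub>M\<^esub> y) ` (S \<times> T)"
      unfolding image_image using that by (intro image_cong refl) (use cP h_f in force)
    then show ?thesis by (simp add: set_add_image)
  qed
  moreover have nonempty: "f ` (S \<times> T) \<in> nonempty_subsets (carrier ?N)"
    if "S \<in> nonempty_subsets (carrier M)" "T \<in> nonempty_subsets (carrier M)" for S T
    using that by (auto simp: nonempty_subsets_def copy_module_simps cP)
  ultimately have "l2 M (A <+>\<^bsub>M\<^esub> A') (B <+>\<^bsub>M\<^esub> B') \<le> l2 ?N (f ` (A \<times> A')) (f ` (B \<times> B'))"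
    using l2_hom[OF N M, of h "f ` (A \<times> A')" "f ` (B \<times> B')"] sets
    by (simp add: nonempty_subsets_def)
  also have "\<dots> = ext_len2 l2 ?P (A \<times> A') (B \<times> B')"
    by (simp add: ext_len2_def f_def Let_def)
  also have "\<dots> = l2 M A B + l2 M A' B'"
    using bivariant M sets unfolding bivariant_weak_length_function_def by blast
  finally show ?thesis .
qed

text \<open>
  The finite subsets \<open>B\<close> of the kernel provided by properness bound \<open>l2 M A (a_kernel M N \<phi>)\<close> from
  above; conversely \<open>\<phi>\<close> maps the kernel to \<open>0\<close> and \<open>l2 N (\<phi> ` A) {\<zero>\<^bsub>N\<^esub>}\<close> is the length of \<open>\<phi> ` A\<close>.
\<close>

lemma l2_kernel:
  assumes M: "left_module R M" and N: "left_module R N" and \<phi>: "\<phi> \<in> left_module_hom R M N"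
    and surj: "\<phi> ` carrier M = carrier N" and A: "A \<in> fin_subsets (carrier M)"
  shows "l2 M A (a_kernel M N \<phi>) = l N (\<phi> ` A)"
proof (rule antisym)
  interpret M: left_module R M by fact
  interpret N: left_module R N by fact
  have "\<phi> \<zero>\<^bsub>M\<^esub> \<oplus>\<^bsub>N\<^esub> \<phi> \<zero>\<^bsub>M\<^esub> = \<phi> \<zero>\<^bsub>M\<^esub>"
    using left_module_homD(2)[OF \<phi>, of "\<zero>\<^bsub>M\<^esub>" "\<zero>\<^bsub>M\<^esub>"] by simp
  then have zero: "\<phi> \<zero>\<^bsub>M\<^esub> = \<zero>\<^bsub>N\<^esub>"
    using left_module_homD(1)[OF \<phi>, of "\<zero>\<^bsub>M\<^esub>"] N.M.add.r_cancel_one' by simp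
  then have ker: "a_kernel M N \<phi> \<in> nonempty_subsets (carrier M)"
    using M.M.zero_closed by (auto simp: a_kernel_def' nonempty_subsets_def simp del: M.M.zero_closed)
  show "l2 M A (a_kernel M N \<phi>) \<le> l N (\<phi> ` A)"
  proof (rule ennreal_le_epsilon)
    fix \<epsilon> :: real assume "0 < \<epsilon>"
    from l2_kernel_approx[OF M N \<phi> A this]
    obtain B where B: "B \<in> fin_subsets (a_kernel M N \<phi>)"
        "l2 M A B \<le> l (N\<lparr>carrier := \<phi> ` carrier M\<rparr>) (\<phi> ` A) + ennreal \<epsilon>" .
    have "l2 M A (a_kernel M N \<phi>) \<le> l2 M A B"
      using B(1) ker unfolding l2_eq_INF_fin_subsets[OF M ker A] by (intro INF_lower)
    also have "N\<lparr>carrier := \<phi> ` carrier M\<rparr> = N"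
      using surj by simp
    note B(2)[unfolded this]
    finally show "l2 M A (a_kernel M N \<phi>) \<le> l N (\<phi> ` A) + ennreal \<epsilon>" .
  qed
  have "\<phi> ` a_kernel M N \<phi> = {\<zero>\<^bsub>N\<^esub>}"
    using zero M.M.zero_closed by (auto simp: a_kernel_def' image_iff simp del: M.M.zero_closed)
  moreover have "\<phi> ` A \<in> nonempty_subsets (carrier N)"
    using A left_module_homD(1)[OF \<phi>] by (auto simp: fin_subsets_def nonempty_subsets_def)
  ultimately show "l N (\<phi> ` A) \<le> l2 M A (a_kernel M N \<phi>)"
    using l2_hom[OF M N \<phi> fin_subsets_imp_nonempty_subsets[OF A] ker] l2_zero_right[OF N] by simp
qed

end

section \<open>Sums of translates in modules over the group ring\<close>

context abelian_group
begin

lemma set_add_closed: "A \<subseteq> carrier G \<Longrightarrow> B \<subseteq> carrier G \<Longrightarrow> A <+>\<^bsub>G\<^esub> B \<subseteq> carrier G"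
  by (auto simp: set_add_image)

lemma set_add_zero: "A \<subseteq> carrier G \<Longrightarrow> {\<zero>} <+>\<^bsub>G\<^esub> A = A"
  by (force simp: set_add_def')

lemma set_add_assoc:
  assumes "A \<subseteq> carrier G" "B \<subseteq> carrier G" "C \<subseteq> carrier G"
  shows "A <+>\<^bsub>G\<^esub> B <+>\<^bsub>G\<^esub> C = A <+>\<^bsub>G\<^esub> (B <+>\<^bsub>G\<^esub> C)"
  using assms add.set_mult_assoc unfolding set_add_def by blast

lemma set_add_commute:
  assumes "A \<subseteq> carrier G" "B \<subseteq> carrier G"
  shows "A <+>\<^bsub>G\<^esub> B = B <+>\<^bsub>G\<^esub> A"
  using assms by (force simp: set_add_def' a_comm)

lemma set_add_swap:
  assumes "A \<subseteq> carrier G" "B \<subseteq> carrier G" "C \<subseteq> carrier G" "D \<subseteq> carrier G"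
  shows "(A <+>\<^bsub>G\<^esub> B) <+>\<^bsub>G\<^esub> (C <+>\<^bsub>G\<^esub> D) = (A <+>\<^bsub>G\<^esub> C) <+>\<^bsub>G\<^esub> (B <+>\<^bsub>G\<^esub> D)"
proof -
  have "(A <+>\<^bsub>G\<^esub> B) <+>\<^bsub>G\<^esub> (C <+>\<^bsub>G\<^esub> D) = A <+>\<^bsub>G\<^esub> (B <+>\<^bsub>G\<^esub> C <+>\<^bsub>G\<^esub> D)"
    using assms by (simp add: set_add_assoc set_add_closed)
  also have "B <+>\<^bsub>G\<^esub> C = C <+>\<^bsub>G\<^esub> B"
    using assms by (intro set_add_commute)
  finally show ?thesis
    using assms by (simp add: set_add_assoc set_add_closed)
qed

end

lemma set_add_mono: "A \<subseteq> A' \<Longrightarrow> B \<subseteq> B' \<Longrightarrow> A <+>\<^bsub>M\<^esub> B \<subseteq> A' <+>\<^bsub>M\<^esub> B'"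
  by (auto simp: set_add_def')

lemma finite_set_add: "finite A \<Longrightarrow> finite B \<Longrightarrow> finite (A <+>\<^bsub>M\<^esub> B)"
  by (simp add: set_add_image)

lemma image_set_add:
  assumes "\<And>x y. x \<in> A \<Longrightarrow> y \<in> B \<Longrightarrow> \<pi> (x \<oplus>\<^bsub>M\<^esub> y) = \<pi> x \<oplus>\<^bsub>N\<^esub> \<pi> y"
  shows "\<pi> ` (A <+>\<^bsub>M\<^esub> B) = \<pi> ` A <+>\<^bsub>N\<^esub> \<pi> ` B"
  using assms by (force simp: set_add_def')

locale group_ring_module = R: ring R + G: group G + M: left_module "group_ring R G" M
  for R :: "('r, 'p) ring_scheme" and G :: "('g, 'q) monoid_scheme"
    and M :: "('g \<Rightarrow> 'r, 'm) module"
begin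

lemma single_closed:
  "r \<in> carrier R \<Longrightarrow> s \<in> carrier G \<Longrightarrow> group_ring_single R r s \<in> carrier (group_ring R G)"
  by (auto simp: group_ring_def group_ring_single_def intro: finite_subset[of _ "{s}"])

lemma single_add:
  "r \<in> carrier R \<Longrightarrow> r' \<in> carrier R \<Longrightarrow>
    group_ring_single R (r \<oplus>\<^bsub>R\<^esub> r') s
    = group_ring_single R r s \<oplus>\<^bsub>group_ring R G\<^esub> group_ring_single R r' s"
  by (auto simp: group_ring_def group_ring_single_def)

lemma single_mult:
  assumes r: "r \<in> carrier R" "r' \<in> carrier R" and s: "s \<in> carrier G" "t \<in> carrier G"
  shows "group_ring_single R r s \<otimes>\<^bsub>group_ring R G\<^esub> group_ring_single R r' t
    = group_ring_single R (r \<otimes>\<^bsub>R\<^esub> r') (s \<otimes>\<^bsub>G\<^esub> t)"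
proof
  fix u
  let ?f = "group_ring_single R r s" and ?g = "group_ring_single R r' t"
  have "(?f \<otimes>\<^bsub>group_ring R G\<^esub> ?g) u = \<zero>\<^bsub>R\<^esub>" if "u \<notin> carrier G"
    using that by (simp add: group_ring_def)
  moreover have "(?f \<otimes>\<^bsub>group_ring R G\<^esub> ?g) u = group_ring_single R (r \<otimes>\<^bsub>R\<^esub> r') (s \<otimes>\<^bsub>G\<^esub> t) u"
    if u: "u \<in> carrier G"
  proof -
    have "(?f \<otimes>\<^bsub>group_ring R G\<^esub> ?g) u
        = (\<Oplus>\<^bsub>R\<^esub>v\<in>{v. ?f v \<noteq> \<zero>\<^bsub>R\<^esub>}. ?f v \<otimes>\<^bsub>R\<^esub> ?g (inv\<^bsub>G\<^esub> v \<otimes>\<^bsub>G\<^esub> u))"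
      using u by (simp add: group_ring_def)
    also have "\<dots> = r \<otimes>\<^bsub>R\<^esub> ?g (inv\<^bsub>G\<^esub> s \<otimes>\<^bsub>G\<^esub> u)"
    proof (cases "r = \<zero>\<^bsub>R\<^esub>")
      case True
      have "{v. ?f v \<noteq> \<zero>\<^bsub>R\<^esub>} = {}"
        using True by (auto simp: group_ring_single_def)
      then show ?thesis
        using True r by (simp add: group_ring_single_def)
    next
      case False
      then have "{v. ?f v \<noteq> \<zero>\<^bsub>R\<^esub>} = {s}"
        by (auto simp: group_ring_single_def)
      then show ?thesis
        using r by (simp add: group_ring_single_def R.finsum_insert)
    qed
    also have "\<dots> = group_ring_single R (r \<otimes>\<^bsub>R\<^esub> r') (s \<otimes>\<^bsub>G\<^esub> t) u"
    proof -
      have "inv\<^bsub>G\<^esub> s \<otimes>\<^bsub>G\<^esub> u = t \<longleftrightarrow> u = s \<otimes>\<^bsub>G\<^esub> t"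
        using s u G.inv_solve_left' by metis
      then show ?thesis
        using r by (simp add: group_ring_single_def)
    qed
    finally show ?thesis .
  qed
  ultimately show "(?f \<otimes>\<^bsub>group_ring R G\<^esub> ?g) u = group_ring_single R (r \<otimes>\<^bsub>R\<^esub> r') (s \<otimes>\<^bsub>G\<^esub> t) u"
    using s by (cases "u \<in> carrier G") (auto simp: group_ring_single_def)
qed

lemma single_one: "group_ring_single R \<one>\<^bsub>R\<^esub> \<one>\<^bsub>G\<^esub> = \<one>\<^bsub>group_ring R G\<^esub>"
  by (simp add: group_ring_def group_ring_single_def)

abbreviation MR :: "('r, 'm) module" where
  "MR \<equiv> restrict_scalars R G M"

lemma MR_simps [simp]:
  "carrier MR = carrier M" "\<zero>\<^bsub>MR\<^esub> = \<zero>\<^bsub>M\<^esub>" "x \<oplus>\<^bsub>MR\<^esub> y = x \<oplus>\<^bsub>M\<^esub> y"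
  "r \<odot>\<^bsub>MR\<^esub> x = group_ring_single R r \<one>\<^bsub>G\<^esub> \<odot>\<^bsub>M\<^esub> x"
  by (simp_all add: restrict_scalars_def)

lemma set_add_MR [simp]: "A <+>\<^bsub>MR\<^esub> B = A <+>\<^bsub>M\<^esub> B"
  by (simp add: set_add_def')

lemma left_module_restrict_scalars: "left_module R MR"
proof -
  have "abelian_group MR"
  proof (rule abelian_groupI)
    fix x assume "x \<in> carrier MR"
    then show "\<exists>y\<in>carrier MR. y \<oplus>\<^bsub>MR\<^esub> x = \<zero>\<^bsub>MR\<^esub>"
      by (intro bexI[of _ "\<ominus>\<^bsub>M\<^esub> x"]) (auto simp: M.M.l_neg)
  qed (auto simp: M.M.a_ac)
  moreover have "left_module_axioms R MR"
    by unfold_locales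
      (auto simp: M.smult_closed single_closed single_add M.smult_l_distr M.smult_r_distr
        M.smult_assoc1[symmetric] single_mult single_one M.smult_one)
  ultimately show ?thesis
    using R.ring_axioms unfolding left_module_def by blast
qed

abbreviation act :: "'g \<Rightarrow> 'm \<Rightarrow> 'm" where
  "act \<equiv> group_action R M"

lemma act_closed: "s \<in> carrier G \<Longrightarrow> x \<in> carrier M \<Longrightarrow> act s x \<in> carrier M"
  by (simp add: group_action_def single_closed M.smult_closed)

lemma act_add:
  "s \<in> carrier G \<Longrightarrow> x \<in> carrier M \<Longrightarrow> y \<in> carrier M \<Longrightarrow> act s (x \<oplus>\<^bsub>M\<^esub> y) = act s x \<oplus>\<^bsub>M\<^esub> act s y"
  by (simp add: group_action_def single_closed M.smult_r_distr)

lemma act_zero: "s \<in> carrier G \<Longrightarrow> act s \<zero>\<^bsub>M\<^esub> = \<zero>\<^bsub>M\<^esub>"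
  using act_add[of s "\<zero>\<^bsub>M\<^esub>" "\<zero>\<^bsub>M\<^esub>"] act_closed[of s "\<zero>\<^bsub>M\<^esub>"] M.M.add.r_cancel_one' by simp

lemma act_one: "x \<in> carrier M \<Longrightarrow> act \<one>\<^bsub>G\<^esub> x = x"
  by (simp add: group_action_def single_one M.smult_one)

lemma act_act:
  "s \<in> carrier G \<Longrightarrow> t \<in> carrier G \<Longrightarrow> x \<in> carrier M \<Longrightarrow> act s (act t x) = act (s \<otimes>\<^bsub>G\<^esub> t) x"
  by (simp add: group_action_def single_closed M.smult_assoc1[symmetric] single_mult)

lemma act_hom: "s \<in> carrier G \<Longrightarrow> act s \<in> left_module_hom R MR MR"
  unfolding left_module_hom_def
  by (auto simp: act_closed act_add) 
    (simp add: group_action_def single_closed M.smult_assoc1[symmetric] single_mult)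

lemma act_image_subset: "s \<in> carrier G \<Longrightarrow> A \<subseteq> carrier M \<Longrightarrow> act s ` A \<subseteq> carrier M"
  by (auto simp: act_closed)

abbreviation trans_sum :: "'m set \<Rightarrow> 'g set \<Rightarrow> 'm set" where
  "trans_sum \<equiv> sum_translates R G M"

lemma trans_sum_empty: "trans_sum A {} = {\<zero>\<^bsub>M\<^esub>}"
  by (auto simp: sum_translates_def)

text \<open>
  Most further properties of sums of translates follow from this recursion by induction on \<open>F\<close>.
\<close>

lemma trans_sum_insert:
  assumes A: "A \<subseteq> carrier M" and F: "finite F" "insert s F \<subseteq> carrier G" "s \<notin> F"
  shows "trans_sum A (insert s F) = act (inv\<^bsub>G\<^esub> s) ` A <+>\<^bsub>M\<^esub> trans_sum A F"
proof (intro equalityI subsetI)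
  have closed: "(\<lambda>s. act (inv\<^bsub>G\<^esub> s) (a s)) \<in> S \<rightarrow> carrier M" if "a \<in> S \<rightarrow> A" "S \<subseteq> carrier G" for a S
    using that A by (auto intro!: act_closed)
  {
    fix x assume "x \<in> trans_sum A (insert s F)"
    then obtain a where a: "a \<in> insert s F \<rightarrow> A" and
        x: "x = (\<Oplus>\<^bsub>M\<^esub>s\<in>insert s F. act (inv\<^bsub>G\<^esub> s) (a s))"
      by (auto simp: sum_translates_def)
    have "x = act (inv\<^bsub>G\<^esub> s) (a s) \<oplus>\<^bsub>M\<^esub> (\<Oplus>\<^bsub>M\<^esub>s\<in>F. act (inv\<^bsub>G\<^esub> s) (a s))"
      unfolding x using F a A by (intro M.M.finsum_insert closed) (auto intro!: act_closed)
    then show "x \<in> act (inv\<^bsub>G\<^esub> s) ` A <+>\<^bsub>M\<^esub> trans_sum A F"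
      using a by (auto simp: set_add_def' sum_translates_def)
  next
    fix x assume "x \<in> act (inv\<^bsub>G\<^esub> s) ` A <+>\<^bsub>M\<^esub> trans_sum A F"
    then obtain y a where y: "y \<in> A" and a: "a \<in> F \<rightarrow> A" and
        x: "x = act (inv\<^bsub>G\<^esub> s) y \<oplus>\<^bsub>M\<^esub> (\<Oplus>\<^bsub>M\<^esub>s\<in>F. act (inv\<^bsub>G\<^esub> s) (a s))"
      by (auto simp: set_add_def' sum_translates_def)
    let ?a = "a(s := y)"
    have a': "?a \<in> insert s F \<rightarrow> A"
      using a y by auto
    have "(\<Oplus>\<^bsub>M\<^esub>s\<in>insert s F. act (inv\<^bsub>G\<^esub> s) (?a s))
        = act (inv\<^bsub>G\<^esub> s) (?a s) \<oplus>\<^bsub>M\<^esub> (\<Oplus>\<^bsub>M\<^esub>s\<in>F. act (inv\<^bsub>G\<^esub> s) (?a s))"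
      using F a' A y by (intro M.M.finsum_insert closed) (auto intro!: act_closed)
    also have "(\<Oplus>\<^bsub>M\<^esub>s\<in>F. act (inv\<^bsub>G\<^esub> s) (?a s)) = (\<Oplus>\<^bsub>M\<^esub>s\<in>F. act (inv\<^bsub>G\<^esub> s) (a s))"
      using F a A by (intro M.M.finsum_cong' closed) (auto intro!: act_closed)
    finally have "x = (\<Oplus>\<^bsub>M\<^esub>s\<in>insert s F. act (inv\<^bsub>G\<^esub> s) (?a s))"
      using x by simp
    then show "x \<in> trans_sum A (insert s F)"
      using a' unfolding sum_translates_def by blast
  }
qed

lemma trans_sum_closed:
  assumes "A \<subseteq> carrier M" "finite F" "F \<subseteq> carrier G"
  shows "trans_sum A F \<subseteq> carrier M"
  using assms(2,3)
  by (induction F) (auto simp: trans_sum_empty trans_sum_insert[OF assms(1)]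
    dest!: set_mp[OF M.M.set_add_closed, rotated 2] intro: act_closed set_mp[OF assms(1)])

lemma finite_trans_sum:
  assumes "A \<subseteq> carrier M" "finite A" "finite F" "F \<subseteq> carrier G"
  shows "finite (trans_sum A F)"
  using assms(3,4)
  by (induction F) (auto simp: trans_sum_empty trans_sum_insert[OF assms(1)] intro!: finite_set_add assms(2))

lemma trans_sum_nonempty: "A \<noteq> {} \<Longrightarrow> trans_sum A F \<noteq> {}"
  by (auto simp: sum_translates_def)

lemma zero_mem_trans_sum:
  assumes "A \<subseteq> carrier M" "\<zero>\<^bsub>M\<^esub> \<in> A" "finite F" "F \<subseteq> carrier G"
  shows "\<zero>\<^bsub>M\<^esub> \<in> trans_sum A F"
  using assms(3,4)
proof (induction F)
  case (insert s F)
  then have "\<zero>\<^bsub>M\<^esub> \<in> act (inv\<^bsub>G\<^esub> s) ` A" "\<zero>\<^bsub>M\<^esub> \<in> trans_sum A F"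
    using act_zero[of "inv\<^bsub>G\<^esub> s"] assms(2) by force+
  then have "\<zero>\<^bsub>M\<^esub> \<oplus>\<^bsub>M\<^esub> \<zero>\<^bsub>M\<^esub> \<in> act (inv\<^bsub>G\<^esub> s) ` A <+>\<^bsub>M\<^esub> trans_sum A F"
    unfolding set_add_def' by blast
  then show ?case
    using insert by (simp add: trans_sum_insert[OF assms(1)])
qed (simp add: trans_sum_empty)

lemma trans_sum_Un_disjoint:
  assumes A: "A \<subseteq> carrier M" and F: "finite F" "F \<subseteq> carrier G"
    and H: "finite H" "H \<subseteq> carrier G" and disj: "F \<inter> H = {}"
  shows "trans_sum A (F \<union> H) = trans_sum A F <+>\<^bsub>M\<^esub> trans_sum A H"
  using F disj
proof (induction F)
  case empty
  then show ?case
    using M.M.set_add_zero trans_sum_closed[OF A H] by (simp add: trans_sum_empty)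
next
  case (insert s F)
  have "trans_sum A (insert s (F \<union> H)) = act (inv\<^bsub>G\<^esub> s) ` A <+>\<^bsub>M\<^esub> trans_sum A (F \<union> H)"
    using insert H by (intro trans_sum_insert A) auto
  also have "trans_sum A (F \<union> H) = trans_sum A F <+>\<^bsub>M\<^esub> trans_sum A H"
    using insert by auto
  also have "act (inv\<^bsub>G\<^esub> s) ` A <+>\<^bsub>M\<^esub> \<dots> = act (inv\<^bsub>G\<^esub> s) ` A <+>\<^bsub>M\<^esub> trans_sum A F <+>\<^bsub>M\<^esub> trans_sum A H"
    using insert H by (intro M.M.set_add_assoc[symmetric] act_image_subset trans_sum_closed A) auto
  also have "act (inv\<^bsub>G\<^esub> s) ` A <+>\<^bsub>M\<^esub> trans_sum A F = trans_sum A (insert s F)"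
    using insert by (intro trans_sum_insert[symmetric] A) auto
  finally show ?case by simp
qed

lemma trans_sum_mono_right:
  assumes A: "A \<subseteq> carrier M" "\<zero>\<^bsub>M\<^esub> \<in> A" and F: "F \<subseteq> H" "finite H" "H \<subseteq> carrier G"
  shows "trans_sum A F \<subseteq> trans_sum A H"
proof
  fix x assume x: "x \<in> trans_sum A F"
  have fF: "finite F" "F \<subseteq> carrier G"
    using F by (auto intro: finite_subset)
  have "trans_sum A (F \<union> (H - F)) = trans_sum A F <+>\<^bsub>M\<^esub> trans_sum A (H - F)"
    using fF F by (intro trans_sum_Un_disjoint A) auto
  moreover have "F \<union> (H - F) = H"
    using F by auto
  moreover have "\<zero>\<^bsub>M\<^esub> \<in> trans_sum A (H - F)"
    using F by (intro zero_mem_trans_sum A) auto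
  moreover have "x \<oplus>\<^bsub>M\<^esub> \<zero>\<^bsub>M\<^esub> = x"
    using trans_sum_closed[OF A(1) fF] x by auto
  ultimately show "x \<in> trans_sum A H"
    using x unfolding set_add_def' by force
qed

text \<open>
  For overlapping \<open>F\<close> and \<open>H\<close> the right-hand side uses the common translates twice; as \<open>A\<close>
  contains \<open>0\<close>, this only enlarges it.
\<close>

lemma trans_sum_Un_subset:
  assumes A: "A \<subseteq> carrier M" "\<zero>\<^bsub>M\<^esub> \<in> A" and F: "finite F" "F \<subseteq> carrier G" and H: "finite H" "H \<subseteq> carrier G"
  shows "trans_sum A (F \<union> H) \<subseteq> trans_sum A F <+>\<^bsub>M\<^esub> trans_sum A H"
proof -
  have "trans_sum A (F \<union> (H - F)) = trans_sum A F <+>\<^bsub>M\<^esub> trans_sum A (H - F)"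
    using F H by (intro trans_sum_Un_disjoint A) auto
  also have "\<dots> \<subseteq> trans_sum A F <+>\<^bsub>M\<^esub> trans_sum A H"
    using H by (intro set_add_mono order_refl trans_sum_mono_right A) auto
  finally show ?thesis by simp
qed

lemma act_image_set_add:
  assumes "s \<in> carrier G" "A \<subseteq> carrier M" "B \<subseteq> carrier M"
  shows "act s ` (A <+>\<^bsub>M\<^esub> B) = act s ` A <+>\<^bsub>M\<^esub> act s ` B"
  using assms by (intro image_set_add act_add) auto

lemma trans_sum_r_coset:
  assumes A: "A \<subseteq> carrier M" and c: "c \<in> carrier G" and F: "finite F" "F \<subseteq> carrier G"
  shows "trans_sum A (F #>\<^bsub>G\<^esub> c) = act (inv\<^bsub>G\<^esub> c) ` trans_sum A F"
  using F
proof (induction F)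
  case empty
  then show ?case
    using c by (simp add: G.r_coset_image trans_sum_empty act_zero)
next
  case (insert s F)
  have s: "s \<in> carrier G" and F: "finite F" "F \<subseteq> carrier G"
    using insert by auto
  have "insert s F #>\<^bsub>G\<^esub> c = insert (s \<otimes>\<^bsub>G\<^esub> c) (F #>\<^bsub>G\<^esub> c)"
    by (simp add: G.r_coset_image)
  moreover have "s \<otimes>\<^bsub>G\<^esub> c \<notin> F #>\<^bsub>G\<^esub> c"
    using insert c by (auto simp: G.r_coset_image)
  ultimately have "trans_sum A (insert s F #>\<^bsub>G\<^esub> c)
      = act (inv\<^bsub>G\<^esub> (s \<otimes>\<^bsub>G\<^esub> c)) ` A <+>\<^bsub>M\<^esub> trans_sum A (F #>\<^bsub>G\<^esub> c)"
    using s c F G.r_coset_subset_carrier[of F c] by (simp add: trans_sum_insert[OF A] G.finite_r_coset)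
  also have "act (inv\<^bsub>G\<^esub> (s \<otimes>\<^bsub>G\<^esub> c)) ` A = act (inv\<^bsub>G\<^esub> c) ` act (inv\<^bsub>G\<^esub> s) ` A"
    unfolding image_image using s c A
    by (intro image_cong refl) (auto simp: act_act G.inv_mult_group)
  also have "\<dots> <+>\<^bsub>M\<^esub> trans_sum A (F #>\<^bsub>G\<^esub> c)
      = act (inv\<^bsub>G\<^esub> c) ` (act (inv\<^bsub>G\<^esub> s) ` A <+>\<^bsub>M\<^esub> trans_sum A F)"
    using insert s c F A by (subst act_image_set_add) (auto intro!: act_closed dest: set_mp[OF trans_sum_closed])
  also have "act (inv\<^bsub>G\<^esub> s) ` A <+>\<^bsub>M\<^esub> trans_sum A F = trans_sum A (insert s F)"
    using insert by (intro trans_sum_insert[symmetric] A) auto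
  finally show ?case .
qed

lemma trans_sum_set_add:
  assumes A: "A \<subseteq> carrier M" and B: "B \<subseteq> carrier M" and F: "finite F" "F \<subseteq> carrier G"
  shows "trans_sum (A <+>\<^bsub>M\<^esub> B) F = trans_sum A F <+>\<^bsub>M\<^esub> trans_sum B F"
  using F
proof (induction F)
  case empty
  then show ?case
    using M.M.set_add_zero[of "{\<zero>\<^bsub>M\<^esub>}"] by (simp add: trans_sum_empty)
next
  case (insert s F)
  have s: "s \<in> carrier G" and F: "finite F" "F \<subseteq> carrier G"
    using insert by auto
  have AB: "A <+>\<^bsub>M\<^esub> B \<subseteq> carrier M"
    using A B by (rule M.M.set_add_closed)
  have "trans_sum (A <+>\<^bsub>M\<^esub> B) (insert s F)
      = (act (inv\<^bsub>G\<^esub> s) ` A <+>\<^bsub>M\<^esub> act (inv\<^bsub>G\<^esub> s) ` B) <+>\<^bsub>M\<^esub> (trans_sum A F <+>\<^bsub>M\<^esub> trans_sum B F)"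
    using insert s by (simp add: trans_sum_insert[OF AB] act_image_set_add A B)
  also have "\<dots> = (act (inv\<^bsub>G\<^esub> s) ` A <+>\<^bsub>M\<^esub> trans_sum A F) <+>\<^bsub>M\<^esub> (act (inv\<^bsub>G\<^esub> s) ` B <+>\<^bsub>M\<^esub> trans_sum B F)"
    using s F by (intro M.M.set_add_swap act_image_subset trans_sum_closed A B) auto
  finally show ?case
    using insert by (simp add: trans_sum_insert A B)
qed

end

lemma trans_sum_image:
  assumes "group_ring_module R G M" "group_ring_module R G Q"
    and closed: "\<And>x. x \<in> carrier M \<Longrightarrow> \<pi> x \<in> carrier Q"
    and add: "\<And>x y. x \<in> carrier M \<Longrightarrow> y \<in> carrier M \<Longrightarrow> \<pi> (x \<oplus>\<^bsub>M\<^esub> y) = \<pi> x \<oplus>\<^bsub>Q\<^esub> \<pi> y"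
    and zero_eq: "\<pi> \<zero>\<^bsub>M\<^esub> = \<zero>\<^bsub>Q\<^esub>"
    and act: "\<And>s x. s \<in> carrier G \<Longrightarrow> x \<in> carrier M \<Longrightarrow>
      \<pi> (group_action R M s x) = group_action R Q s (\<pi> x)"
    and A: "A \<subseteq> carrier M" and F: "finite F" "F \<subseteq> carrier G"
  shows "\<pi> ` sum_translates R G M A F = sum_translates R G Q (\<pi> ` A) F"
proof -
  interpret M: group_ring_module R G M by fact
  interpret Q: group_ring_module R G Q by fact
  have \<pi>A: "\<pi> ` A \<subseteq> carrier Q"
    using A closed by auto
  show ?thesis
    using F
  proof (induction F)
    case empty
    then show ?case
      by (simp add: M.trans_sum_empty Q.trans_sum_empty zero_eq)
  next
    case (insert s F)
    have s: "s \<in> carrier G" and F: "finite F" "F \<subseteq> carrier G"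
      using insert by auto
    have "\<pi> ` M.trans_sum A (insert s F)
        = \<pi> ` (M.act (inv\<^bsub>G\<^esub> s) ` A <+>\<^bsub>M\<^esub> M.trans_sum A F)"
      using insert by (simp add: M.trans_sum_insert[OF A])
    also have "\<dots> = \<pi> ` M.act (inv\<^bsub>G\<^esub> s) ` A <+>\<^bsub>Q\<^esub> \<pi> ` M.trans_sum A F"
      using A s M.trans_sum_closed[OF A F] by (intro image_set_add add) (auto intro: M.act_closed)
    also have "\<pi> ` M.act (inv\<^bsub>G\<^esub> s) ` A = Q.act (inv\<^bsub>G\<^esub> s) ` \<pi> ` A"
      unfolding image_image using A s by (intro image_cong refl act) auto
    also have "\<pi> ` M.trans_sum A F = Q.trans_sum (\<pi> ` A) F"
      using insert F by blast
    finally show ?case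
      using insert by (simp add: Q.trans_sum_insert[OF \<pi>A])
  qed
qed

lemma left_module_submodule:
  assumes M: "left_module R M" and N: "submodule N R M"
  shows "left_module R (M\<lparr>carrier := N\<rparr>)"
proof -
  interpret M: left_module R M by fact
  interpret N: submodule N R M by fact
  have sub: "N \<subseteq> carrier M"
    using N.subset by simp
  have "abelian_group (M\<lparr>carrier := N\<rparr>)"
  proof (rule abelian_groupI)
    fix x assume x: "x \<in> carrier (M\<lparr>carrier := N\<rparr>)"
    then have "\<ominus>\<^bsub>M\<^esub> x \<in> N"
      using N.m_inv_closed by (simp add: a_inv_def)
    moreover have "\<ominus>\<^bsub>M\<^esub> x \<oplus>\<^bsub>M\<^esub> x = \<zero>\<^bsub>M\<^esub>"
      using x sub by (intro M.M.l_neg) auto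
    ultimately show "\<exists>y\<in>carrier (M\<lparr>carrier := N\<rparr>). y \<oplus>\<^bsub>M\<lparr>carrier := N\<rparr>\<^esub> x = \<zero>\<^bsub>M\<lparr>carrier := N\<rparr>\<^esub>"
      by (intro bexI[of _ "\<ominus>\<^bsub>M\<^esub> x"]) auto
  qed (use N.m_closed N.one_closed sub in \<open>auto simp: M.M.a_ac subset_iff\<close>)
  moreover have "left_module_axioms R (M\<lparr>carrier := N\<rparr>)"
    using sub by unfold_locales
      (auto simp: N.smult_closed M.smult_l_distr M.smult_r_distr M.smult_assoc1 M.smult_one subset_iff)
  ultimately show ?thesis
    using M unfolding left_module_def by blast
qed

lemma trans_sum_submodule:
  assumes M: "group_ring_module R G M" and N: "submodule N (group_ring R G) M"
    and A: "A \<subseteq> N" and F: "finite F" "F \<subseteq> carrier G"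
  shows "sum_translates R G (M\<lparr>carrier := N\<rparr>) A F = sum_translates R G M A F"
proof -
  interpret M: group_ring_module R G M by fact
  interpret N: submodule N "group_ring R G" M by fact
  have sub: "N \<subseteq> carrier M"
    using N.subset by simp
  have "group_ring_module R G (M\<lparr>carrier := N\<rparr>)"
    using M left_module_submodule[OF M.M.left_module_axioms N] unfolding group_ring_module_def by blast
  from trans_sum_image[OF this M, of "\<lambda>x. x" A F] show ?thesis
    using A F sub by (simp add: subset_iff group_action_def)
qed

section \<open>Quotient modules\<close>

lemma (in left_module) smult_r_null:
  assumes "r \<in> carrier R"
  shows "r \<odot>\<^bsub>M\<^esub> \<zero>\<^bsub>M\<^esub> = \<zero>\<^bsub>M\<^esub>"
  using smult_r_distr[OF assms, of "\<zero>\<^bsub>M\<^esub>" "\<zero>\<^bsub>M\<^esub>"] smult_closed[OF assms, of "\<zero>\<^bsub>M\<^esub>"]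
    M.add.r_cancel_one' by simp

context
  fixes S :: "('s, 'p) ring_scheme" and M :: "('s, 'm) module" and N :: "'m set"
  assumes M: "left_module S M" and N: "submodule N S M"
begin

interpretation M: left_module S M by (fact M)
interpretation N: submodule N S M by (fact N)

interpretation N: abelian_subgroup N M
  using N.subgroup_axioms M.M.abelian_group_axioms
  by (intro abelian_subgroupI3 additive_subgroup.intro)

lemma quot_module_carrier: "carrier (quot_module M N) = (\<lambda>x. N +>\<^bsub>M\<^esub> x) ` carrier M"
  by (auto simp: quot_module_def A_RCOSETS_def')

lemma coset_zero: "N +>\<^bsub>M\<^esub> \<zero>\<^bsub>M\<^esub> = \<zero>\<^bsub>quot_module M N\<^esub>"
  using N.a_subset by (simp add: quot_module_def)

lemma coset_add:
  "x \<in> carrier M \<Longrightarrow> y \<in> carrier M \<Longrightarrow>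
    N +>\<^bsub>M\<^esub> (x \<oplus>\<^bsub>M\<^esub> y) = (N +>\<^bsub>M\<^esub> x) \<oplus>\<^bsub>quot_module M N\<^esub> (N +>\<^bsub>M\<^esub> y)"
  by (simp add: quot_module_def N.a_rcos_sum)

lemma coset_smult:
  assumes "r \<in> carrier S" "x \<in> carrier M"
  shows "N +>\<^bsub>M\<^esub> (r \<odot>\<^bsub>M\<^esub> x) = r \<odot>\<^bsub>quot_module M N\<^esub> (N +>\<^bsub>M\<^esub> x)"
proof -
  have eq: "n \<oplus>\<^bsub>M\<^esub> r \<odot>\<^bsub>M\<^esub> (n' \<oplus>\<^bsub>M\<^esub> x) = (n \<oplus>\<^bsub>M\<^esub> r \<odot>\<^bsub>M\<^esub> n') \<oplus>\<^bsub>M\<^esub> r \<odot>\<^bsub>M\<^esub> x"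
    if "n \<in> N" "n' \<in> N" for n n'
    using that assms by (simp add: M.smult_r_distr M.smult_closed M.M.a_assoc)
  have "r \<odot>\<^bsub>quot_module M N\<^esub> (N +>\<^bsub>M\<^esub> x) = (\<Union>n\<in>N. \<Union>n'\<in>N. {n \<oplus>\<^bsub>M\<^esub> r \<odot>\<^bsub>M\<^esub> (n' \<oplus>\<^bsub>M\<^esub> x)})"
    by (auto simp: quot_module_def set_add_def' a_r_coset_def')
  also have "\<dots> = (\<Union>n\<in>N. \<Union>n'\<in>N. {(n \<oplus>\<^bsub>M\<^esub> r \<odot>\<^bsub>M\<^esub> n') \<oplus>\<^bsub>M\<^esub> r \<odot>\<^bsub>M\<^esub> x})"
    by (intro SUP_cong refl) (simp add: eq)
  also have "\<dots> = (\<Union>n\<in>N. {n \<oplus>\<^bsub>M\<^esub> r \<odot>\<^bsub>M\<^esub> x})"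
  proof (intro equalityI subsetI)
    fix y assume "y \<in> (\<Union>n\<in>N. \<Union>n'\<in>N. {(n \<oplus>\<^bsub>M\<^esub> r \<odot>\<^bsub>M\<^esub> n') \<oplus>\<^bsub>M\<^esub> r \<odot>\<^bsub>M\<^esub> x})"
    then show "y \<in> (\<Union>n\<in>N. {n \<oplus>\<^bsub>M\<^esub> r \<odot>\<^bsub>M\<^esub> x})"
      using assms N.smult_closed N.a_closed by blast
  next
    fix y assume "y \<in> (\<Union>n\<in>N. {n \<oplus>\<^bsub>M\<^esub> r \<odot>\<^bsub>M\<^esub> x})"
    then obtain n where n: "n \<in> N" "y = n \<oplus>\<^bsub>M\<^esub> r \<odot>\<^bsub>M\<^esub> x"
      by blast
    have "y = (n \<oplus>\<^bsub>M\<^esub> r \<odot>\<^bsub>M\<^esub> \<zero>\<^bsub>M\<^esub>) \<oplus>\<^bsub>M\<^esub> r \<odot>\<^bsub>M\<^esub> x"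
      using n assms by (simp add: left_module.smult_r_null[OF M])
    then show "y \<in> (\<Union>n\<in>N. \<Union>n'\<in>N. {(n \<oplus>\<^bsub>M\<^esub> r \<odot>\<^bsub>M\<^esub> n') \<oplus>\<^bsub>M\<^esub> r \<odot>\<^bsub>M\<^esub> x})"
      using n(1) N.zero_closed by blast
  qed
  finally show ?thesis
    by (simp add: a_r_coset_def')
qed

lemma left_module_quot_module: "left_module S (quot_module M N)"
  by (rule left_module_surj_image[OF M, where \<pi> = "\<lambda>x. N +>\<^bsub>M\<^esub> x"])
    (simp_all add: quot_module_carrier coset_zero coset_add coset_smult)

lemma coset_eq_zero_iff:
  "x \<in> carrier M \<Longrightarrow> N +>\<^bsub>M\<^esub> x = \<zero>\<^bsub>quot_module M N\<^esub> \<longleftrightarrow> x \<in> N"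
  using N.a_rcos_self[of x] N.a_rcos_const[of x] by (auto simp: quot_module_def)

lemma fin_subsets0_quot_module:
  assumes "M2 \<subseteq> carrier M" "\<zero>\<^bsub>M\<^esub> \<in> M2"
  shows "fin_subsets0 (quot_module M N) (carrier (quot_module (M\<lparr>carrier := M2\<rparr>) N))
    = (\<lambda>A. (\<lambda>x. N +>\<^bsub>M\<^esub> x) ` A) ` fin_subsets0 M M2"
proof -
  have carrier: "carrier (quot_module (M\<lparr>carrier := M2\<rparr>) N) = (\<lambda>x. N +>\<^bsub>M\<^esub> x) ` M2"
    by (auto simp: quot_module_def A_RCOSETS_def' a_r_coset_def')
  show ?thesis
    unfolding carrier
  proof (intro equalityI subsetI)
    fix B assume "B \<in> fin_subsets0 (quot_module M N) ((\<lambda>x. N +>\<^bsub>M\<^esub> x) ` M2)"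
    then have B: "B \<subseteq> (\<lambda>x. N +>\<^bsub>M\<^esub> x) ` M2" "finite B" "\<zero>\<^bsub>quot_module M N\<^esub> \<in> B"
      by (auto simp: fin_subsets0_def)
    from finite_subset_image[OF B(2,1)] obtain A where
      A: "A \<subseteq> M2" "finite A" "B = (\<lambda>x. N +>\<^bsub>M\<^esub> x) ` A"
      by blast
    have "B = (\<lambda>x. N +>\<^bsub>M\<^esub> x) ` insert \<zero>\<^bsub>M\<^esub> A"
      using A B(3) coset_zero by auto
    moreover have "insert \<zero>\<^bsub>M\<^esub> A \<in> fin_subsets0 M M2"
      using A assms by (auto simp: fin_subsets0_def)
    ultimately show "B \<in> (\<lambda>A. (\<lambda>x. N +>\<^bsub>M\<^esub> x) ` A) ` fin_subsets0 M M2"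
      by blast
  next
    fix B assume "B \<in> (\<lambda>A. (\<lambda>x. N +>\<^bsub>M\<^esub> x) ` A) ` fin_subsets0 M M2"
    then obtain A where A: "A \<in> fin_subsets0 M M2" and B: "B = (\<lambda>x. N +>\<^bsub>M\<^esub> x) ` A"
      by blast
    have "N +>\<^bsub>M\<^esub> \<zero>\<^bsub>M\<^esub> \<in> B"
      unfolding B using A by (intro imageI) (simp add: fin_subsets0_def)
    then show "B \<in> fin_subsets0 (quot_module M N) ((\<lambda>x. N +>\<^bsub>M\<^esub> x) ` M2)"
      using A unfolding coset_zero B fin_subsets0_def by blast
  qed
qed

end


section \<open>Mean lengths relative to a submodule\<close>

lemma fin_subsets0D:
  assumes "A \<in> fin_subsets0 M S"
  shows "A \<subseteq> S" "\<zero>\<^bsub>M\<^esub> \<in> A"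
  using assms by (auto simp: fin_subsets0_def)

lemma enn2real_add:
  "a < \<infinity> \<Longrightarrow> b < \<infinity> \<Longrightarrow> enn2real (a + b) = enn2real a + enn2real b"
  by (cases a; cases b) (auto simp flip: ennreal_plus)

context group_ring_module
begin

lemma submodule_facts:
  assumes "submodule N (group_ring R G) M"
  shows "N \<subseteq> carrier M" "\<zero>\<^bsub>M\<^esub> \<in> N"
    and "\<And>x y. x \<in> N \<Longrightarrow> y \<in> N \<Longrightarrow> x \<oplus>\<^bsub>M\<^esub> y \<in> N"
    and "\<And>s x. s \<in> carrier G \<Longrightarrow> x \<in> N \<Longrightarrow> act s x \<in> N"
proof -
  interpret N: submodule N "group_ring R G" M by fact
  show "N \<subseteq> carrier M" "\<zero>\<^bsub>M\<^esub> \<in> N"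
    using N.subset N.one_closed by simp_all
  show "x \<oplus>\<^bsub>M\<^esub> y \<in> N" if "x \<in> N" "y \<in> N" for x y
    using N.m_closed[OF that] by simp
  show "act s x \<in> N" if "s \<in> carrier G" "x \<in> N" for s x
    using that by (simp add: group_action_def single_closed)
qed

lemma submodule_set_add:
  assumes "submodule N (group_ring R G) M"
  shows "N <+>\<^bsub>M\<^esub> N = N"
proof
  note N = submodule_facts[OF assms]
  show "N <+>\<^bsub>M\<^esub> N \<subseteq> N"
    using N(3) by (auto simp: set_add_def')
  have "{\<zero>\<^bsub>M\<^esub>} <+>\<^bsub>M\<^esub> N \<subseteq> N <+>\<^bsub>M\<^esub> N"
    using N(2) by (intro set_add_mono) auto
  then show "N \<subseteq> N <+>\<^bsub>M\<^esub> N"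
    by (simp add: M.M.set_add_zero[OF N(1)])
qed

lemma submodule_act_image:
  assumes "submodule N (group_ring R G) M" "s \<in> carrier G"
  shows "act s ` N = N"
proof
  note N = submodule_facts[OF assms(1)]
  show "act s ` N \<subseteq> N"
    using N(4) assms(2) by auto
  show "N \<subseteq> act s ` N"
  proof
    fix x assume x: "x \<in> N"
    then have "x = act s (act (inv\<^bsub>G\<^esub> s) x)"
      using N(1) assms(2) by (auto simp: act_act act_one)
    then show "x \<in> act s ` N"
      using N(4)[of "inv\<^bsub>G\<^esub> s" x] x assms(2) by auto
  qed
qed

lemma submodule_zero: "submodule {\<zero>\<^bsub>M\<^esub>} (group_ring R G) M"
proof -
  have "subgroup {\<zero>\<^bsub>M\<^esub>} (add_monoid M)"
    using M.M.add.triv_subgroup by simp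
  then show ?thesis
    by (simp add: submodule_def submodule_axioms_def M.smult_r_null)
qed

lemma trans_sum_zero:
  assumes "finite F" "F \<subseteq> carrier G"
  shows "trans_sum {\<zero>\<^bsub>M\<^esub>} F = {\<zero>\<^bsub>M\<^esub>}"
  using assms
proof (induction F)
  case (insert s F)
  then show ?case
    using M.M.set_add_zero[of "{\<zero>\<^bsub>M\<^esub>}"] by (simp add: trans_sum_insert act_zero)
qed (simp add: trans_sum_empty)

lemma trans_sum_in_fin_subsets:
  assumes "A \<in> fin_subsets0 M (carrier M)" "finite F" "F \<subseteq> carrier G"
  shows "trans_sum A F \<in> fin_subsets (carrier MR)"
  using assms trans_sum_closed[of A F] finite_trans_sum[of A F] trans_sum_nonempty[of A F]
  by (auto simp: fin_subsets_def fin_subsets0_def)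

lemma fin_subsets0_set_add:
  assumes "submodule N (group_ring R G) M" "A \<in> fin_subsets0 M N" "B \<in> fin_subsets0 M N"
  shows "A <+>\<^bsub>M\<^esub> B \<in> fin_subsets0 M N"
proof -
  note N = submodule_facts[OF assms(1)]
  have "\<zero>\<^bsub>M\<^esub> \<oplus>\<^bsub>M\<^esub> \<zero>\<^bsub>M\<^esub> \<in> A <+>\<^bsub>M\<^esub> B"
    using assms(2,3) unfolding fin_subsets0_def set_add_def' by blast
  then show ?thesis
    using assms(2,3) N(3) by (auto simp: fin_subsets0_def set_add_image)
qed

end

locale proper_length_module =
  proper_length R l l2 + group_ring_module R G M
  for R :: "('r, 'p) ring_scheme" and l l2
    and G :: "('g, 'q) monoid_scheme" and M :: "('g \<Rightarrow> 'r, 'u) module" +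
  assumes amenable: "amenable G"
    and locally_finite: "locally_finite_module R G l M"
begin

abbreviation rel_length :: "'u set \<Rightarrow> 'u set \<Rightarrow> 'g set \<Rightarrow> ennreal" where
  "rel_length A N F \<equiv> l2 MR (trans_sum A F) N"

lemma submodule_in_nonempty_subsets:
  "submodule N (group_ring R G) M \<Longrightarrow> N \<in> nonempty_subsets (carrier MR)"
  using submodule_facts[of N] by (auto simp: nonempty_subsets_def)

lemma zero_in_nonempty_subsets: "{\<zero>\<^bsub>M\<^esub>} \<in> nonempty_subsets (carrier MR)"
  by (intro submodule_in_nonempty_subsets submodule_zero)

lemma trans_sum_in_nonempty_subsets:
  "A \<in> fin_subsets0 M (carrier M) \<Longrightarrow> finite F \<Longrightarrow> F \<subseteq> carrier G \<Longrightarrow>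
    trans_sum A F \<in> nonempty_subsets (carrier MR)"
  using trans_sum_in_fin_subsets by (rule fin_subsets_imp_nonempty_subsets)

context
  fixes A N
  assumes A: "A \<in> fin_subsets0 M (carrier M)" and N: "submodule N (group_ring R G) M"
begin

lemma rel_length_finite:
  assumes F: "finite F" "F \<subseteq> carrier G"
  shows "rel_length A N F < \<infinity>"
proof -
  have "rel_length A N F \<le> l2 MR (trans_sum A F) {\<zero>\<^bsub>MR\<^esub>}"
    using submodule_facts(2)[OF N] zero_in_nonempty_subsets F
    by (intro l2_antimono left_module_restrict_scalars trans_sum_in_fin_subsets[OF A] submodule_in_nonempty_subsets[OF N]) auto
  also have "\<dots> = l MR (trans_sum A F)"
    using F by (intro l2_zero_right left_module_restrict_scalars trans_sum_in_nonempty_subsets[OF A])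
  also have "\<dots> < \<infinity>"
    using locally_finite trans_sum_in_fin_subsets[OF A F] by (auto simp: locally_finite_module_def)
  finally show ?thesis .
qed

lemma rel_length_r_coset_le:
  assumes F: "finite F" "F \<subseteq> carrier G" and c: "c \<in> carrier G"
  shows "rel_length A N (F #>\<^bsub>G\<^esub> c) \<le> rel_length A N F"
proof -
  have "l2 MR (act (inv\<^bsub>G\<^esub> c) ` trans_sum A F) (act (inv\<^bsub>G\<^esub> c) ` N) \<le> l2 MR (trans_sum A F) N"
    using F c by (intro l2_hom left_module_restrict_scalars act_hom trans_sum_in_nonempty_subsets[OF A] submodule_in_nonempty_subsets[OF N]) auto
  then show ?thesis
    using F c by (simp add: trans_sum_r_coset[OF fin_subsets0D(1)[OF A]] submodule_act_image[OF N])
qed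

text \<open>
  \<open>c\<^sup>-\<^sup>1\<close> acts as an automorphism of the \<open>R\<close>-module \<open>M\<close> that maps \<open>N\<close> onto \<open>N\<close> and takes the sum
  over \<open>F\<close> to the sum over \<open>F c\<close>.
\<close>

lemma rel_length_r_coset:
  assumes F: "finite F" "F \<subseteq> carrier G" and c: "c \<in> carrier G"
  shows "rel_length A N (F #>\<^bsub>G\<^esub> c) = rel_length A N F"
proof (rule antisym)
  show "rel_length A N (F #>\<^bsub>G\<^esub> c) \<le> rel_length A N F"
    using F c by (rule rel_length_r_coset_le)
  have "F #>\<^bsub>G\<^esub> c #>\<^bsub>G\<^esub> inv\<^bsub>G\<^esub> c = F"
    using F c by (simp add: G.coset_mult_assoc)
  then show "rel_length A N F \<le> rel_length A N (F #>\<^bsub>G\<^esub> c)"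
    using rel_length_r_coset_le[of "F #>\<^bsub>G\<^esub> c" "inv\<^bsub>G\<^esub> c"] F c
    by (simp add: G.finite_r_coset G.r_coset_subset_carrier)
qed

lemma rel_length_Un:
  assumes F: "finite F" "F \<subseteq> carrier G" and H: "finite H" "H \<subseteq> carrier G"
  shows "rel_length A N (F \<union> H) \<le> rel_length A N F + rel_length A N H"
proof -
  have "rel_length A N (F \<union> H) \<le> l2 MR (trans_sum A F <+>\<^bsub>MR\<^esub> trans_sum A H) N"
  proof (rule l2_mono[OF left_module_restrict_scalars])
    show "trans_sum A (F \<union> H) \<subseteq> trans_sum A F <+>\<^bsub>MR\<^esub> trans_sum A H"
      using F H fin_subsets0D[OF A] by (simp add: trans_sum_Un_subset)
    show "trans_sum A F <+>\<^bsub>MR\<^esub> trans_sum A H \<in> nonempty_subsets (carrier MR)"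
      using F H by (intro nonempty_subsets_set_add trans_sum_in_nonempty_subsets[OF A]
          left_module_imp_abelian_group[OF left_module_restrict_scalars])
  qed (use F H trans_sum_in_nonempty_subsets[OF A] submodule_in_nonempty_subsets[OF N] in auto)
  also have "\<dots> = l2 MR (trans_sum A F <+>\<^bsub>MR\<^esub> trans_sum A H) (N <+>\<^bsub>MR\<^esub> N)"
    by (simp add: submodule_set_add[OF N])
  also have "\<dots> \<le> rel_length A N F + rel_length A N H"
    using F H by (intro l2_set_add left_module_restrict_scalars trans_sum_in_nonempty_subsets[OF A] submodule_in_nonempty_subsets[OF N])
  finally show ?thesis .
qed

lemma rel_length_empty: "rel_length A N {} = 0"
proof -
  have "l2 MR {\<zero>\<^bsub>MR\<^esub>} N \<le> l2 MR {\<zero>\<^bsub>MR\<^esub>} {\<zero>\<^bsub>MR\<^esub>}"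
    using submodule_facts(2)[OF N] zero_in_nonempty_subsets trans_sum_in_fin_subsets[OF A, of "{}"]
    by (intro l2_antimono left_module_restrict_scalars submodule_in_nonempty_subsets[OF N]) (auto simp: trans_sum_empty)
  then show ?thesis
    using l2_zero_zero[OF left_module_restrict_scalars] by (simp add: trans_sum_empty)
qed

definition rel_mean :: real where
  "rel_mean = (THE c. amenable_limit G (\<lambda>F. enn2real (rel_length A N F) / real (card F)) c)"

lemma amenable_limit_rel_mean:
  "amenable_limit G (\<lambda>F. enn2real (rel_length A N F) / real (card F)) rel_mean"
proof -
  have "\<exists>c. amenable_limit G (\<lambda>F. enn2real (rel_length A N F) / real (card F)) c"
  proof (rule G.ornstein_weiss[OF amenable])
    fix F H assume FH: "finite F" "F \<subseteq> carrier G" "finite H" "H \<subseteq> carrier G"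
    have "enn2real (rel_length A N (F \<union> H)) \<le> enn2real (rel_length A N F + rel_length A N H)"
      using FH rel_length_finite rel_length_Un by (intro enn2real_mono) auto
    then show "enn2real (rel_length A N (F \<union> H))
        \<le> enn2real (rel_length A N F) + enn2real (rel_length A N H)"
      using FH rel_length_finite by (simp add: enn2real_add)
  qed (simp_all add: rel_length_empty rel_length_r_coset)
  then obtain c where c: "amenable_limit G (\<lambda>F. enn2real (rel_length A N F) / real (card F)) c"
    by blast
  have "rel_mean = c"
    unfolding rel_mean_def using c by (rule G.the_amenable_limit[OF amenable])
  with c show ?thesis by simp
qed

lemma rel_mean_tendsto:
  "((\<lambda>F. enn2real (rel_length A N F) / real (card F)) \<longlongrightarrow> rel_mean) (folner_filter G)"
  using amenable_limit_rel_mean by (simp add: G.amenable_limit_iff)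

lemma rel_mean_nonneg: "0 \<le> rel_mean"
  by (rule tendsto_lowerbound[OF rel_mean_tendsto])
    (auto simp: G.folner_filter_neq_bot[OF amenable])

end

text \<open>
  In the second argument each tile needs only the single translate \<open>c\<^sup>-\<^sup>1 B\<close> at its centre.
\<close>

lemma rel_length_tiled_region:
  assumes A: "A \<in> fin_subsets0 M (carrier M)" and B: "B \<in> fin_subsets0 M (carrier M)"
    and C: "finite C" "C \<subseteq> carrier G"
    and \<tau>: "\<And>c. c \<in> C \<Longrightarrow> finite (\<tau> c) \<and> \<tau> c \<subseteq> carrier G"
  shows "l2 MR (trans_sum A (G.tiled_region \<tau> C)) (trans_sum B C)
    \<le> (\<Sum>c\<in>C. l2 MR (trans_sum A (\<tau> c)) B)"
  using C \<tau>
proof (induction C)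
  case empty
  then show ?case
    using l2_zero_zero[OF left_module_restrict_scalars] by (simp add: G.tiled_region_def trans_sum_empty)
next
  case (insert c C)
  let ?U = "G.tiled_region \<tau> C"
  have c: "c \<in> carrier G" and C: "C \<subseteq> carrier G" and \<tau>c: "finite (\<tau> c)" "\<tau> c \<subseteq> carrier G"
    using insert.prems by auto
  have U: "finite ?U" "?U \<subseteq> carrier G"
    unfolding G.tiled_region_def
    using insert.hyps(1) insert.prems
    by (intro finite_UN_I UN_least G.finite_r_coset G.r_coset_subset_carrier; auto)+
  have U': "finite (\<tau> c #>\<^bsub>G\<^esub> c)" "\<tau> c #>\<^bsub>G\<^esub> c \<subseteq> carrier G"
    using \<tau>c c by (simp_all add: G.finite_r_coset G.r_coset_subset_carrier)
  have A_sub: "A \<subseteq> carrier M" "\<zero>\<^bsub>M\<^esub> \<in> A" and B_sub: "B \<subseteq> carrier M"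
    using A B by (auto simp: fin_subsets0_def)
  have B_ne: "B \<in> nonempty_subsets (carrier MR)"
    using B by (auto simp: fin_subsets0_def nonempty_subsets_def)
  have ic: "inv\<^bsub>G\<^esub> c \<in> carrier G"
    using c by simp
  have actB: "act (inv\<^bsub>G\<^esub> c) ` B \<in> nonempty_subsets (carrier MR)"
    using B_ne act_image_subset[OF ic] by (auto simp: nonempty_subsets_def)
  have BC: "trans_sum B C \<in> nonempty_subsets (carrier MR)"
    using B insert.hyps(1) C by (rule trans_sum_in_nonempty_subsets)
  have "l2 MR (trans_sum A (G.tiled_region \<tau> (insert c C))) (trans_sum B (insert c C))
      = l2 MR (trans_sum A ((\<tau> c #>\<^bsub>G\<^esub> c) \<union> ?U)) (act (inv\<^bsub>G\<^esub> c) ` B <+>\<^bsub>MR\<^esub> trans_sum B C)"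
    using insert.hyps insert.prems by (simp add: G.tiled_region_def trans_sum_insert[OF B_sub])
  also have "\<dots> \<le> l2 MR (trans_sum A (\<tau> c #>\<^bsub>G\<^esub> c) <+>\<^bsub>MR\<^esub> trans_sum A ?U)
      (act (inv\<^bsub>G\<^esub> c) ` B <+>\<^bsub>MR\<^esub> trans_sum B C)"
  proof (rule l2_mono[OF left_module_restrict_scalars])
    show "trans_sum A ((\<tau> c #>\<^bsub>G\<^esub> c) \<union> ?U) \<subseteq> trans_sum A (\<tau> c #>\<^bsub>G\<^esub> c) <+>\<^bsub>MR\<^esub> trans_sum A ?U"
      unfolding set_add_MR by (intro trans_sum_Un_subset A_sub U U')
    show "trans_sum A (\<tau> c #>\<^bsub>G\<^esub> c) <+>\<^bsub>MR\<^esub> trans_sum A ?U \<in> nonempty_subsets (carrier MR)"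
      by (intro nonempty_subsets_set_add trans_sum_in_nonempty_subsets[OF A] U U'
          left_module_imp_abelian_group[OF left_module_restrict_scalars])
    show "act (inv\<^bsub>G\<^esub> c) ` B <+>\<^bsub>MR\<^esub> trans_sum B C \<in> nonempty_subsets (carrier MR)"
      by (intro nonempty_subsets_set_add actB BC
          left_module_imp_abelian_group[OF left_module_restrict_scalars])
    show "trans_sum A ((\<tau> c #>\<^bsub>G\<^esub> c) \<union> ?U) \<in> nonempty_subsets (carrier MR)"
      using U U' by (intro trans_sum_in_nonempty_subsets[OF A]) auto
  qed
  also have "\<dots> \<le> l2 MR (trans_sum A (\<tau> c #>\<^bsub>G\<^esub> c)) (act (inv\<^bsub>G\<^esub> c) ` B)
      + l2 MR (trans_sum A ?U) (trans_sum B C)"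
    by (intro l2_set_add left_module_restrict_scalars trans_sum_in_nonempty_subsets[OF A] actB BC U U')
  also have "\<dots> \<le> l2 MR (trans_sum A (\<tau> c)) B + (\<Sum>c\<in>C. l2 MR (trans_sum A (\<tau> c)) B)"
  proof (rule add_mono)
    have "l2 MR (act (inv\<^bsub>G\<^esub> c) ` trans_sum A (\<tau> c)) (act (inv\<^bsub>G\<^esub> c) ` B) \<le> l2 MR (trans_sum A (\<tau> c)) B"
      using ic \<tau>c by (intro l2_hom left_module_restrict_scalars act_hom trans_sum_in_nonempty_subsets[OF A] B_ne)
    then show "l2 MR (trans_sum A (\<tau> c #>\<^bsub>G\<^esub> c)) (act (inv\<^bsub>G\<^esub> c) ` B) \<le> l2 MR (trans_sum A (\<tau> c)) B"
      using c \<tau>c by (simp add: trans_sum_r_coset[OF A_sub(1)])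
    show "l2 MR (trans_sum A ?U) (trans_sum B C) \<le> (\<Sum>c\<in>C. l2 MR (trans_sum A (\<tau> c)) B)"
      using insert.IH insert.prems by auto
  qed
  finally show ?case
    using insert.hyps by simp
qed

text \<open>
  This is the bound for a tiling by single points, with \<open>B = 0\<close>.
\<close>

lemma length_trans_sum_le_card:
  assumes A: "A \<in> fin_subsets0 M (carrier M)" and F: "finite F" "F \<subseteq> carrier G"
  shows "l2 MR (trans_sum A F) {\<zero>\<^bsub>M\<^esub>}
    \<le> ennreal (enn2real (l2 MR (trans_sum A {\<one>\<^bsub>G\<^esub>}) {\<zero>\<^bsub>M\<^esub>}) * real (card F))"
proof -
  let ?b = "l2 MR (trans_sum A {\<one>\<^bsub>G\<^esub>}) {\<zero>\<^bsub>M\<^esub>}"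
  have b: "?b < \<infinity>"
    by (rule rel_length_finite[OF A submodule_zero]) auto
  have "G.tiled_region (\<lambda>_. {\<one>\<^bsub>G\<^esub>}) F = F"
    using F by (force simp: G.tiled_region_def G.r_coset_image)
  then have "l2 MR (trans_sum A F) (trans_sum {\<zero>\<^bsub>M\<^esub>} F) \<le> (\<Sum>c\<in>F. ?b)"
    using rel_length_tiled_region[OF A _ F, of "{\<zero>\<^bsub>M\<^esub>}" "\<lambda>_. {\<one>\<^bsub>G\<^esub>}"]
    by (simp add: fin_subsets0_def)
  also have "(\<Sum>c\<in>F. ?b) = ennreal (enn2real ?b) * ennreal (real (card F))"
    using b by (simp add: ennreal_of_nat_eq_real_of_nat mult.commute)
  also have "\<dots> = ennreal (enn2real ?b * real (card F))"
    by (simp add: ennreal_mult)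
  finally show ?thesis
    using F by (simp add: trans_sum_zero)
qed

text \<open>
  Each of the finitely many tiles \<open>D\<close> has a finite \<open>Bf D \<subseteq> N\<close> that replaces \<open>N\<close> at small cost, and
  the union of these sets serves all tiles at once.
\<close>

lemma rel_length_approximation:
  assumes A: "A \<in> fin_subsets0 M (carrier M)" and N: "submodule N (group_ring R G) M"
    and \<epsilon>: "0 < \<epsilon>"
  shows "\<exists>B\<in>fin_subsets0 M N. \<forall>\<^sub>F F in folner_filter G.
    l2 MR (trans_sum A F) (trans_sum B F) \<le> ennreal ((rel_mean A N + \<epsilon>) * real (card F))"
proof -
  note MR = left_module_restrict_scalars
  note N_facts = submodule_facts[OF N]
  define m where "m = rel_mean A N"
  define b where "b = enn2real (l2 MR (trans_sum A {\<one>\<^bsub>G\<^esub>}) {\<zero>\<^bsub>M\<^esub>})"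
  have m: "0 \<le> m" and b: "0 \<le> b"
    unfolding m_def b_def using rel_mean_nonneg[OF A N] by simp_all
  have "((\<lambda>\<delta>. (m + 2 * \<delta>) / (1 - \<delta>) + \<delta> * b) \<longlongrightarrow> (m + 2 * 0) / (1 - 0) + 0 * b) (at_right 0)"
    by (intro tendsto_intros) auto
  then have "((\<lambda>\<delta>. (m + 2 * \<delta>) / (1 - \<delta>) + \<delta> * b) \<longlongrightarrow> m) (at_right 0)"
    by simp
  from order_tendstoD(2)[OF this, of "m + \<epsilon>"] \<epsilon>
  have "\<forall>\<^sub>F \<delta> in at_right 0. (m + 2 * \<delta>) / (1 - \<delta>) + \<delta> * b < m + \<epsilon> \<and> \<delta> \<in> {0<..<1}"
    by (intro eventually_conj eventually_at_right_real) auto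
  from eventually_happens'[OF _ this]
  obtain \<delta> where \<delta>: "(m + 2 * \<delta>) / (1 - \<delta>) + \<delta> * b < m + \<epsilon>" "0 < \<delta>" "\<delta> < 1"
    by auto
  \<comment> \<open>The term \<open>m + 2 \<delta>\<close> allows an error of \<open>\<delta>\<close> in the choice of the tiles and another \<open>\<delta>\<close> for
    replacing \<open>N\<close> by a finite subset.\<close>
  let ?P = "\<lambda>D. enn2real (rel_length A N D) \<le> (m + \<delta>) * real (card D)"
  have "\<forall>\<^sub>F F in folner_filter G. enn2real (rel_length A N F) / real (card F) < m + \<delta>"
    using order_tendstoD(2)[OF rel_mean_tendsto[OF A N], of "m + \<delta>"] \<delta> by (simp add: m_def)
  with G.eventually_folner_fin_subsets have "\<forall>\<^sub>F F in folner_filter G. ?P F"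
  proof eventually_elim
    case (elim F)
    then have "0 < real (card F)"
      by (simp add: fin_subsets_def card_gt_0_iff)
    with elim(2) show ?case
      by (simp add: divide_less_eq)
  qed
  then have "\<exists>\<^sub>F F in folner_filter G. ?P F"
    by (rule eventually_frequently[OF G.folner_filter_neq_bot[OF amenable]])
  moreover have "?P (F #>\<^bsub>G\<^esub> c)" if "F \<in> fin_subsets (carrier G)" "c \<in> carrier G" "?P F" for F c
    using that by (simp add: fin_subsets_def G.card_r_coset rel_length_r_coset[OF A N])
  ultimately have tiles: "\<exists>D\<in>{D. ?P D}. D \<in> fin_subsets (carrier G) \<and> \<one>\<^bsub>G\<^esub> \<in> D \<and> invariant_set G K \<eta> D"
    if "K \<in> fin_subsets (carrier G)" "\<eta> > 0" for K \<eta>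
    using that by (rule G.invariant_tile_containing_one)
  obtain \<T> K \<eta> where \<T>: "finite \<T>" "\<T> \<subseteq> {D. ?P D} \<inter> fin_subsets (carrier G)"
    and K: "K \<in> fin_subsets (carrier G)" "\<eta> > 0"
    and tiling: "\<And>F. F \<in> fin_subsets (carrier G) \<Longrightarrow> invariant_set G K \<eta> F \<Longrightarrow>
      \<exists>\<tau> C. G.quasi_tiling \<delta> \<delta> \<T> F \<tau> C"
    using G.quasi_tilings_exist[OF \<delta>(2,3) tiles] by blast
  have \<T>D: "finite D" "D \<subseteq> carrier G" "0 < real (card D)" "?P D" if "D \<in> \<T>" for D
  proof -
    have "D \<in> {D. ?P D}" "D \<in> fin_subsets (carrier G)"
      using that \<T>(2) by blast+
    then show "finite D" "D \<subseteq> carrier G" "0 < real (card D)" "?P D"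
      by (simp_all add: fin_subsets_def card_gt_0_iff)
  qed
  have "\<exists>B\<in>fin_subsets N. l2 MR (trans_sum A D) B \<le> ennreal ((m + 2 * \<delta>) * real (card D))"
    if "D \<in> \<T>" for D
  proof -
    have "rel_length A N D = ennreal (enn2real (rel_length A N D))"
      using rel_length_finite[OF A N \<T>D(1,2)[OF that]] by simp
    also have "\<dots> < ennreal ((m + 2 * \<delta>) * real (card D))"
    proof (rule ennreal_lessI)
      have "(m + \<delta>) * real (card D) < (m + 2 * \<delta>) * real (card D)"
        using \<T>D(3)[OF that] \<delta> by (intro mult_strict_right_mono) auto
      then show "enn2real (rel_length A N D) < (m + 2 * \<delta>) * real (card D)"
        using \<T>D(4)[OF that] by linarith
      show "0 < (m + 2 * \<delta>) * real (card D)"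
        using m \<delta> \<T>D(3)[OF that] by (intro mult_pos_pos) auto
    qed
    finally show ?thesis
      unfolding l2_eq_INF_fin_subsets[OF MR submodule_in_nonempty_subsets[OF N] trans_sum_in_fin_subsets[OF A \<T>D(1,2)[OF that]]]
      by (auto simp: INF_less_iff intro: less_imp_le)
  qed
  then obtain Bf where Bf: "\<And>D. D \<in> \<T> \<Longrightarrow> Bf D \<in> fin_subsets N"
      "\<And>D. D \<in> \<T> \<Longrightarrow> l2 MR (trans_sum A D) (Bf D) \<le> ennreal ((m + 2 * \<delta>) * real (card D))"
    by metis
  define B where "B = insert \<zero>\<^bsub>M\<^esub> (\<Union>D\<in>\<T>. Bf D)"
  have B: "B \<in> fin_subsets0 M N"
    using Bf(1) \<T>(1) N_facts(2) unfolding B_def fin_subsets0_def fin_subsets_def by blast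
  have B': "B \<in> fin_subsets0 M (carrier M)" "B \<subseteq> carrier M" "\<zero>\<^bsub>M\<^esub> \<in> B"
    using B N_facts(1) by (auto simp: fin_subsets0_def)
  have l2_B: "l2 MR (trans_sum A D) B \<le> ennreal ((m + 2 * \<delta>) * real (card D))" if "D \<in> \<T>" for D
  proof -
    have "l2 MR (trans_sum A D) B \<le> l2 MR (trans_sum A D) (Bf D)"
    proof (rule l2_antimono[OF MR])
      show "Bf D \<subseteq> B"
        using that unfolding B_def by blast
      show "Bf D \<in> nonempty_subsets (carrier MR)"
        using Bf(1)[OF that] N_facts(1) by (auto simp: fin_subsets_def nonempty_subsets_def)
      show "B \<in> nonempty_subsets (carrier MR)"
        using B' by (auto simp: nonempty_subsets_def)
    qed (intro trans_sum_in_fin_subsets[OF A] \<T>D that)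
    with Bf(2)[OF that] show ?thesis by (rule order_trans[rotated])
  qed
  have "l2 MR (trans_sum A F) (trans_sum B F) \<le> ennreal ((m + \<epsilon>) * real (card F))"
    if F: "F \<in> fin_subsets (carrier G)" and F_inv: "invariant_set G K \<eta> F" for F
  proof -
    have F': "F \<subseteq> carrier G" "finite F"
      using F by (auto simp: fin_subsets_def)
    from tiling[OF F F_inv] obtain \<tau> C where *: "G.quasi_tiling \<delta> \<delta> \<T> F \<tau> C"
      by blast
    let ?U = "G.tiled_region \<tau> C"
    let ?W = "F - ?U"
    have C: "C \<subseteq> F" "?U \<subseteq> F" "real (card ?W) \<le> \<delta> * real (card F)" "\<tau> ` C \<subseteq> \<T>"
      using * unfolding G.quasi_tiling_def by auto
    have C': "finite C" "C \<subseteq> carrier G" and U: "finite ?U" "?U \<subseteq> carrier G"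
      and W: "finite ?W" "?W \<subseteq> carrier G"
      using C F' by (auto intro: finite_subset)
    have \<tau>: "\<tau> c \<in> \<T>" if "c \<in> C" for c
      using that C(4) by auto
    have W_0: "{\<zero>\<^bsub>M\<^esub>} \<in> nonempty_subsets (carrier MR)"
      using zero_in_nonempty_subsets by simp
    have split_F: "trans_sum A F = trans_sum A ?U <+>\<^bsub>MR\<^esub> trans_sum A ?W"
    proof -
      have "?U \<union> ?W = F"
        using C by auto
      then show ?thesis
        using trans_sum_Un_disjoint[OF fin_subsets0D(1)[OF A] U W] by simp
    qed
    have add_zero: "trans_sum B C <+>\<^bsub>MR\<^esub> {\<zero>\<^bsub>M\<^esub>} = trans_sum B C"
      using M.M.set_add_commute[of "trans_sum B C" "{\<zero>\<^bsub>M\<^esub>}"] M.M.set_add_zero[of "trans_sum B C"]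
        trans_sum_closed[OF B'(2) C'] by simp
    have "l2 MR (trans_sum A F) (trans_sum B F) \<le> l2 MR (trans_sum A F) (trans_sum B C)"
      using C' C F' trans_sum_mono_right[OF B'(2,3) C(1)]
      by (intro l2_antimono[OF MR] trans_sum_in_nonempty_subsets[OF B'(1)] trans_sum_in_fin_subsets[OF A]) auto
    also have "l2 MR (trans_sum A F) (trans_sum B C)
        = l2 MR (trans_sum A ?U <+>\<^bsub>MR\<^esub> trans_sum A ?W) (trans_sum B C <+>\<^bsub>MR\<^esub> {\<zero>\<^bsub>M\<^esub>})"
      by (simp only: split_F add_zero)
    also have "\<dots> \<le> l2 MR (trans_sum A ?U) (trans_sum B C) + l2 MR (trans_sum A ?W) {\<zero>\<^bsub>M\<^esub>}"
      by (intro l2_set_add[OF MR] trans_sum_in_nonempty_subsets[OF A] trans_sum_in_nonempty_subsets[OF B'(1)] W_0 U W C')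
    also have "\<dots> \<le> ennreal ((m + 2 * \<delta>) / (1 - \<delta>) * real (card F)) + ennreal (\<delta> * b * real (card F))"
    proof (rule add_mono)
      have "l2 MR (trans_sum A ?U) (trans_sum B C) \<le> (\<Sum>c\<in>C. l2 MR (trans_sum A (\<tau> c)) B)"
        using \<T>D(1,2) \<tau> by (intro rel_length_tiled_region[OF A B'(1) C']) blast
      also have "\<dots> \<le> (\<Sum>c\<in>C. ennreal ((m + 2 * \<delta>) * real (card (\<tau> c))))"
        by (intro sum_mono l2_B \<tau>)
      also have "\<dots> = ennreal (\<Sum>c\<in>C. (m + 2 * \<delta>) * real (card (\<tau> c)))"
        using m \<delta> by (intro sum_ennreal) simp
      also have "\<dots> \<le> ennreal ((m + 2 * \<delta>) / (1 - \<delta>) * real (card F))"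
        using m \<delta> F'(2)
        by (intro ennreal_leI G.quasi_tiling_sum_le[OF _ _ _ *, where h = "\<lambda>D. (m + 2 * \<delta>) * real (card D)"]) auto
      finally show "l2 MR (trans_sum A ?U) (trans_sum B C) \<le> ennreal ((m + 2 * \<delta>) / (1 - \<delta>) * real (card F))" .
      have "b * real (card ?W) \<le> b * (\<delta> * real (card F))"
        using C(3) b by (rule mult_left_mono)
      then show "l2 MR (trans_sum A ?W) {\<zero>\<^bsub>M\<^esub>} \<le> ennreal (\<delta> * b * real (card F))"
        using length_trans_sum_le_card[OF A W] unfolding b_def[symmetric]
        by (elim order_trans) (intro ennreal_leI, simp add: ac_simps)
    qed
    also have "\<dots> = ennreal (((m + 2 * \<delta>) / (1 - \<delta>) + \<delta> * b) * real (card F))"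
      using m b \<delta> by (simp add: ennreal_plus[symmetric] algebra_simps del: ennreal_plus)
    also have "\<dots> \<le> ennreal ((m + \<epsilon>) * real (card F))"
      using \<delta> by (intro ennreal_leI mult_right_mono) auto
    finally show ?thesis .
  qed
  then have "\<forall>\<^sub>F F in folner_filter G.
      l2 MR (trans_sum A F) (trans_sum B F) \<le> ennreal ((m + \<epsilon>) * real (card F))"
    unfolding G.eventually_folner_filter using K by blast
  with B show ?thesis
    unfolding m_def by blast
qed

lemma rel_mean_le_add:
  assumes A: "A \<in> fin_subsets0 M (carrier M)" and N: "submodule N (group_ring R G) M"
    and \<epsilon>: "0 < \<epsilon>"
  shows "\<exists>B\<in>fin_subsets0 M N.
    rel_mean A {\<zero>\<^bsub>M\<^esub>} \<le> rel_mean B {\<zero>\<^bsub>M\<^esub>} + rel_mean A N + \<epsilon>"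
proof -
  note MR = left_module_restrict_scalars
  from rel_length_approximation[OF A N \<epsilon>] obtain B where B: "B \<in> fin_subsets0 M N"
    and B_ev: "\<forall>\<^sub>F F in folner_filter G.
      l2 MR (trans_sum A F) (trans_sum B F) \<le> ennreal ((rel_mean A N + \<epsilon>) * real (card F))"
    by blast
  have B': "B \<in> fin_subsets0 M (carrier M)"
    using B submodule_facts(1)[OF N] by (auto simp: fin_subsets0_def)
  let ?f = "\<lambda>A F. enn2real (rel_length A {\<zero>\<^bsub>M\<^esub>} F)"
  have "\<forall>\<^sub>F F in folner_filter G.
      ?f A F / real (card F) \<le> ?f B F / real (card F) + (rel_mean A N + \<epsilon>)"
    using G.eventually_folner_fin_subsets B_ev
  proof eventually_elim
    case (elim F)
    then have F: "finite F" "F \<subseteq> carrier G" and F0: "0 < real (card F)"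
      by (auto simp: fin_subsets_def card_gt_0_iff)
    have zero_fin: "{\<zero>\<^bsub>M\<^esub>} \<in> fin_subsets (carrier MR)"
      by (simp add: fin_subsets_def)
    have nonneg: "0 \<le> (rel_mean A N + \<epsilon>) * real (card F)"
      using rel_mean_nonneg[OF A N] \<epsilon> by simp
    have fB: "rel_length B {\<zero>\<^bsub>M\<^esub>} F = ennreal (?f B F)"
      using rel_length_finite[OF B' submodule_zero F] by simp
    have "rel_length A {\<zero>\<^bsub>M\<^esub>} F
        \<le> l2 MR (trans_sum A F) (trans_sum B F) + rel_length B {\<zero>\<^bsub>M\<^esub>} F"
      using F by (intro l2_triangle[OF MR] trans_sum_in_fin_subsets[OF A] trans_sum_in_fin_subsets[OF B'] zero_fin)
    also have "\<dots> \<le> ennreal ((rel_mean A N + \<epsilon>) * real (card F)) + ennreal (?f B F)"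
      using elim(2) fB by (intro add_mono) auto
    also have "\<dots> = ennreal ((rel_mean A N + \<epsilon>) * real (card F) + ?f B F)"
      using nonneg by (intro ennreal_plus[symmetric]) auto
    finally have "?f A F \<le> (rel_mean A N + \<epsilon>) * real (card F) + ?f B F"
      using nonneg by (intro enn2real_leI add_nonneg_nonneg) auto
    then show ?case
      using F0 by (simp add: field_simps)
  qed
  then have "rel_mean A {\<zero>\<^bsub>M\<^esub>} \<le> rel_mean B {\<zero>\<^bsub>M\<^esub>} + (rel_mean A N + \<epsilon>)"
    by (rule tendsto_le[OF G.folner_filter_neq_bot[OF amenable]
        tendsto_add[OF rel_mean_tendsto[OF B' submodule_zero] tendsto_const]
        rel_mean_tendsto[OF A submodule_zero]])
  with B show ?thesis
    by (auto simp: add.assoc)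
qed


section \<open>The addition formula\<close>

lemma mean_length_set_eq_rel_mean:
  assumes A: "A \<in> fin_subsets0 M (carrier M)"
  shows "mean_length_set R G l M A = ennreal (rel_mean A {\<zero>\<^bsub>M\<^esub>})"
proof -
  have "rel_length A {\<zero>\<^bsub>M\<^esub>} F = l MR (trans_sum A F)" if "F \<in> fin_subsets (carrier G)" for F
    using l2_zero_right[OF left_module_restrict_scalars trans_sum_in_nonempty_subsets[OF A, of F]] that
    by (simp add: fin_subsets_def)
  then have "amenable_limit G (\<lambda>F. enn2real (l MR (trans_sum A F)) / real (card F))
      (rel_mean A {\<zero>\<^bsub>M\<^esub>})"
    using amenable_limit_rel_mean[OF A submodule_zero] by (subst G.amenable_limit_cong) auto
  then show ?thesis
    unfolding mean_length_set_def by (simp add: G.the_amenable_limit[OF amenable])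
qed

text \<open>
  The value of \<open>ext_len l\<close> on the quotient is computed in a copy \<open>N'\<close> of it inside the universe
  \<open>'u\<close>; coset representatives show that an embedding exists.
\<close>

lemma quotient_representation:
  assumes N: "submodule N (group_ring R G) M"
  obtains N' :: "('r, 'u) module" and \<pi> where
    "left_module R N'" "\<pi> \<in> left_module_hom R MR N'" "\<pi> ` carrier MR = carrier N'" "a_kernel MR N' \<pi> = N"
    "\<And>Y. ext_len l (restrict_scalars R G (quot_module M N)) ((\<lambda>x. N +>\<^bsub>M\<^esub> x) ` Y) = l N' (\<pi> ` Y)"
proof -
  let ?Q = "quot_module M N"
  let ?QR = "restrict_scalars R G ?Q"
  let ?q = "\<lambda>x. N +>\<^bsub>M\<^esub> x"
  note M = M.left_module_axioms
  have "group_ring_module R G ?Q"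
    using group_ring_module_axioms left_module_quot_module[OF M N]
    unfolding group_ring_module_def by blast
  then interpret Q: group_ring_module R G ?Q .
  have Q: "carrier ?Q = ?q ` carrier M"
    by (rule quot_module_carrier[OF M N])
  define f where "f = (SOME f :: 'u set \<Rightarrow> 'u. inj_on f (carrier ?QR))"
  have "inj_on (inv_into (carrier M) ?q) (carrier ?QR)"
    by (simp add: Q inj_on_inv_into)
  then have "inj_on f (carrier ?QR)"
    unfolding f_def by (rule someI[where P = "\<lambda>f. inj_on f (carrier ?QR)"])
  then have f: "inj_on f (carrier ?QR)" "inj_on f (carrier ?Q)"
    by simp_all
  let ?N' = "copy_module f ?QR"
  show thesis
  proof (rule that[of ?N' "f \<circ> ?q"])
    show "left_module R ?N'"
      using Q.left_module_restrict_scalars f(1) by (rule left_module_copy_module)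
    have qQ: "?q x \<in> carrier ?QR" if "x \<in> carrier M" for x
      using that Q by simp
    show "f \<circ> ?q \<in> left_module_hom R MR ?N'"
      unfolding left_module_hom_def
    proof (intro CollectI conjI ballI)
      show "f \<circ> ?q \<in> carrier MR \<rightarrow> carrier ?N'"
        using qQ by (auto simp: copy_module_simps)
      fix x assume x: "x \<in> carrier MR"
      {
        fix y assume y: "y \<in> carrier MR"
        show "(f \<circ> ?q) (x \<oplus>\<^bsub>MR\<^esub> y) = (f \<circ> ?q) x \<oplus>\<^bsub>?N'\<^esub> (f \<circ> ?q) y"
          using x y qQ copy_module_add[OF f(1), of "?q x" "?q y"] by (simp add: coset_add[OF M N])
      }
      fix r assume r: "r \<in> carrier R"
      show "(f \<circ> ?q) (r \<odot>\<^bsub>MR\<^esub> x) = r \<odot>\<^bsub>?N'\<^esub> (f \<circ> ?q) x"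
        using x r qQ copy_module_smult[OF f(1), of "?q x" r]
        by (simp add: coset_smult[OF M N] single_closed)
    qed
    show "(f \<circ> ?q) ` carrier MR = carrier ?N'"
      by (simp add: copy_module_simps Q image_comp)
    have "f (?q x) = f \<zero>\<^bsub>?Q\<^esub> \<longleftrightarrow> x \<in> N" if "x \<in> carrier M" for x
      using inj_on_eq_iff[OF f(2), of "?q x" "\<zero>\<^bsub>?Q\<^esub>"] qQ[OF that] coset_eq_zero_iff[OF M N that]
      by simp
    then show "a_kernel MR ?N' (f \<circ> ?q) = N"
      using submodule_facts(1)[OF N] by (auto simp: a_kernel_def' copy_module_simps)
    show "ext_len l ?QR (?q ` Y) = l ?N' ((f \<circ> ?q) ` Y)" for Y
      by (simp add: ext_len_def f_def Let_def image_comp)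
  qed
qed

text \<open>
  The projection takes sums of translates in \<open>M\<close> to sums of translates in the quotient, and its
  kernel is \<open>N\<close>.
\<close>

lemma ext_len_quotient:
  assumes N: "submodule N (group_ring R G) M"
    and A: "A \<in> fin_subsets0 M (carrier M)" and F: "finite F" "F \<subseteq> carrier G"
  shows "ext_len l (restrict_scalars R G (quot_module M N))
      (sum_translates R G (quot_module M N) ((\<lambda>x. N +>\<^bsub>M\<^esub> x) ` A) F)
    = rel_length A N F"
proof -
  let ?q = "\<lambda>x. N +>\<^bsub>M\<^esub> x"
  note M = M.left_module_axioms
  obtain N' \<pi> where N': "left_module R N'" "\<pi> \<in> left_module_hom R MR N'" "\<pi> ` carrier MR = carrier N'"
      "a_kernel MR N' \<pi> = N"
    and ext: "\<And>Y. ext_len l (restrict_scalars R G (quot_module M N)) (?q ` Y) = l N' (\<pi> ` Y)"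
    using quotient_representation[OF N] by blast
  have "group_ring_module R G (quot_module M N)"
    using group_ring_module_axioms left_module_quot_module[OF M N]
    unfolding group_ring_module_def by blast
  then have "?q ` trans_sum A F = sum_translates R G (quot_module M N) (?q ` A) F"
    using group_ring_module_axioms fin_subsets0D(1)[OF A] F
    by (intro trans_sum_image)
      (simp_all add: quot_module_carrier[OF M N] coset_zero[OF M N] coset_add[OF M N]
        coset_smult[OF M N] group_action_def single_closed)
  then have "ext_len l (restrict_scalars R G (quot_module M N))
      (sum_translates R G (quot_module M N) (?q ` A) F) = l N' (\<pi> ` trans_sum A F)"
    using ext[of "trans_sum A F"] by simp
  also have "\<dots> = rel_length A N F"
    using l2_kernel[OF left_module_restrict_scalars N'(1,2,3) trans_sum_in_fin_subsets[OF A F]] N'(4) by simp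
  finally show ?thesis .
qed

lemma mean_length_set_quotient:
  assumes N: "submodule N (group_ring R G) M" and A: "A \<in> fin_subsets0 M (carrier M)"
  shows "mean_length_set R G (ext_len l) (quot_module M N) ((\<lambda>x. N +>\<^bsub>M\<^esub> x) ` A)
    = ennreal (rel_mean A N)"
proof -
  let ?h = "\<lambda>F. ext_len l (restrict_scalars R G (quot_module M N))
    (sum_translates R G (quot_module M N) ((\<lambda>x. N +>\<^bsub>M\<^esub> x) ` A) F)"
  have "?h F = rel_length A N F" if "F \<in> fin_subsets (carrier G)" for F
    using that by (intro ext_len_quotient[OF N A]) (auto simp: fin_subsets_def)
  then have "amenable_limit G (\<lambda>F. enn2real (?h F) / real (card F)) (rel_mean A N)"
    using amenable_limit_rel_mean[OF A N] by (subst G.amenable_limit_cong) auto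
  then show ?thesis
    unfolding mean_length_set_def by (simp add: G.the_amenable_limit[OF amenable])
qed

lemma rel_mean_superadditive:
  assumes strong: "strong_quotient_property R l"
    and N: "submodule N (group_ring R G) M"
    and A: "A \<in> fin_subsets0 M (carrier M)" and B: "B \<in> fin_subsets0 M N"
    and AB: "A <+>\<^bsub>M\<^esub> B \<in> fin_subsets0 M (carrier M)"
  shows "rel_mean A N + rel_mean B {\<zero>\<^bsub>M\<^esub>} \<le> rel_mean (A <+>\<^bsub>M\<^esub> B) {\<zero>\<^bsub>M\<^esub>}"
proof -
  note MR = left_module_restrict_scalars
  have B': "B \<in> fin_subsets0 M (carrier M)"
    using B submodule_facts(1)[OF N] by (auto simp: fin_subsets0_def)
  obtain N' :: "('r, 'u) module" and \<pi> where N': "left_module R N'" "\<pi> \<in> left_module_hom R MR N'"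
      "\<pi> ` carrier MR = carrier N'" "a_kernel MR N' \<pi> = N"
    using quotient_representation[OF N] by blast
  let ?f = "\<lambda>A N F. enn2real (rel_length A N F)"
  have "\<forall>\<^sub>F F in folner_filter G. ?f A N F / real (card F) + ?f B {\<zero>\<^bsub>M\<^esub>} F / real (card F)
      \<le> ?f (A <+>\<^bsub>M\<^esub> B) {\<zero>\<^bsub>M\<^esub>} F / real (card F)"
    using G.eventually_folner_fin_subsets
  proof eventually_elim
    case (elim F)
    then have F: "finite F" "F \<subseteq> carrier G"
      by (auto simp: fin_subsets_def)
    have zero_mem: "\<zero>\<^bsub>M\<^esub> \<in> trans_sum A F" "\<zero>\<^bsub>M\<^esub> \<in> trans_sum B F"
      using zero_mem_trans_sum F fin_subsets0D[OF A] fin_subsets0D[OF B'] by blast+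
    have "trans_sum B F \<subseteq> N"
      using trans_sum_submodule[OF group_ring_module_axioms N fin_subsets0D(1)[OF B] F]
        group_ring_module.trans_sum_closed[of R G "M\<lparr>carrier := N\<rparr>" B F] fin_subsets0D(1)[OF B] F
        left_module_submodule[OF M.left_module_axioms N] group_ring_module_axioms
      by (simp add: group_ring_module_def)
    then have BN: "trans_sum B F \<in> fin_subsets0 MR (a_kernel MR N' \<pi>)"
      using N'(4) zero_mem trans_sum_in_fin_subsets[OF B' F] by (simp add: fin_subsets0_def fin_subsets_def)
    have AM: "trans_sum A F \<in> fin_subsets0 MR (carrier MR)"
      using zero_mem trans_sum_in_fin_subsets[OF A F] by (simp add: fin_subsets0_def fin_subsets_def)
    have "rel_length A N F + rel_length B {\<zero>\<^bsub>M\<^esub>} F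
        = l N' (\<pi> ` trans_sum A F) + l MR (trans_sum B F)"
      using l2_kernel[OF MR N'(1,2,3) trans_sum_in_fin_subsets[OF A F]] N'(4)
        l2_zero_right[OF MR trans_sum_in_nonempty_subsets[OF B' F]] by simp
    also have "\<dots> \<le> l MR (trans_sum A F <+>\<^bsub>MR\<^esub> trans_sum B F)"
      using strong MR N'(1,2) AM BN unfolding strong_quotient_property_def by blast
    also have "\<dots> = l MR (trans_sum (A <+>\<^bsub>M\<^esub> B) F)"
      using fin_subsets0D(1)[OF A] fin_subsets0D(1)[OF B'] F by (simp add: trans_sum_set_add)
    also have "\<dots> = rel_length (A <+>\<^bsub>M\<^esub> B) {\<zero>\<^bsub>M\<^esub>} F"
      using l2_zero_right[OF MR trans_sum_in_nonempty_subsets[OF AB F]] by simp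
    finally have "enn2real (rel_length A N F + rel_length B {\<zero>\<^bsub>M\<^esub>} F) \<le> ?f (A <+>\<^bsub>M\<^esub> B) {\<zero>\<^bsub>M\<^esub>} F"
      using rel_length_finite[OF AB submodule_zero F] by (intro enn2real_mono) auto
    then have "?f A N F + ?f B {\<zero>\<^bsub>M\<^esub>} F \<le> ?f (A <+>\<^bsub>M\<^esub> B) {\<zero>\<^bsub>M\<^esub>} F"
      using rel_length_finite[OF A N F] rel_length_finite[OF B' submodule_zero F]
      by (simp add: enn2real_add)
    then show ?case
      by (simp add: add_divide_distrib[symmetric] divide_right_mono)
  qed
  then show ?thesis
    by (rule tendsto_le[OF G.folner_filter_neq_bot[OF amenable]
        rel_mean_tendsto[OF AB submodule_zero]
        tendsto_add[OF rel_mean_tendsto[OF A N] rel_mean_tendsto[OF B' submodule_zero]]])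
qed

theorem mean_length_addition:
  assumes strong: "strong_quotient_property R l"
    and N: "submodule N (group_ring R G) M" and P: "submodule P (group_ring R G) M" and NP: "N \<subseteq> P"
  shows "mean_length R G l M P = mean_length R G l M N +
    mean_length R G (ext_len l) (quot_module M N) (carrier (quot_module (M\<lparr>carrier := P\<rparr>) N))"
proof -
  let ?z = "{\<zero>\<^bsub>M\<^esub>}"
  have sub: "A \<in> fin_subsets0 M (carrier M)" if "A \<in> fin_subsets0 M P" for A
    using that submodule_facts(1)[OF P] by (auto simp: fin_subsets0_def)
  have subN: "A \<in> fin_subsets0 M P" if "A \<in> fin_subsets0 M N" for A
    using that NP by (auto simp: fin_subsets0_def)
  have len_P: "mean_length R G l M P = (SUP A\<in>fin_subsets0 M P. ennreal (rel_mean A ?z))"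
    unfolding mean_length_def by (intro SUP_cong refl mean_length_set_eq_rel_mean sub)
  have len_N: "mean_length R G l M N = (SUP A\<in>fin_subsets0 M N. ennreal (rel_mean A ?z))"
    unfolding mean_length_def by (intro SUP_cong refl mean_length_set_eq_rel_mean sub subN)
  have len_Q: "mean_length R G (ext_len l) (quot_module M N) (carrier (quot_module (M\<lparr>carrier := P\<rparr>) N))
      = (SUP A\<in>fin_subsets0 M P. ennreal (rel_mean A N))"
    unfolding mean_length_def
      fin_subsets0_quot_module[OF M.left_module_axioms N submodule_facts(1,2)[OF P]] image_image
    by (intro SUP_cong refl mean_length_set_quotient[OF N] sub)
  have ne: "fin_subsets0 M N \<noteq> {}" "fin_subsets0 M P \<noteq> {}"
    using submodule_facts(2)[OF N] submodule_facts(2)[OF P]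
    by (auto simp: fin_subsets0_def intro!: exI[of _ ?z])
  show ?thesis
    unfolding len_P len_N len_Q
  proof (rule antisym)
    show "(SUP A\<in>fin_subsets0 M P. ennreal (rel_mean A ?z))
        \<le> (SUP A\<in>fin_subsets0 M N. ennreal (rel_mean A ?z)) + (SUP A\<in>fin_subsets0 M P. ennreal (rel_mean A N))"
      (is "_ \<le> ?S1 + ?S2")
    proof (rule SUP_least, rule ennreal_le_epsilon)
      fix A and e :: real assume A: "A \<in> fin_subsets0 M P" and e: "0 < e"
      obtain B where B: "B \<in> fin_subsets0 M N"
          "rel_mean A ?z \<le> rel_mean B ?z + rel_mean A N + e"
        using rel_mean_le_add[OF sub[OF A] N e] by blast
      have "ennreal (rel_mean A ?z) \<le> ennreal (rel_mean B ?z + rel_mean A N + e)"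
        using B(2) by (rule ennreal_leI)
      also have "\<dots> = ennreal (rel_mean B ?z) + ennreal (rel_mean A N) + ennreal e"
        using rel_mean_nonneg[OF sub[OF subN[OF B(1)]] submodule_zero] rel_mean_nonneg[OF sub[OF A] N] e
        by simp
      also have "\<dots> \<le> ?S1 + ?S2 + ennreal e"
        using A B(1) by (intro add_mono SUP_upper order_refl)
      finally show "ennreal (rel_mean A ?z) \<le> ?S1 + ?S2 + ennreal e" .
    qed
    have "ennreal (rel_mean B ?z) + ennreal (rel_mean A N) \<le> (SUP A\<in>fin_subsets0 M P. ennreal (rel_mean A ?z))"
      if A: "A \<in> fin_subsets0 M P" and B: "B \<in> fin_subsets0 M N" for A B
    proof -
      have AB: "A <+>\<^bsub>M\<^esub> B \<in> fin_subsets0 M P"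
        using A subN[OF B] by (rule fin_subsets0_set_add[OF P])
      have "ennreal (rel_mean B ?z) + ennreal (rel_mean A N) = ennreal (rel_mean A N + rel_mean B ?z)"
        using rel_mean_nonneg[OF sub[OF subN[OF B]] submodule_zero] rel_mean_nonneg[OF sub[OF A] N]
        by (simp add: add.commute)
      also have "\<dots> \<le> ennreal (rel_mean (A <+>\<^bsub>M\<^esub> B) ?z)"
        using rel_mean_superadditive[OF strong N sub[OF A] B sub[OF AB]] by (rule ennreal_leI)
      also have "\<dots> \<le> (SUP A\<in>fin_subsets0 M P. ennreal (rel_mean A ?z))"
        using AB by (rule SUP_upper)
      finally show ?thesis .
    qed
    then have "(SUP A\<in>fin_subsets0 M P. SUP B\<in>fin_subsets0 M N. ennreal (rel_mean B ?z) + ennreal (rel_mean A N))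
        \<le> (SUP A\<in>fin_subsets0 M P. ennreal (rel_mean A ?z))"
      by (intro SUP_least)
    then show "(SUP A\<in>fin_subsets0 M N. ennreal (rel_mean A ?z)) + (SUP A\<in>fin_subsets0 M P. ennreal (rel_mean A N))
        \<le> (SUP A\<in>fin_subsets0 M P. ennreal (rel_mean A ?z))"
      by (simp add: ennreal_SUP_add_left ennreal_SUP_add_right ne)
  qed
qed

text \<open>
  The sums of translates of a subset of \<open>N\<close> agree in \<open>N\<close> and in \<open>M\<close>, as do their lengths by
  independence of the ambient module.
\<close>

lemma mean_length_submodule:
  assumes indep: "independent_of_ambient R l" and N: "submodule N (group_ring R G) M"
  shows "mean_length R G l (M\<lparr>carrier := N\<rparr>) N = mean_length R G l M N"
proof -
  note N_facts = submodule_facts[OF N]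
  interpret N: submodule N "group_ring R G" M by fact
  have "subgroup N (add_monoid MR)"
    using N.subgroup_axioms by (simp add: restrict_scalars_def subgroup_def m_inv_def)
  then have sub: "submodule N R MR"
    using N.smult_closed single_closed by (simp add: submodule_def submodule_axioms_def)
  have restrict: "restrict_scalars R G (M\<lparr>carrier := N\<rparr>) = MR\<lparr>carrier := N\<rparr>"
    by (simp add: restrict_scalars_def)
  have gm: "group_ring_module R G (M\<lparr>carrier := N\<rparr>)"
    using left_module_submodule[OF M.left_module_axioms N] group_ring_module_axioms
    unfolding group_ring_module_def by blast
  have "mean_length_set R G l (M\<lparr>carrier := N\<rparr>) A = mean_length_set R G l M A"
    if A: "A \<in> fin_subsets0 M N" for A
  proof -
    have "l (restrict_scalars R G (M\<lparr>carrier := N\<rparr>)) (sum_translates R G (M\<lparr>carrier := N\<rparr>) A F)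
        = l MR (trans_sum A F)" if F: "F \<in> fin_subsets (carrier G)" for F
    proof -
      have F': "finite F" "F \<subseteq> carrier G"
        using F by (auto simp: fin_subsets_def)
      have eq: "sum_translates R G (M\<lparr>carrier := N\<rparr>) A F = trans_sum A F"
        by (rule trans_sum_submodule[OF group_ring_module_axioms N fin_subsets0D(1)[OF A] F'])
      have "trans_sum A F \<subseteq> N"
        using group_ring_module.trans_sum_closed[OF gm _ F', of A] fin_subsets0D(1)[OF A] eq by simp
      then have "trans_sum A F \<in> nonempty_subsets N"
        using trans_sum_nonempty[of A F] fin_subsets0D(2)[OF A] by (auto simp: nonempty_subsets_def)
      then show ?thesis
        using indep left_module_restrict_scalars sub unfolding independent_of_ambient_def eq restrict
        by blast
    qed
    then have "amenable_limit G (\<lambda>F. enn2real (l (restrict_scalars R G (M\<lparr>carrier := N\<rparr>))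
          (sum_translates R G (M\<lparr>carrier := N\<rparr>) A F)) / real (card F))
        = amenable_limit G (\<lambda>F. enn2real (l MR (trans_sum A F)) / real (card F))"
      by (intro ext G.amenable_limit_cong) simp
    then show ?thesis
      by (simp add: mean_length_set_def)
  qed
  moreover have "fin_subsets0 (M\<lparr>carrier := N\<rparr>) N = fin_subsets0 M N"
    by (simp add: fin_subsets0_def)
  ultimately show ?thesis
    by (simp add: mean_length_def)
qed

end

theorem theorem1p2:
  fixes R :: "('r, 'p) ring_scheme"
    and G :: "('g, 'q) monoid_scheme"
    and l :: "('r, 'u) module \<Rightarrow> 'u set \<Rightarrow> ennreal"
  assumes "infinite (UNIV :: 'u set)"
    and "ring R"
    and "group G"
    and "amenable G"
    and "weak_length_function R l"
    and "strong_quotient_property R l"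
    and "\<exists>l2. proper_upgrading R l l2"
  shows "(\<forall>(M3 :: ('g \<Rightarrow> 'r, 'u) module) M2 M1.
            left_module (group_ring R G) M3 \<and>
            submodule M2 (group_ring R G) M3 \<and> submodule M1 (group_ring R G) M3 \<and> M1 \<subseteq> M2 \<and>
            locally_finite_module R G l (M3\<lparr>carrier := M1\<rparr>) \<and>
            locally_finite_module R G l (M3\<lparr>carrier := M2\<rparr>) \<and>
            locally_finite_module R G l M3 \<longrightarrow>
            mean_length R G l M3 M2 =
              mean_length R G l M3 M1 +
              mean_length R G (ext_len l)
                (quot_module M3 M1) (carrier (quot_module (M3\<lparr>carrier := M2\<rparr>) M1))) \<and>
         (independent_of_ambient R l \<longrightarrow>
          (\<forall>(M2 :: ('g \<Rightarrow> 'r, 'u) module) M1.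
            left_module (group_ring R G) M2 \<and> submodule M1 (group_ring R G) M2 \<and>
            locally_finite_module R G l (M2\<lparr>carrier := M1\<rparr>) \<and>
            locally_finite_module R G l M2 \<longrightarrow>
            mean_length R G l M2 (carrier M2) =
              mean_length R G l (M2\<lparr>carrier := M1\<rparr>) M1 +
              mean_length R G (ext_len l)
                (quot_module M2 M1) (carrier (quot_module M2 M1))))"
proof -
  obtain l2 where l2: "proper_upgrading R l l2"
    using assms(7) by blast
  have locale_M: "proper_length_module R l l2 G M"
    if "left_module (group_ring R G) M" "locally_finite_module R G l M"
    for M :: "('g \<Rightarrow> 'r, 'u) module"
    using that assms l2
    by (simp add: proper_length_module_def proper_length_def group_ring_module_def
        proper_length_module_axioms_def)
  have whole: "submodule (carrier M) (group_ring R G) M"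
    if "left_module (group_ring R G) M" for M :: "('g \<Rightarrow> 'r, 'u) module"
  proof -
    interpret left_module "group_ring R G" M by fact
    show ?thesis
      using M.add.subgroup_self smult_closed by (simp add: submodule_def submodule_axioms_def)
  qed
  show ?thesis
  proof (intro conjI impI allI; elim conjE)
    fix M3 :: "('g \<Rightarrow> 'r, 'u) module" and M2 M1
    assume M: "left_module (group_ring R G) M3" "locally_finite_module R G l M3"
      and N: "submodule M1 (group_ring R G) M3" "submodule M2 (group_ring R G) M3" "M1 \<subseteq> M2"
    show "mean_length R G l M3 M2 = mean_length R G l M3 M1 +
        mean_length R G (ext_len l) (quot_module M3 M1) (carrier (quot_module (M3\<lparr>carrier := M2\<rparr>) M1))"
      by (rule proper_length_module.mean_length_addition[OF locale_M[OF M] assms(6) N])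
  next
    fix M2 :: "('g \<Rightarrow> 'r, 'u) module" and M1
    assume indep: "independent_of_ambient R l"
      and M: "left_module (group_ring R G) M2" "locally_finite_module R G l M2"
      and N: "submodule M1 (group_ring R G) M2"
    interpret M: proper_length_module R l l2 G M2
      by (rule locale_M[OF M])
    have "mean_length R G l M2 (carrier M2) = mean_length R G l M2 M1 +
        mean_length R G (ext_len l) (quot_module M2 M1) (carrier (quot_module (M2\<lparr>carrier := carrier M2\<rparr>) M1))"
      by (rule M.mean_length_addition[OF assms(6) N whole[OF M(1)] M.submodule_facts(1)[OF N]])
    then show "mean_length R G l M2 (carrier M2) = mean_length R G l (M2\<lparr>carrier := M1\<rparr>) M1 +
        mean_length R G (ext_len l) (quot_module M2 M1) (carrier (quot_module M2 M1))"
      by (simp add: M.mean_length_submodule[OF indep N])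
  qed
qed

end
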